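(* Let $G$ be a compact abelian group and let $D$ be a dense subgroup of $G$ that determines $G$. Then $D$ is projectively $w$-compact.
   Context: All spaces and topological groups are assumed to be Hausdorff. For an abelian topological group $A$, $\widehat{A}$ denotes the dual group of all continuous characters (continuous homomorphisms $A\to\mathbb{T}$, where $\mathbb{T}$ is the circle group) endowed with the compact-open topology. A dense subgroup $D$ of an abelian topological group $G$ determines $G$ if the restriction homomorphism $\widehat{G}\to\widehat{D}$, $\chi\mapsto\chi\restriction_D$, is a topological isomorphism. $w(X)$ denotes the weight of a space $X$. A space $X$ is $w$-compact if there exists a compact subset $C$ of $X$ with $w(C)=w(X)$. A topological group $G$ is projectively $w$-compact if every (Hausdorff) topological group that is the image of $G$ under a continuous surjective homomorphism is $w$-compact. *)

theory Defs
  imports "HOL-Analysis.Analysis" "HOL-Algebra.Group"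
begin

unbundle cardinal_syntax
no_notation (input) elt_set_eq (infix \<open>=o\<close> 50)

section \<open>Topological groups\<close>

locale topological_group = group G for G (structure) +
  fixes T :: "'a topology"
  assumes topspace_eq: "topspace T = carrier G"
    and continuous_mult: "continuous_map (prod_topology T T) T (\<lambda>(x, y). x \<otimes> y)"
    and continuous_inv: "continuous_map T T (\<lambda>x. inv x)"

definition circle_group :: "complex monoid" where
  "circle_group = \<lparr>carrier = sphere 0 1, mult = (*), one = 1\<rparr>"

definition circle_topology :: "complex topology" where
  "circle_topology = top_of_set (sphere 0 1)"


section \<open>The dual group\<close>

text \<open>HOL functions are total, so continuous maps and characters are taken to be extensional,
  that is, \<^term>\<open>undefined\<close> outside the space.\<close>

definition continuous_maps :: "'a topology \<Rightarrow> 'b topology \<Rightarrow> ('a \<Rightarrow> 'b) set" where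
  "continuous_maps X Y = {f \<in> extensional (topspace X). continuous_map X Y f}"

definition compact_open_topology :: "'a topology \<Rightarrow> 'b topology \<Rightarrow> ('a \<Rightarrow> 'b) topology" where
  "compact_open_topology X Y =
     topology_generated_by
       {{f \<in> continuous_maps X Y. f ` K \<subseteq> U} | K U. compactin X K \<and> openin Y U}"

definition characters :: "('a, 'm) monoid_scheme \<Rightarrow> 'a topology \<Rightarrow> ('a \<Rightarrow> complex) set" where
  "characters G T = hom G circle_group \<inter> continuous_maps T circle_topology"

definition dual_group :: "('a, 'm) monoid_scheme \<Rightarrow> 'a topology \<Rightarrow> ('a \<Rightarrow> complex) monoid" where
  "dual_group G T =
     \<lparr>carrier = characters G T,
      mult = (\<lambda>\<phi> \<psi>. \<lambda>x\<in>carrier G. \<phi> x \<otimes>\<^bsub>circle_group\<^esub> \<psi> x),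
      one = (\<lambda>x\<in>carrier G. \<one>\<^bsub>circle_group\<^esub>)\<rparr>"

definition dual_topology ::
    "('a, 'm) monoid_scheme \<Rightarrow> 'a topology \<Rightarrow> ('a \<Rightarrow> complex) topology" where
  "dual_topology G T = subtopology (compact_open_topology T circle_topology) (characters G T)"

definition dense_subgroup :: "'a set \<Rightarrow> ('a, 'm) monoid_scheme \<Rightarrow> 'a topology \<Rightarrow> bool" where
  "dense_subgroup D G T \<longleftrightarrow> subgroup D G \<and> T closure_of D = topspace T"

text \<open>The subgroup \<open>D\<close> is regarded as the topological group \<open>G\<lparr>carrier := D\<rparr>\<close> with the
  subspace topology.\<close>

definition determines :: "'a set \<Rightarrow> ('a, 'm) monoid_scheme \<Rightarrow> 'a topology \<Rightarrow> bool" where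
  "determines D G T \<longleftrightarrow>
     (let D_grp = G\<lparr>carrier := D\<rparr>; D_top = subtopology T D; r = (\<lambda>\<phi>. restrict \<phi> D) in
        r \<in> iso (dual_group G T) (dual_group D_grp D_top) \<and>
        homeomorphic_map (dual_topology G T) (dual_topology D_grp D_top) r)"


section \<open>Weight and w-compactness\<close>

definition topology_base :: "'a topology \<Rightarrow> 'a set set \<Rightarrow> bool" where
  "topology_base X \<B> \<longleftrightarrow> openin X = arbitrary union_of (\<lambda>U. U \<in> \<B>)"

definition minimal_base :: "'a topology \<Rightarrow> 'a set set \<Rightarrow> bool" where
  "minimal_base X \<B> \<longleftrightarrow>
     topology_base X \<B> \<and> (\<forall>\<B>'. topology_base X \<B>' \<longrightarrow> |\<B>| \<le>o |\<B>'| )"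

text \<open>Cardinals are well-orders, determined only up to order isomorphism; weights are accordingly
  compared by \<^term>\<open>(=o)\<close>. The choice below is harmless by \<open>minimal_base_exists\<close> and
  \<open>weight_eq\<close>.\<close>

definition weight :: "'a topology \<Rightarrow> 'a set rel" where
  "weight X = |SOME \<B>. minimal_base X \<B>|"

lemma minimal_base_exists: "\<exists>\<B>. minimal_base X \<B>"
proof -
  have b: "topology_base X {U. openin X U}"
    unfolding topology_base_def
    by (rule openin_topology_base_unique[THEN iffD2]) auto
  let ?R = "{ |\<B>| | \<B>. topology_base X \<B>}"
  have "?R \<noteq> {}" "\<forall>r\<in>?R. Card_order r"
    using b card_of_Card_order by auto
  from exists_minim_Card_order[OF this] show ?thesis
    unfolding minimal_base_def by auto
qed

lemma weight_eq:
  assumes "minimal_base X \<B>"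
  shows "weight X =o |\<B>|"
proof -
  have "minimal_base X (SOME \<B>. minimal_base X \<B>)"
    using minimal_base_exists by (rule someI_ex)
  then show ?thesis
    using assms unfolding weight_def minimal_base_def ordIso_iff_ordLeq by blast
qed

definition w_compact :: "'a topology \<Rightarrow> bool" where
  "w_compact X \<longleftrightarrow> (\<exists>C. compactin X C \<and> weight (subtopology X C) =o weight X)"

text \<open>HOL cannot quantify over types inside a formula, so the type \<open>'b\<close> of the elements of the
  image group is a parameter. It is left arbitrary in theorems; every image of \<open>G\<close> is isomorphic
  to a quotient of \<open>G\<close>, hence to a group living on the type \<open>'a set\<close> of cosets.\<close>

definition projectively_w_compact ::
    "'b itself \<Rightarrow> ('a, 'm) monoid_scheme \<Rightarrow> 'a topology \<Rightarrow> bool" where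
  "projectively_w_compact _ G T \<longleftrightarrow>
     (\<forall>(H :: 'b monoid) S f.
        topological_group H S \<and> Hausdorff_space S \<and> f \<in> epi G H \<and> continuous_map T S f
        \<longrightarrow> w_compact S)"

end

theory Submission
  imports Defs
begin

text \<open>
  Since \<open>G\<close> is compact, its dual is discrete, because the circle has no small subgroups; hence so is
  the dual of \<open>D\<close>, and there are a compact \<open>K \<subseteq> D\<close> and \<open>\<delta> > 0\<close> such that every nontrivial character
  of \<open>D\<close> moves some point of \<open>K\<close> by at least \<open>\<delta>\<close>. If \<open>f\<close> maps \<open>D\<close> onto \<open>H\<close>, distinct characters of \<open>H\<close>
  are therefore uniformly \<open>\<delta>\<close>-apart on \<open>C = f ` K\<close>, so there are at most \<open>w(C)\<close> of them when there are
  infinitely many. As \<open>H\<close> is precompact and abelian, its characters generate its topology, whence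
  \<open>w(H) \<le> w(C)\<close>; if there are only finitely many characters, \<open>H\<close> is finite.

  That the characters generate the topology is the Peter--Weyl theorem for precompact abelian groups.
  It is proved without Haar measure or compact operators. Von Neumann's mean of a uniformly
  continuous function (the constant uniformly approximated by averages of translates) makes these
  functions a convolution algebra. For a nonzero Hermitian \<open>k\<close> the normalized even convolution powers
  converge uniformly to an idempotent, because their \<open>L\<^sup>2\<close>-norms are logarithmically convex and
  submultiplicative. An idempotent of minimal norm below it is a multiple of a character not
  orthogonal to \<open>k\<close>. Hence the functions \<open>g * g\<^sup>*\<close> are uniform limits of their Fourier series.
\<close>

section \<open>Invariant means on precompact abelian groups\<close>

text \<open>The obstacle is that \<open>H\<close> is only precompact and may be incomplete: Haar
  measure would first require a completion and then a descent back to \<open>H\<close>. Finite nets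
  of translates replace compactness, and uniform continuity replaces continuity. Commutativity
  enters at every stage: translations commute, so two averages can be composed in either order;
  convolution is commutative, so a character is an eigenfunction of every convolution. No space of
  square-integrable functions is formed: the pointwise bound \<open>norm_conv_le_sqnorm\<close>
  turns mean-square Cauchy sequences of convolutions into uniform ones, whose limits are still
  uniformly continuous. The value of a Hermitian idempotent at \<open>\<one>\<close> is its trace
  and serves as a dimension: it is at least 1 unless the idempotent vanishes, and it is additive
  when an idempotent is split, so a minimal one exists and takes the place of a one-dimensional
  eigenspace.\<close>

lemma sum_list_norm_le: "norm (\<Sum>a\<leftarrow>as. f a) \<le> (\<Sum>a\<leftarrow>as. norm (f a))"
  by (induction as) (auto intro: norm_triangle_le)

lemma member_le_sum_list_nonneg:
  fixes f :: "'a \<Rightarrow> real"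
  assumes "b \<in> set bs" "\<And>x. x \<in> set bs \<Longrightarrow> f x \<ge> 0"
  shows "f b \<le> (\<Sum>x\<leftarrow>bs. f x)"
  using assms
proof (induction bs)
  case (Cons c bs)
  have "(\<Sum>x\<leftarrow>bs. f x) \<ge> 0" using Cons.prems by (intro sum_list_nonneg) auto
  moreover have "f c \<ge> 0" using Cons.prems by simp
  moreover have "b \<noteq> c \<Longrightarrow> f b \<le> (\<Sum>x\<leftarrow>bs. f x)" using Cons by simp
  ultimately show ?case by (cases "b = c") fastforce+
qed simp

lemma norm_mult_diff_less:
  fixes a b a' b' :: "'c::real_normed_algebra"
  assumes "norm (a' - a) < \<epsilon>/(2*C)" "norm (b' - b) < \<epsilon>/(2*B)" "norm a \<le> B" "norm b' \<le> C" "B > 0" "C > 0"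
  shows "norm (a' * b' - a * b) < \<epsilon>"
proof -
  have "a' * b' - a * b = (a' - a) * b' + a * (b' - b)" by (simp add: algebra_simps)
  also have "norm \<dots> \<le> norm (a' - a) * norm b' + norm a * norm (b' - b)"
    by (intro order.trans[OF norm_triangle_ineq] add_mono norm_mult_ineq)
  also have "\<dots> \<le> norm (a' - a) * C + B * norm (b' - b)"
    using assms by (intro add_mono mult_left_mono mult_right_mono) auto
  also have "\<dots> < \<epsilon>/(2*C) * C + B * (\<epsilon>/(2*B))"
    using assms by (intro add_strict_mono mult_strict_right_mono mult_strict_left_mono) auto
  also have "\<dots> = \<epsilon>" using assms by simp
  finally show ?thesis .
qed

text \<open>Lists rather than finite sets: repetitions act as weights, so that the composite of two
  averages is again an average.\<close>

definition avg :: "('a, 'm) monoid_scheme \<Rightarrow> 'a list \<Rightarrow> ('a \<Rightarrow> 'c::real_normed_vector) \<Rightarrow> 'a \<Rightarrow> 'c" where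
  "avg G as g = (\<lambda>x. (\<Sum>a\<leftarrow>as. g (a \<otimes>\<^bsub>G\<^esub> x)) /\<^sub>R real (length as))"

text \<open>Total boundedness in finite-net form. Unlike compactness, it passes from a compact group
  to a dense subgroup and from there to continuous homomorphic images.\<close>

locale precompact_group = comm_group G + topological_group G T
  for G :: "('a, 'm) monoid_scheme" (structure) and T :: "'a topology" +
  assumes precompact:
    "\<lbrakk>openin T V; \<one> \<in> V\<rbrakk> \<Longrightarrow>
      \<exists>F. finite F \<and> F \<subseteq> carrier G \<and> (\<forall>x\<in>carrier G. \<exists>a\<in>F. inv a \<otimes> x \<in> V)"
begin

section \<open>Neighbourhoods of the identity and uniformly continuous functions\<close>

definition nbhd :: "'a set \<Rightarrow> bool" where
  "nbhd V \<longleftrightarrow> openin T V \<and> \<one> \<in> V"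

lemma nbhd_carrier: "nbhd V \<Longrightarrow> v \<in> V \<Longrightarrow> v \<in> carrier G"
  using openin_subset topspace_eq unfolding nbhd_def by blast

lemma nbhd_one: "nbhd V \<Longrightarrow> \<one> \<in> V"
  by (simp add: nbhd_def)

lemma nbhd_net:
  assumes "nbhd V"
  obtains F where "finite F" "F \<subseteq> carrier G" "\<And>x. x \<in> carrier G \<Longrightarrow> \<exists>a\<in>F. inv a \<otimes> x \<in> V"
proof -
  have "openin T V" "\<one> \<in> V" using assms by (auto simp: nbhd_def)
  from precompact[OF this] show ?thesis
    by (elim exE conjE) (rule that, auto)
qed

lemma nbhd_UNIV: "nbhd (carrier G)"
  using openin_topspace[of T] topspace_eq unfolding nbhd_def by auto

lemma nbhd_Int: "nbhd V \<Longrightarrow> nbhd W \<Longrightarrow> nbhd (V \<inter> W)"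
  by (auto simp: nbhd_def)

lemma nbhd_inv:
  assumes "nbhd V"
  shows "nbhd {x \<in> carrier G. inv x \<in> V}"
  using openin_continuous_map_preimage[OF continuous_inv, of V] assms
  unfolding nbhd_def topspace_eq by auto

lemma continuous_translate:
  assumes "a \<in> carrier G"
  shows "continuous_map T T (\<lambda>x. a \<otimes> x)"
proof -
  have "continuous_map T (prod_topology T T) (\<lambda>x. (a, x))"
    using assms by (intro continuous_map_pairedI) (auto simp: topspace_eq)
  from continuous_map_compose[OF this continuous_mult] show ?thesis
    by (simp add: o_def)
qed

lemma mult_inv_cancel: "a \<in> carrier G \<Longrightarrow> x \<in> carrier G \<Longrightarrow> a \<otimes> (inv a \<otimes> x) = x"
  by (simp flip: m_assoc)

lemma openin_translate:
  assumes "a \<in> carrier G" "openin T V"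
  shows "openin T {x \<in> carrier G. inv a \<otimes> x \<in> V}"
  using openin_continuous_map_preimage[OF continuous_translate[of "inv a"] assms(2)] assms(1)
  by (simp add: topspace_eq)

lemma nbhd_mult:
  assumes "nbhd V"
  shows "\<exists>W. nbhd W \<and> (\<forall>x\<in>W. \<forall>y\<in>W. x \<otimes> y \<in> V)"
proof -
  let ?P = "{p \<in> topspace (prod_topology T T). (\<lambda>(x, y). x \<otimes> y) p \<in> V}"
  have "openin (prod_topology T T) ?P"
    using openin_continuous_map_preimage[OF continuous_mult] assms unfolding nbhd_def by blast
  moreover have "(\<one>, \<one>) \<in> ?P"
    using assms by (auto simp: nbhd_def topspace_eq)
  ultimately obtain U W where UW: "openin T U" "openin T W" "\<one> \<in> U" "\<one> \<in> W" "U \<times> W \<subseteq> ?P"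
    unfolding openin_prod_topology_alt by meson
  then show ?thesis
    by (intro exI[of _ "U \<inter> W"]) (auto simp: nbhd_def)
qed

text \<open>Uniform continuity for the group uniformity. The group is abelian, so the left and right
  uniformities coincide and no side has to be named.\<close>

definition ucont :: "('a \<Rightarrow> 'c::real_normed_vector) \<Rightarrow> bool" where
  "ucont g \<longleftrightarrow>
     (\<forall>\<epsilon>>0. \<exists>V. nbhd V \<and> (\<forall>x\<in>carrier G. \<forall>v\<in>V. norm (g (x \<otimes> v) - g x) < \<epsilon>))"

lemma ucontD:
  assumes "ucont g" "\<epsilon> > 0"
  obtains V where "nbhd V" "\<And>x v. x \<in> carrier G \<Longrightarrow> v \<in> V \<Longrightarrow> norm (g (x \<otimes> v) - g x) < \<epsilon>"
  using assms unfolding ucont_def by blast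

lemma ucont_cong:
  assumes "\<And>x. x \<in> carrier G \<Longrightarrow> f x = g x"
  shows "ucont f \<longleftrightarrow> ucont g"
  unfolding ucont_def
proof (intro all_cong ex_cong1 conj_cong refl ball_cong)
  fix V x v assume "nbhd V" "x \<in> carrier G" "v \<in> V"
  then show "(norm (f (x \<otimes> v) - f x) < \<epsilon>) = (norm (g (x \<otimes> v) - g x) < \<epsilon>)" for \<epsilon>
    using assms nbhd_carrier by auto
qed

lemma ucont_const: "ucont (\<lambda>x. c)"
  unfolding ucont_def using nbhd_UNIV by auto

lemma ucont_add:
  assumes "ucont f" "ucont g"
  shows "ucont (\<lambda>x. f x + g x)"
  unfolding ucont_def
proof (intro allI impI)
  fix \<epsilon> :: real assume "\<epsilon> > 0"
  then have e: "\<epsilon>/2 > 0" by simp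
  obtain V where V: "nbhd V" "\<And>x v. x \<in> carrier G \<Longrightarrow> v \<in> V \<Longrightarrow> norm (f (x \<otimes> v) - f x) < \<epsilon>/2"
    by (rule ucontD[OF assms(1) e]) (rule that, auto)
  obtain W where W: "nbhd W" "\<And>x v. x \<in> carrier G \<Longrightarrow> v \<in> W \<Longrightarrow> norm (g (x \<otimes> v) - g x) < \<epsilon>/2"
    by (rule ucontD[OF assms(2) e]) (rule that, auto)
  have "norm (f (x \<otimes> v) + g (x \<otimes> v) - (f x + g x)) < \<epsilon>"
    if "x \<in> carrier G" "v \<in> V \<inter> W" for x v
  proof -
    have "norm (f (x \<otimes> v) + g (x \<otimes> v) - (f x + g x))
        \<le> norm (f (x \<otimes> v) - f x) + norm (g (x \<otimes> v) - g x)"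
      unfolding add_diff_add by (rule norm_triangle_ineq)
    then show ?thesis using V(2)[of x v] W(2)[of x v] that by simp
  qed
  then show "\<exists>V. nbhd V \<and>
      (\<forall>x\<in>carrier G. \<forall>v\<in>V. norm (f (x \<otimes> v) + g (x \<otimes> v) - (f x + g x)) < \<epsilon>)"
    using nbhd_Int[OF V(1) W(1)] by blast
qed

lemma ucont_bounded_linear:
  assumes "ucont f" "bounded_linear L"
  shows "ucont (\<lambda>x. L (f x))"
  unfolding ucont_def
proof (intro allI impI)
  fix \<epsilon> :: real assume e: "\<epsilon> > 0"
  interpret bounded_linear L by fact
  obtain K where K: "K > 0" "\<And>x. norm (L x) \<le> norm x * K"
    using pos_bounded by blast
  obtain V where V: "nbhd V" "\<And>x v. x \<in> carrier G \<Longrightarrow> v \<in> V \<Longrightarrow> norm (f (x \<otimes> v) - f x) < \<epsilon>/K"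
    using ucontD[OF assms(1), of "\<epsilon>/K"] e K(1) by auto
  have "norm (L (f (x \<otimes> v)) - L (f x)) < \<epsilon>" if "x \<in> carrier G" "v \<in> V" for x v
    using V(2)[OF that] K(2)[of "f (x \<otimes> v) - f x"] K(1) by (simp add: diff field_simps)
  then show "\<exists>V. nbhd V \<and> (\<forall>x\<in>carrier G. \<forall>v\<in>V. norm (L (f (x \<otimes> v)) - L (f x)) < \<epsilon>)"
    using V(1) by blast
qed

text \<open>On a finite net for the modulus 1 there are finitely many values, and every other value
  is within 1 of one of them. The bound is made positive because later proofs divide by it.\<close>

lemma ucont_bounded:
  assumes "ucont g"
  obtains B where "B > 0" "\<And>x. x \<in> carrier G \<Longrightarrow> norm (g x) \<le> B"
proof -
  obtain V where V: "nbhd V" "\<And>x v. x \<in> carrier G \<Longrightarrow> v \<in> V \<Longrightarrow> norm (g (x \<otimes> v) - g x) < 1"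
    using ucontD[OF assms, of 1] by auto
  obtain F where F: "finite F" "F \<subseteq> carrier G" "\<And>x. x \<in> carrier G \<Longrightarrow> \<exists>a\<in>F. inv a \<otimes> x \<in> V"
    by (rule nbhd_net[OF V(1)]) (rule that, auto)
  let ?B = "1 + (\<Sum>a\<in>F. norm (g a))"
  have "norm (g x) \<le> ?B" if x: "x \<in> carrier G" for x
  proof -
    obtain a where a: "a \<in> F" "inv a \<otimes> x \<in> V" using F(3)[OF x] by blast
    then have "a \<in> carrier G" using F(2) by blast
    then have "norm (g (a \<otimes> (inv a \<otimes> x)) - g a) < 1" using V(2) a(2) by simp
    moreover have "a \<otimes> (inv a \<otimes> x) = x"
      using a(1) F(2) x by (intro mult_inv_cancel) auto
    moreover have "norm (g a) \<le> (\<Sum>a\<in>F. norm (g a))"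
      using a(1) F(1) by (intro member_le_sum) auto
    ultimately show ?thesis
      using norm_triangle_ineq2[of "g x" "g a"] by simp
  qed
  moreover have "?B > 0" by (simp add: add_pos_nonneg sum_nonneg)
  ultimately show ?thesis using that by blast
qed

lemma ucont_mult:
  fixes f g :: "'a \<Rightarrow> 'c::real_normed_algebra"
  assumes "ucont f" "ucont g"
  shows "ucont (\<lambda>x. f x * g x)"
  unfolding ucont_def
proof (intro allI impI)
  fix \<epsilon> :: real assume e: "\<epsilon> > 0"
  obtain B where B: "B > 0" "\<And>x. x \<in> carrier G \<Longrightarrow> norm (f x) \<le> B"
    by (rule ucont_bounded[OF assms(1)]) (rule that, auto)
  obtain C where C: "C > 0" "\<And>x. x \<in> carrier G \<Longrightarrow> norm (g x) \<le> C"
    by (rule ucont_bounded[OF assms(2)]) (rule that, auto)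
  obtain V where V: "nbhd V" "\<And>x v. x \<in> carrier G \<Longrightarrow> v \<in> V \<Longrightarrow> norm (f (x \<otimes> v) - f x) < \<epsilon>/(2*C)"
    using ucontD[OF assms(1), of "\<epsilon>/(2*C)"] e C by auto
  obtain W where W: "nbhd W" "\<And>x v. x \<in> carrier G \<Longrightarrow> v \<in> W \<Longrightarrow> norm (g (x \<otimes> v) - g x) < \<epsilon>/(2*B)"
    using ucontD[OF assms(2), of "\<epsilon>/(2*B)"] e B by auto
  have "norm (f (x \<otimes> v) * g (x \<otimes> v) - f x * g x) < \<epsilon>"
    if x: "x \<in> carrier G" and v: "v \<in> V \<inter> W" for x v
  proof (rule norm_mult_diff_less)
    have "x \<otimes> v \<in> carrier G" using x v nbhd_carrier[OF V(1)] by auto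
    then show "norm (g (x \<otimes> v)) \<le> C" by (rule C(2))
  qed (use V(2)[OF x] W(2)[OF x] B C x v in auto)
  then show "\<exists>V. nbhd V \<and>
      (\<forall>x\<in>carrier G. \<forall>v\<in>V. norm (f (x \<otimes> v) * g (x \<otimes> v) - f x * g x) < \<epsilon>)"
    using nbhd_Int[OF V(1) W(1)] by blast
qed

lemma ucont_translate:
  assumes "ucont g" "a \<in> carrier G"
  shows "ucont (\<lambda>x. g (a \<otimes> x))"
  unfolding ucont_def
proof (intro allI impI)
  fix \<epsilon> :: real assume e: "\<epsilon> > 0"
  obtain V where V: "nbhd V" "\<And>x v. x \<in> carrier G \<Longrightarrow> v \<in> V \<Longrightarrow> norm (g (x \<otimes> v) - g x) < \<epsilon>"
    by (rule ucontD[OF assms(1) e]) (rule that, auto)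
  have "norm (g (a \<otimes> (x \<otimes> v)) - g (a \<otimes> x)) < \<epsilon>" if "x \<in> carrier G" "v \<in> V" for x v
    using V(2)[of "a \<otimes> x" v] that assms(2) nbhd_carrier[OF V(1)] by (simp add: m_assoc)
  then show "\<exists>V. nbhd V \<and> (\<forall>x\<in>carrier G. \<forall>v\<in>V. norm (g (a \<otimes> (x \<otimes> v)) - g (a \<otimes> x)) < \<epsilon>)"
    using V(1) by blast
qed

lemma ucont_inv:
  assumes "ucont g"
  shows "ucont (\<lambda>x. g (inv x))"
  unfolding ucont_def
proof (intro allI impI)
  fix \<epsilon> :: real assume e: "\<epsilon> > 0"
  obtain V where V: "nbhd V" "\<And>x v. x \<in> carrier G \<Longrightarrow> v \<in> V \<Longrightarrow> norm (g (x \<otimes> v) - g x) < \<epsilon>"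
    by (rule ucontD[OF assms(1) e]) (rule that, auto)
  have "norm (g (inv (x \<otimes> v)) - g (inv x)) < \<epsilon>"
    if "x \<in> carrier G" "v \<in> {x \<in> carrier G. inv x \<in> V}" for x v
    using V(2)[of "inv x" "inv v"] that by (simp add: inv_mult)
  then show "\<exists>V. nbhd V \<and> (\<forall>x\<in>carrier G. \<forall>v\<in>V. norm (g (inv (x \<otimes> v)) - g (inv x)) < \<epsilon>)"
    using nbhd_inv[OF V(1)] by blast
qed

lemma ucont_limit:
  fixes g :: "'a \<Rightarrow> 'c::real_normed_vector"
  assumes "\<And>\<epsilon>. \<epsilon> > 0 \<Longrightarrow> \<exists>f. ucont f \<and> (\<forall>x\<in>carrier G. norm (f x - g x) \<le> \<epsilon>)"
  shows "ucont g"
  unfolding ucont_def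
proof (intro allI impI)
  fix \<epsilon> :: real assume e: "\<epsilon> > 0"
  obtain f where f: "ucont f" "\<And>x. x \<in> carrier G \<Longrightarrow> norm (f x - g x) \<le> \<epsilon>/4"
    using assms[of "\<epsilon>/4"] e by auto
  obtain V where V: "nbhd V" "\<And>x v. x \<in> carrier G \<Longrightarrow> v \<in> V \<Longrightarrow> norm (f (x \<otimes> v) - f x) < \<epsilon>/4"
    using ucontD[OF f(1), of "\<epsilon>/4"] e by auto
  have "norm (g (x \<otimes> v) - g x) < \<epsilon>" if x: "x \<in> carrier G" and v: "v \<in> V" for x v
  proof -
    have "x \<otimes> v \<in> carrier G" using x v V nbhd_carrier by auto
    from f(2)[OF this] f(2)[OF x] V(2)[OF x v]
    have "dist (g (x \<otimes> v)) (f (x \<otimes> v)) \<le> \<epsilon>/4" "dist (f x) (g x) \<le> \<epsilon>/4"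
      "dist (f (x \<otimes> v)) (f x) < \<epsilon>/4"
      by (auto simp: dist_norm norm_minus_commute)
    then have "dist (g (x \<otimes> v)) (g x) < \<epsilon>" using e by metric
    then show ?thesis by (simp add: dist_norm)
  qed
  then show "\<exists>V. nbhd V \<and> (\<forall>x\<in>carrier G. \<forall>v\<in>V. norm (g (x \<otimes> v) - g x) < \<epsilon>)"
    using V(1) by blast
qed

section \<open>Averages over finite lists of translates\<close>

abbreviation averaging :: "'a list \<Rightarrow> bool" where
  "averaging as \<equiv> as \<noteq> [] \<and> set as \<subseteq> carrier G"

lemma avg_add: "avg G as (\<lambda>x. f x + g x) x = avg G as f x + avg G as g x"
  by (simp add: avg_def sum_list_addf scaleR_add_right)

lemma avg_bounded_linear:
  assumes "bounded_linear L"
  shows "avg G as (\<lambda>x. L (f x)) x = L (avg G as f x)"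
proof -
  interpret bounded_linear L by fact
  have "L (\<Sum>a\<leftarrow>as. f (a \<otimes> x)) = (\<Sum>a\<leftarrow>as. L (f (a \<otimes> x)))"
    by (induction as) (simp_all add: add zero)
  then show ?thesis by (simp add: avg_def scaleR)
qed

lemma avg_const:
  assumes "as \<noteq> []"
  shows "avg G as (\<lambda>x. c) x = c"
proof -
  have "(\<Sum>a\<leftarrow>as. c) = real (length as) *\<^sub>R c"
    by (induction as) (simp_all add: scaleR_add_left)
  then show ?thesis using assms by (simp add: avg_def)
qed

lemma avg_diff_const:
  assumes "as \<noteq> []"
  shows "avg G as f x - c = avg G as (\<lambda>x. f x - c) x"
  using avg_add[of as f "\<lambda>_. - c" x] avg_const[OF assms, of "- c" x] by simp

lemma avg_mono:
  fixes f g :: "'a \<Rightarrow> real"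
  assumes "averaging as" "x \<in> carrier G" "\<And>y. y \<in> carrier G \<Longrightarrow> f y \<le> g y"
  shows "avg G as f x \<le> avg G as g x"
proof -
  have "(\<Sum>a\<leftarrow>as. f (a \<otimes> x)) \<le> (\<Sum>a\<leftarrow>as. g (a \<otimes> x))"
    using assms by (intro sum_list_mono) auto
  then show ?thesis by (simp add: avg_def divide_right_mono mult_left_mono)
qed

lemma norm_avg_le:
  assumes "averaging as" "x \<in> carrier G" "\<And>y. y \<in> carrier G \<Longrightarrow> norm (f y) \<le> B"
  shows "norm (avg G as f x) \<le> B"
proof -
  have "norm (avg G as f x) \<le> avg G as (\<lambda>x. norm (f x)) x"
    using sum_list_norm_le[of "\<lambda>a. f (a \<otimes> x)" as] by (simp add: avg_def divide_simps)
  also have "\<dots> \<le> avg G as (\<lambda>_. B) x" using assms by (intro avg_mono)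
  also have "\<dots> = B" using assms by (intro avg_const) auto
  finally show ?thesis .
qed

lemma avg_cong:
  assumes "averaging as" "x \<in> carrier G" "\<And>y. y \<in> carrier G \<Longrightarrow> f y = g y"
  shows "avg G as f x = avg G as g x"
proof -
  have "map (\<lambda>a. f (a \<otimes> x)) as = map (\<lambda>a. g (a \<otimes> x)) as"
    using assms by (auto intro!: map_cong)
  then show ?thesis by (simp only: avg_def)
qed

lemma avg_translate:
  assumes "averaging as" "x \<in> carrier G" "b \<in> carrier G"
  shows "avg G as (\<lambda>x. f (b \<otimes> x)) x = avg G as f (b \<otimes> x)"
proof -
  have "map (\<lambda>a. f (b \<otimes> (a \<otimes> x))) as = map (\<lambda>a. f (a \<otimes> (b \<otimes> x))) as"
    using assms by (intro map_cong refl arg_cong[of _ _ f]) (simp add: m_lcomm subset_iff)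
  then show ?thesis by (simp only: avg_def)
qed

lemma avg_inv:
  assumes "averaging as" "x \<in> carrier G"
  shows "avg G as (\<lambda>x. f (inv x)) x = avg G (map (\<lambda>a. inv a) as) f (inv x)"
proof -
  have "map (\<lambda>a. f (inv (a \<otimes> x))) as = map (\<lambda>a. f (inv a \<otimes> inv x)) as"
    using assms by (intro map_cong refl arg_cong[of _ _ f]) (auto simp: inv_mult)
  then show ?thesis by (simp only: avg_def map_map o_def length_map)
qed

lemma avg_sum_list:
  "avg G as (\<lambda>x. \<Sum>b\<leftarrow>bs. f b x) x = (\<Sum>b\<leftarrow>bs. avg G as (f b) x)"
proof (induction bs)
  case Nil
  then show ?case by (simp add: avg_def)
next
  case (Cons b bs)
  show ?case
    using avg_add[of as "f b" "\<lambda>x. \<Sum>b\<leftarrow>bs. f b x" x] Cons.IH by simp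
qed

text \<open>Translations of an abelian group commute, so a translation passes through an average
  (\<open>avg_translate\<close>). Uniqueness and additivity of the mean rest on this.\<close>

lemma avg_commute:
  assumes "averaging as" "averaging bs" "x \<in> carrier G"
  shows "avg G as (avg G bs f) x = avg G bs (avg G as f) x"
proof -
  have "avg G as (avg G bs f) x = avg G as (\<lambda>y. (\<Sum>b\<leftarrow>bs. f (b \<otimes> y))) x /\<^sub>R length bs"
    using avg_bounded_linear[OF bounded_linear_scaleR_right, of as "inverse (length bs)"]
    by (simp add: avg_def)
  also have "\<dots> = (\<Sum>b\<leftarrow>bs. avg G as (\<lambda>y. f (b \<otimes> y)) x) /\<^sub>R length bs"
    by (simp add: avg_sum_list)
  also have "map (\<lambda>b. avg G as (\<lambda>y. f (b \<otimes> y)) x) bs = map (\<lambda>b. avg G as f (b \<otimes> x)) bs"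
    using assms by (intro map_cong refl avg_translate) auto
  finally show ?thesis by (simp add: avg_def[of G bs])
qed

text \<open>The order \<open>b \<otimes> a\<close> is the one in which the inner average, over
  \<open>bs\<close>, evaluates its function at \<open>b \<otimes> (a \<otimes> x)\<close>;
  associativity then suffices in \<open>avg_products\<close>.\<close>

definition products :: "'a list \<Rightarrow> 'a list \<Rightarrow> 'a list" where
  "products as bs = concat (map (\<lambda>a. map (\<lambda>b. b \<otimes> a) bs) as)"

lemma averaging_products: "averaging as \<Longrightarrow> averaging bs \<Longrightarrow> averaging (products as bs)"
  unfolding products_def by (cases as; cases bs) auto

lemma avg_products:
  fixes f :: "'a \<Rightarrow> 'b::real_normed_vector"
  assumes "averaging as" "averaging bs" "x \<in> carrier G"
  shows "avg G (products as bs) f x = avg G as (avg G bs f) x"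
proof -
  have "(\<Sum>c\<leftarrow>products as bs. f (c \<otimes> x)) = (\<Sum>a\<leftarrow>as. \<Sum>b\<leftarrow>bs. f (b \<otimes> a \<otimes> x))"
    unfolding products_def by (induction as) (simp_all add: o_def)
  also have "\<dots> = (\<Sum>a\<leftarrow>as. \<Sum>b\<leftarrow>bs. f (b \<otimes> (a \<otimes> x)))"
    using assms by (intro arg_cong[of _ _ sum_list] map_cong refl arg_cong[of _ _ f]) (auto intro: m_assoc)
  finally have 1: "(\<Sum>c\<leftarrow>products as bs. f (c \<otimes> x)) = (\<Sum>a\<leftarrow>as. \<Sum>b\<leftarrow>bs. f (b \<otimes> (a \<otimes> x)))" .
  have 2: "length (products as bs) = length as * length bs"
    unfolding products_def by (induction as) simp_all
  have 3: "(\<Sum>a\<leftarrow>as. F a /\<^sub>R r) = (\<Sum>a\<leftarrow>as. F a) /\<^sub>R r" for F :: "'a \<Rightarrow> 'b" and r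
    by (induction as) (simp_all add: scaleR_add_right)
  show ?thesis
    unfolding avg_def 1 2 3 by simp
qed

text \<open>Equicontinuity of all averages of \<open>f\<close>: in \<open>exists_mean_real\<close>
  the neighbourhood \<open>V\<close> must be fixed before the list \<open>as\<close> is
  known.\<close>

lemma avg_modulus:
  assumes "averaging as" "\<And>x v. x \<in> carrier G \<Longrightarrow> v \<in> V \<Longrightarrow> norm (f (x \<otimes> v) - f x) \<le> \<epsilon>"
    "V \<subseteq> carrier G" "x \<in> carrier G" "v \<in> V"
  shows "norm (avg G as f (x \<otimes> v) - avg G as f x) \<le> \<epsilon>"
proof -
  have v: "v \<in> carrier G" using assms by blast
  have "avg G as (\<lambda>x. f (v \<otimes> x) + - f x) x = avg G as f (x \<otimes> v) - avg G as f x"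
    unfolding avg_add
    using avg_translate[OF assms(1,4) v, of f] m_comm[OF v assms(4)]
      avg_bounded_linear[OF bounded_linear_minus[OF bounded_linear_ident], of as f x]
    by simp
  moreover have "norm (avg G as (\<lambda>x. f (v \<otimes> x) + - f x) x) \<le> \<epsilon>"
  proof (rule norm_avg_le[OF assms(1,4)])
    fix y assume y: "y \<in> carrier G"
    show "norm (f (v \<otimes> y) + - f y) \<le> \<epsilon>"
      using assms(2)[OF y assms(5)] m_comm[OF v y] by simp
  qed
  ultimately show ?thesis by simp
qed

section \<open>Von Neumann means\<close>

definition has_mean :: "('a \<Rightarrow> 'c::real_normed_vector) \<Rightarrow> 'c \<Rightarrow> bool" where
  "has_mean g c \<longleftrightarrow>
     (\<forall>\<epsilon>>0. \<exists>as. averaging as \<and> (\<forall>x\<in>carrier G. norm (avg G as g x - c) \<le> \<epsilon>))"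

lemma has_meanD:
  assumes "has_mean g c" "\<epsilon> > 0"
  obtains as where "averaging as" "\<And>x. x \<in> carrier G \<Longrightarrow> norm (avg G as g x - c) \<le> \<epsilon>"
proof -
  have "\<exists>as. averaging as \<and> (\<forall>x\<in>carrier G. norm (avg G as g x - c) \<le> \<epsilon>)"
    using assms by (simp add: has_mean_def)
  then show ?thesis by (elim exE conjE) (rule that, auto)
qed

lemma avg_near:
  assumes "averaging as" "averaging bs" "x \<in> carrier G"
    "\<And>x. x \<in> carrier G \<Longrightarrow> norm (avg G as g x - c) \<le> \<epsilon>"
  shows "norm (avg G bs (avg G as g) x - c) \<le> \<epsilon>"
proof -
  have "avg G bs (avg G as g) x - c = avg G bs (\<lambda>x. avg G as g x - c) x"
    using assms(2) by (intro avg_diff_const) simp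
  then show ?thesis
    using norm_avg_le[OF assms(2,3), of "\<lambda>x. avg G as g x - c" \<epsilon>] assms(4) by simp
qed

lemma avg_near':
  assumes "averaging as" "averaging bs" "x \<in> carrier G"
    "\<And>x. x \<in> carrier G \<Longrightarrow> norm (avg G as g x - c) \<le> \<epsilon>"
  shows "norm (avg G as (avg G bs g) x - c) \<le> \<epsilon>"
  unfolding avg_commute[OF assms(1,2,3)] using assms by (rule avg_near)

text \<open>Compose the two lists. Once an average is uniformly close to a constant, any further
  averaging keeps it so (\<open>avg_near\<close>), and by commutativity it does not matter which of
  the two is applied first (\<open>avg_near'\<close>).\<close>

lemma common_averaging:
  assumes "has_mean f c" "has_mean g d" "\<epsilon> > 0"
  obtains as where "averaging as" "\<And>x. x \<in> carrier G \<Longrightarrow> norm (avg G as f x - c) \<le> \<epsilon>"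
    "\<And>x. x \<in> carrier G \<Longrightarrow> norm (avg G as g x - d) \<le> \<epsilon>"
proof -
  obtain as where as: "averaging as" "\<And>x. x \<in> carrier G \<Longrightarrow> norm (avg G as f x - c) \<le> \<epsilon>"
    by (rule has_meanD[OF assms(1,3)]) (rule that, auto)
  obtain bs where bs: "averaging bs" "\<And>x. x \<in> carrier G \<Longrightarrow> norm (avg G bs g x - d) \<le> \<epsilon>"
    by (rule has_meanD[OF assms(2,3)]) (rule that, auto)
  show ?thesis
  proof (rule that)
    show "averaging (products as bs)" using averaging_products[OF as(1) bs(1)] .
    fix x assume x: "x \<in> carrier G"
    show "norm (avg G (products as bs) f x - c) \<le> \<epsilon>"
      unfolding avg_products[OF as(1) bs(1) x] by (rule avg_near'[OF as(1) bs(1) x as(2)])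
    show "norm (avg G (products as bs) g x - d) \<le> \<epsilon>"
      unfolding avg_products[OF as(1) bs(1) x] by (rule avg_near[OF bs(1) as(1) x bs(2)])
  qed
qed

lemma has_mean_unique:
  assumes "has_mean g c" "has_mean g d"
  shows "c = d"
proof -
  have "norm (c - d) \<le> 0"
  proof (rule field_le_epsilon)
    fix \<epsilon> :: real assume "\<epsilon> > 0"
    then have e: "\<epsilon>/2 > 0" by simp
    obtain as where as: "averaging as"
      "\<And>x. x \<in> carrier G \<Longrightarrow> norm (avg G as g x - c) \<le> \<epsilon>/2"
      "\<And>x. x \<in> carrier G \<Longrightarrow> norm (avg G as g x - d) \<le> \<epsilon>/2"
      by (rule common_averaging[OF assms e]) (rule that, auto)
    have "dist (avg G as g \<one>) c \<le> \<epsilon>/2" "dist (avg G as g \<one>) d \<le> \<epsilon>/2"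
      using as(2,3)[of \<one>] by (simp_all add: dist_norm)
    then have "dist c d \<le> \<epsilon>" by metric
    then show "norm (c - d) \<le> 0 + \<epsilon>" by (simp add: dist_norm)
  qed
  then show ?thesis by simp
qed

lemma has_mean_cong:
  assumes "has_mean f c" "\<And>x. x \<in> carrier G \<Longrightarrow> f x = g x"
  shows "has_mean g c"
  unfolding has_mean_def
proof (intro allI impI)
  fix \<epsilon> :: real assume "\<epsilon> > 0"
  then obtain as where as: "averaging as" "\<And>x. x \<in> carrier G \<Longrightarrow> norm (avg G as f x - c) \<le> \<epsilon>"
    by (rule has_meanD[OF assms(1)]) (rule that, auto)
  have "norm (avg G as g x - c) \<le> \<epsilon>" if "x \<in> carrier G" for x
    using as(2)[OF that] avg_cong[OF as(1) that assms(2)] by simp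
  then show "\<exists>as. averaging as \<and> (\<forall>x\<in>carrier G. norm (avg G as g x - c) \<le> \<epsilon>)"
    using as(1) by auto
qed

lemma has_mean_const: "has_mean (\<lambda>x. c) c"
  unfolding has_mean_def
proof (intro allI impI exI conjI ballI)
  fix x and \<epsilon> :: real assume "\<epsilon> > 0"
  then show "norm (avg G [\<one>] (\<lambda>x. c) x - c) \<le> \<epsilon>"
    by (simp add: avg_const)
qed auto

lemma has_mean_add:
  assumes "has_mean f c" "has_mean g d"
  shows "has_mean (\<lambda>x. f x + g x) (c + d)"
  unfolding has_mean_def
proof (intro allI impI)
  fix \<epsilon> :: real assume "\<epsilon> > 0"
  then have e: "\<epsilon>/2 > 0" by simp
  obtain as where as: "averaging as"
    "\<And>x. x \<in> carrier G \<Longrightarrow> norm (avg G as f x - c) \<le> \<epsilon>/2"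
    "\<And>x. x \<in> carrier G \<Longrightarrow> norm (avg G as g x - d) \<le> \<epsilon>/2"
    by (rule common_averaging[OF assms e]) (rule that, auto)
  have "norm (avg G as (\<lambda>x. f x + g x) x - (c + d)) \<le> \<epsilon>" if "x \<in> carrier G" for x
  proof -
    have "norm (avg G as (\<lambda>x. f x + g x) x - (c + d))
        \<le> norm (avg G as f x - c) + norm (avg G as g x - d)"
      unfolding avg_add by norm
    then show ?thesis using as(2,3)[OF that] by simp
  qed
  then show "\<exists>as. averaging as \<and> (\<forall>x\<in>carrier G. norm (avg G as (\<lambda>x. f x + g x) x - (c + d)) \<le> \<epsilon>)"
    using as(1) by auto
qed

lemma has_mean_bounded_linear:
  assumes "has_mean f c" "bounded_linear L"
  shows "has_mean (\<lambda>x. L (f x)) (L c)"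
  unfolding has_mean_def
proof (intro allI impI)
  interpret bounded_linear L by fact
  obtain K where K: "K > 0" "\<And>x. norm (L x) \<le> norm x * K"
    using pos_bounded by blast
  fix \<epsilon> :: real assume "\<epsilon> > 0"
  then obtain as where as: "averaging as" "\<And>x. x \<in> carrier G \<Longrightarrow> norm (avg G as f x - c) \<le> \<epsilon>/K"
    using has_meanD[OF assms(1), of "\<epsilon>/K"] K by auto
  have "norm (avg G as (\<lambda>x. L (f x)) x - L c) \<le> \<epsilon>" if "x \<in> carrier G" for x
    using as(2)[OF that] K(2)[of "avg G as f x - c"] K(1)
    unfolding avg_bounded_linear[OF assms(2)] by (simp add: diff field_simps)
  then show "\<exists>as. averaging as \<and> (\<forall>x\<in>carrier G. norm (avg G as (\<lambda>x. L (f x)) x - L c) \<le> \<epsilon>)"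
    using as(1) by auto
qed

lemma has_mean_translate:
  assumes "has_mean f c" "b \<in> carrier G"
  shows "has_mean (\<lambda>x. f (b \<otimes> x)) c"
  unfolding has_mean_def
proof (intro allI impI)
  fix \<epsilon> :: real assume "\<epsilon> > 0"
  then obtain as where as: "averaging as" "\<And>x. x \<in> carrier G \<Longrightarrow> norm (avg G as f x - c) \<le> \<epsilon>"
    by (rule has_meanD[OF assms(1)]) (rule that, auto)
  have "norm (avg G as (\<lambda>x. f (b \<otimes> x)) x - c) \<le> \<epsilon>" if "x \<in> carrier G" for x
    using as(2)[of "b \<otimes> x"] avg_translate[OF as(1) that assms(2), of f] that assms(2) by simp
  then show "\<exists>as. averaging as \<and> (\<forall>x\<in>carrier G. norm (avg G as (\<lambda>x. f (b \<otimes> x)) x - c) \<le> \<epsilon>)"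
    using as(1) by auto
qed

lemma has_mean_inv:
  assumes "has_mean f c"
  shows "has_mean (\<lambda>x. f (inv x)) c"
  unfolding has_mean_def
proof (intro allI impI)
  fix \<epsilon> :: real assume "\<epsilon> > 0"
  then obtain as where as: "averaging as" "\<And>x. x \<in> carrier G \<Longrightarrow> norm (avg G as f x - c) \<le> \<epsilon>"
    by (rule has_meanD[OF assms(1)]) (rule that, auto)
  have m: "map (\<lambda>a. inv a) (map (\<lambda>a. inv a) as) = as"
    using as(1) by (auto simp: o_def subset_iff intro!: map_idI)
  have w: "averaging (map (\<lambda>a. inv a) as)" using as(1) by auto
  have "norm (avg G (map (\<lambda>a. inv a) as) (\<lambda>x. f (inv x)) x - c) \<le> \<epsilon>" if "x \<in> carrier G" for x
    using as(2)[of "inv x"] avg_inv[OF w that, of f] that unfolding m by simp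
  then show "\<exists>as. averaging as \<and> (\<forall>x\<in>carrier G. norm (avg G as (\<lambda>x. f (inv x)) x - c) \<le> \<epsilon>)"
    using w by (intro exI[of _ "map (\<lambda>a. inv a) as"]) auto
qed

lemma has_mean_avg:
  assumes "has_mean f c" "averaging bs"
  shows "has_mean (avg G bs f) c"
  unfolding has_mean_def
proof (intro allI impI)
  fix \<epsilon> :: real assume "\<epsilon> > 0"
  then obtain as where as: "averaging as" "\<And>x. x \<in> carrier G \<Longrightarrow> norm (avg G as f x - c) \<le> \<epsilon>"
    by (rule has_meanD[OF assms(1)]) (rule that, auto)
  then show "\<exists>as. averaging as \<and> (\<forall>x\<in>carrier G. norm (avg G as (avg G bs f) x - c) \<le> \<epsilon>)"
    using avg_near'[OF as(1) assms(2) _ as(2)] by auto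
qed

lemma has_mean_norm_le:
  assumes "has_mean f c" "\<And>x. x \<in> carrier G \<Longrightarrow> norm (f x) \<le> B"
  shows "norm c \<le> B"
proof (rule field_le_epsilon)
  fix \<epsilon> :: real assume "\<epsilon> > 0"
  then obtain as where as: "averaging as" "\<And>x. x \<in> carrier G \<Longrightarrow> norm (avg G as f x - c) \<le> \<epsilon>"
    by (rule has_meanD[OF assms(1)]) (rule that, auto)
  have "norm (avg G as f \<one>) \<le> B" using norm_avg_le[OF as(1) _ assms(2)] by simp
  then show "norm c \<le> B + \<epsilon>" using as(2)[of \<one>] norm_triangle_ineq3[of "avg G as f \<one>" c] by simp
qed

lemma has_mean_ge:
  fixes f :: "'a \<Rightarrow> real"
  assumes "has_mean f c" "\<And>x. x \<in> carrier G \<Longrightarrow> f x \<ge> b"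
  shows "c \<ge> b"
proof (rule field_le_epsilon)
  fix \<epsilon> :: real assume "\<epsilon> > 0"
  then obtain as where as: "averaging as" "\<And>x. x \<in> carrier G \<Longrightarrow> norm (avg G as f x - c) \<le> \<epsilon>"
    by (rule has_meanD[OF assms(1)]) (rule that, auto)
  have "b \<le> avg G as f \<one>"
    using avg_mono[OF as(1), of \<one> "\<lambda>_. b" f] assms(2) as(1) by (simp add: avg_const)
  then show "b \<le> c + \<epsilon>" using as(2)[of \<one>] by simp
qed

lemma common_averaging_finite:
  assumes "finite Y" "\<And>y. y \<in> Y \<Longrightarrow> has_mean (f y) (c y)" "\<epsilon> > 0"
  shows "\<exists>as. averaging as \<and> (\<forall>y\<in>Y. \<forall>x\<in>carrier G. norm (avg G as (f y) x - c y) \<le> \<epsilon>)"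
  using assms(1,2)
proof (induction Y rule: finite_induct)
  case empty
  then show ?case by (intro exI[of _ "[\<one>]"]) simp
next
  case (insert b Y)
  then obtain as where as: "averaging as"
    "\<forall>y\<in>Y. \<forall>x\<in>carrier G. norm (avg G as (f y) x - c y) \<le> \<epsilon>" by auto
  obtain bs where bs: "averaging bs" "\<And>x. x \<in> carrier G \<Longrightarrow> norm (avg G bs (f b) x - c b) \<le> \<epsilon>"
    using has_meanD[OF insert.prems[of b] assms(3)] by auto
  have "norm (avg G (products as bs) (f y) x - c y) \<le> \<epsilon>"
    if "y \<in> insert b Y" "x \<in> carrier G" for x y
    unfolding avg_products[OF as(1) bs(1) that(2)]
  proof (cases "y = b")
    case True
    then show "norm (avg G as (avg G bs (f y)) x - c y) \<le> \<epsilon>"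
      using avg_near[OF bs(1) as(1) that(2) bs(2)] by simp
  next
    case False
    then show "norm (avg G as (avg G bs (f y)) x - c y) \<le> \<epsilon>"
      using as(2) that(1) by (intro avg_near'[OF as(1) bs(1) that(2)]) simp
  qed
  then show ?case
    using averaging_products[OF as(1) bs(1)] by (intro exI[of _ "products as bs"]) auto
qed

text \<open>The mean \<open>s\<close> is the infimum of the upper bounds of averages of
  \<open>u\<close>. Suppose an average with upper bound \<open>t\<close> close to \<open>s\<close>
  dips below \<open>s - \<epsilon>\<close> at \<open>x0\<close>. By equicontinuity it stays below
  \<open>s - \<epsilon>/2\<close> on \<open>x0 \<otimes> V\<close>. Averaging once more over
  \<open>n\<close> translates, one of which carries any given point into the dip, lowers the upper
  bound everywhere by \<open>\<epsilon>/(2*n)\<close>, which is below the infimum.\<close>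

lemma exists_mean_real:
  fixes u :: "'a \<Rightarrow> real"
  assumes u: "ucont u"
  shows "\<exists>c. has_mean u c"
proof -
  define S where "S = {t. \<exists>as. averaging as \<and> (\<forall>x\<in>carrier G. avg G as u x \<le> t)}"
  define s where "s = Inf S"
  obtain B where B: "B > 0" "\<And>x. x \<in> carrier G \<Longrightarrow> norm (u x) \<le> B"
    by (rule ucont_bounded[OF u]) (rule that, auto)
  have avgB: "norm (avg G as u x) \<le> B" if "averaging as" "x \<in> carrier G" for as x
    using norm_avg_le[OF that B(2)] by simp
  have SI: "t \<in> S" if "averaging as" "\<And>x. x \<in> carrier G \<Longrightarrow> avg G as u x \<le> t" for as t
    using that unfolding S_def by blast
  have "B \<in> S"
  proof (rule SI[of "[\<one>]"])
    show "avg G [\<one>] u x \<le> B" if "x \<in> carrier G" for x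
      using avgB[of "[\<one>]" x] that by simp
  qed auto
  then have S: "S \<noteq> {}" by blast
  have "- B \<le> t" if t: "t \<in> S" for t
  proof -
    obtain as where as: "averaging as" "\<forall>x\<in>carrier G. avg G as u x \<le> t"
      using t unfolding S_def by blast
    have "avg G as u \<one> \<le> t" using as(2) by simp
    moreover have "norm (avg G as u \<one>) \<le> B" using avgB[OF as(1), of \<one>] by simp
    ultimately show ?thesis by simp
  qed
  then have S': "bdd_below S" by (auto simp: bdd_below_def)
  have "has_mean u s"
    unfolding has_mean_def
  proof (intro allI impI)
    fix \<epsilon> :: real assume e: "\<epsilon> > 0"
    obtain V where V: "nbhd V" "\<And>x v. x \<in> carrier G \<Longrightarrow> v \<in> V \<Longrightarrow> norm (u (x \<otimes> v) - u x) < \<epsilon>/2"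
      using ucontD[OF u, of "\<epsilon>/2"] e by auto
    obtain F where F: "finite F" "F \<subseteq> carrier G"
      "\<And>x. x \<in> carrier G \<Longrightarrow> \<exists>a\<in>F. inv a \<otimes> x \<in> V"
      by (rule nbhd_net[OF V(1)]) (rule that, auto)
    obtain fs where fs: "set fs = F" using finite_list[OF F(1)] by blast
    have "fs \<noteq> []" using F(3)[of \<one>] fs by auto
    define n where "n = real (length fs)"
    have n: "n > 0" using \<open>fs \<noteq> []\<close> by (simp add: n_def)
    \<comment> \<open>The first entry yields the estimate from above; the second is the drop gained
      by the additional averaging, which \<open>t\<close> must not exceed \<open>s\<close>
      by.\<close>
    define \<delta> where "\<delta> = min \<epsilon> (\<epsilon>/(2*n))"
    have "\<delta> > 0" using e n by (simp add: \<delta>_def)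
    then obtain t where t: "t \<in> S" "t < s + \<delta>"
      using cInf_lessD[OF S, of "s + \<delta>"] s_def by auto
    then obtain as where as: "averaging as" "\<And>x. x \<in> carrier G \<Longrightarrow> avg G as u x \<le> t"
      unfolding S_def by blast
    let ?h = "avg G as u"
    have "s \<le> t" unfolding s_def using t(1) S' by (rule cInf_lower)
    have "?h x0 \<ge> s - \<epsilon>" if x0: "x0 \<in> carrier G" for x0
    proof (rule ccontr)
      assume "\<not> ?h x0 \<ge> s - \<epsilon>"
      then have less: "?h x0 < s - \<epsilon>" by simp
      have near: "?h (x0 \<otimes> v) \<le> s - \<epsilon>/2" if "v \<in> V" for v
      proof -
        have "norm (?h (x0 \<otimes> v) - ?h x0) \<le> \<epsilon>/2"
          using V(2) nbhd_carrier[OF V(1)]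
          by (intro avg_modulus[OF as(1) _ _ x0 that]) (auto intro: less_imp_le)
        then show ?thesis using less unfolding real_norm_def by linarith
      qed
      \<comment> \<open>If \<open>inv a \<otimes> x\<close> lies in \<open>V\<close>, then
        \<open>x0 \<otimes> inv a\<close> moves \<open>x\<close> into the dip
        \<open>x0 \<otimes> V\<close>.\<close>
      define bs where "bs = map (\<lambda>a. x0 \<otimes> inv a) fs"
      have bs: "averaging bs" "length bs = length fs"
        using \<open>fs \<noteq> []\<close> fs F(2) x0 by (auto simp: bs_def)
      have "avg G bs ?h x \<le> t - \<epsilon>/(2*n)" if x: "x \<in> carrier G" for x
      proof -
        obtain a where a: "a \<in> F" "inv a \<otimes> x \<in> V" using F(3)[OF x] by blast
        have aG: "a \<in> carrier G" using a F(2) by blast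
        have "\<epsilon>/2 \<le> t - ?h ((x0 \<otimes> inv a) \<otimes> x)"
          using near[OF a(2)] \<open>s \<le> t\<close> x x0 aG by (simp add: m_assoc)
        also have "\<dots> \<le> (\<Sum>b\<leftarrow>bs. t - ?h (b \<otimes> x))"
        proof (rule member_le_sum_list_nonneg[where f = "\<lambda>b. t - ?h (b \<otimes> x)"])
          show "x0 \<otimes> inv a \<in> set bs" using a(1) fs by (simp add: bs_def)
          show "0 \<le> t - ?h (b \<otimes> x)" if "b \<in> set bs" for b
            using as(2)[of "b \<otimes> x"] bs(1) that x by auto
        qed
        also have "\<dots> = n * t - (\<Sum>b\<leftarrow>bs. ?h (b \<otimes> x))"
          using bs(2) by (simp add: sum_list_subtractf sum_list_triv n_def)
        finally have "(\<Sum>b\<leftarrow>bs. ?h (b \<otimes> x)) \<le> n * t - \<epsilon>/2" by simp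
        then have "(\<Sum>b\<leftarrow>bs. ?h (b \<otimes> x)) / n \<le> (n * t - \<epsilon>/2) / n"
          using n by (intro divide_right_mono) auto
        also have "\<dots> = t - \<epsilon>/(2*n)" using n by (simp add: field_simps)
        also have "(\<Sum>b\<leftarrow>bs. ?h (b \<otimes> x)) / n = avg G bs ?h x"
          unfolding avg_def[of G bs] bs(2) n_def by (simp only: real_scaleR_def divide_inverse_commute)
        finally show ?thesis .
      qed
      then have "t - \<epsilon>/(2*n) \<in> S"
        by (intro SI[OF averaging_products[OF bs(1) as(1)]]) (simp only: avg_products[OF bs(1) as(1)])
      then have "s \<le> t - \<epsilon>/(2*n)" unfolding s_def using S' by (rule cInf_lower)
      then show False using t(2) by (auto simp: \<delta>_def)
    qed
    moreover have "?h x \<le> s + \<epsilon>" if "x \<in> carrier G" for x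
      using as(2)[OF that] t(2) by (simp add: \<delta>_def)
    ultimately have "norm (?h x - s) \<le> \<epsilon>" if "x \<in> carrier G" for x
      using that by (simp add: abs_le_iff algebra_simps)
    then show "\<exists>as. averaging as \<and> (\<forall>x\<in>carrier G. norm (avg G as u x - s) \<le> \<epsilon>)"
      using as(1) by blast
  qed
  then show ?thesis by blast
qed

section \<open>The mean as a faithful positive functional, and its Fubini theorem\<close>

definition mean :: "('a \<Rightarrow> complex) \<Rightarrow> complex" where
  "mean g = (THE c. has_mean g c)"

lemma mean_eqI: "has_mean g c \<Longrightarrow> mean g = c"
  unfolding mean_def using has_mean_unique by blast

lemma has_mean:
  assumes "ucont g"
  shows "has_mean g (mean g)"
proof -
  obtain a where a: "has_mean (\<lambda>x. Re (g x)) a"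
    using exists_mean_real[OF ucont_bounded_linear[OF assms bounded_linear_Re]] by blast
  obtain b where b: "has_mean (\<lambda>x. Im (g x)) b"
    using exists_mean_real[OF ucont_bounded_linear[OF assms bounded_linear_Im]] by blast
  have "has_mean (\<lambda>x. complex_of_real (Re (g x)) + \<i> * complex_of_real (Im (g x)))
      (complex_of_real a + \<i> * complex_of_real b)"
    by (intro has_mean_add has_mean_bounded_linear[OF a bounded_linear_of_real]
      has_mean_bounded_linear[OF has_mean_bounded_linear[OF b bounded_linear_of_real]
        bounded_linear_mult_right])
  then have "has_mean g (complex_of_real a + \<i> * complex_of_real b)"
    by (rule has_mean_cong) (simp flip: complex_eq)
  from mean_eqI[OF this] this show ?thesis by simp
qed

text \<open>Since \<open>mean\<close> is a definite description, uniform continuity of one side is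
  what supplies a mean to be transferred to the other.\<close>

lemma mean_cong: 
  assumes "ucont f" "\<And>x. x \<in> carrier G \<Longrightarrow> f x = g x"
  shows "mean g = mean f"
  using has_mean_cong[OF has_mean[OF assms(1)] assms(2)] by (rule mean_eqI)

lemma mean_const [simp]: "mean (\<lambda>x. c) = c"
  by (rule mean_eqI[OF has_mean_const])

lemma mean_add: "ucont f \<Longrightarrow> ucont g \<Longrightarrow> mean (\<lambda>x. f x + g x) = mean f + mean g"
  by (intro mean_eqI has_mean_add has_mean)

lemma mean_cmult: "ucont f \<Longrightarrow> mean (\<lambda>x. c * f x) = c * mean f"
  by (intro mean_eqI has_mean_bounded_linear[OF _ bounded_linear_mult_right] has_mean)

lemma ucont_cmult: "ucont f \<Longrightarrow> ucont (\<lambda>x. c * f x)" for c :: complex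
  by (intro ucont_mult ucont_const)

lemma ucont_minus: "ucont f \<Longrightarrow> ucont (\<lambda>x. - f x)"
  by (erule ucont_bounded_linear) (intro bounded_linear_minus bounded_linear_ident)

lemma ucont_diff: "ucont f \<Longrightarrow> ucont g \<Longrightarrow> ucont (\<lambda>x. f x - g x)"
  by (drule ucont_minus[of g], drule (1) ucont_add) simp

lemma mean_diff:
  assumes "ucont f" "ucont g"
  shows "mean (\<lambda>x. f x - g x) = mean f - mean g"
  using mean_add[OF assms(1) ucont_cmult[OF assms(2), of "-1"]] mean_cmult[OF assms(2), of "-1"] by simp

lemma ucont_cnj: "ucont f \<Longrightarrow> ucont (\<lambda>x. cnj (f x))"
  by (rule ucont_bounded_linear[OF _ bounded_linear_cnj])

lemma mean_cnj: "ucont f \<Longrightarrow> mean (\<lambda>x. cnj (f x)) = cnj (mean f)"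
  by (intro mean_eqI has_mean_bounded_linear[OF _ bounded_linear_cnj] has_mean)

lemma mean_translate: "ucont f \<Longrightarrow> a \<in> carrier G \<Longrightarrow> mean (\<lambda>x. f (a \<otimes> x)) = mean f"
  by (intro mean_eqI has_mean_translate has_mean)

lemma mean_inv: "ucont f \<Longrightarrow> mean (\<lambda>x. f (inv x)) = mean f"
  by (intro mean_eqI has_mean_inv has_mean)

lemma ucont_sum:
  assumes "\<And>a. a \<in> A \<Longrightarrow> ucont (f a)"
  shows "ucont (\<lambda>x. \<Sum>a\<in>A. f a x)"
  using assms by (induction A rule: infinite_finite_induct) (auto intro: ucont_const ucont_add)

lemma mean_sum:
  assumes "\<And>a. a \<in> A \<Longrightarrow> ucont (f a)"
  shows "mean (\<lambda>x. \<Sum>a\<in>A. f a x) = (\<Sum>a\<in>A. mean (f a))"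
  using assms
  by (induction A rule: infinite_finite_induct) (simp_all add: mean_add ucont_sum)

lemma norm_mean_le:
  assumes "ucont f" "\<And>x. x \<in> carrier G \<Longrightarrow> norm (f x) \<le> B"
  shows "norm (mean f) \<le> B"
  using has_mean_norm_le[OF has_mean[OF assms(1)] assms(2)] .

lemma norm_mean_diff_le:
  assumes "ucont f" "ucont g" "\<And>x. x \<in> carrier G \<Longrightarrow> norm (f x - g x) \<le> B"
  shows "norm (mean f - mean g) \<le> B"
  using norm_mean_le[OF ucont_diff[OF assms(1,2)] assms(3)] mean_diff[OF assms(1,2)] by simp

lemma mean_avg:
  assumes "\<And>z. z \<in> carrier G \<Longrightarrow> ucont (F z)" "averaging as" "x \<in> carrier G"
  shows "ucont (\<lambda>y. avg G as (\<lambda>z. F z y) x)"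
    and "avg G as (\<lambda>z. mean (F z)) x = mean (\<lambda>y. avg G as (\<lambda>z. F z y) x)"
proof -
  have "ucont (\<lambda>y. \<Sum>a\<leftarrow>as. F (a \<otimes> x) y) \<and>
      (\<Sum>a\<leftarrow>as. mean (F (a \<otimes> x))) = mean (\<lambda>y. \<Sum>a\<leftarrow>as. F (a \<otimes> x) y)"
    using assms(2)[THEN conjunct2]
  proof (induction as)
    case (Cons a as)
    then have "ucont (F (a \<otimes> x))" using assms by simp
    then show ?case using Cons by (auto simp: mean_add intro: ucont_add)
  qed (auto intro: ucont_const)
  then show "ucont (\<lambda>y. avg G as (\<lambda>z. F z y) x)"
    and "avg G as (\<lambda>z. mean (F z)) x = mean (\<lambda>y. avg G as (\<lambda>z. F z y) x)"
    unfolding avg_def scaleR_conv_of_real by (auto simp: mean_cmult intro: ucont_cmult)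
qed

text \<open>A single list must average \<open>F y\<close> for all \<open>y\<close> at once.
  \<open>common_averaging_finite\<close> provides one for \<open>y\<close> in a finite net, the
  modulus in \<open>y\<close>, uniform in \<open>z\<close>, extends it to every \<open>y\<close>,
  and \<open>mean_avg\<close> exchanges the outer mean with this finite average.\<close>

lemma mean_fubini:
  fixes F :: "'a \<Rightarrow> 'a \<Rightarrow> complex"
  assumes F: "\<And>\<epsilon>. \<epsilon> > 0 \<Longrightarrow> \<exists>V. nbhd V \<and> (\<forall>y\<in>carrier G. \<forall>z\<in>carrier G. \<forall>v\<in>V.
      norm (F (y \<otimes> v) z - F y z) < \<epsilon> \<and> norm (F y (z \<otimes> v) - F y z) < \<epsilon>)"
  shows "mean (\<lambda>y. mean (\<lambda>z. F y z)) = mean (\<lambda>z. mean (\<lambda>y. F y z))"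
proof -
  have u1: "ucont (\<lambda>y. F y z)" if "z \<in> carrier G" for z
    unfolding ucont_def
  proof (intro allI impI)
    fix \<epsilon> :: real assume "\<epsilon> > 0"
    from F[OF this] show "\<exists>V. nbhd V \<and> (\<forall>y\<in>carrier G. \<forall>v\<in>V. norm (F (y \<otimes> v) z - F y z) < \<epsilon>)"
      using that by (elim exE) (rule exI, auto)
  qed
  have u2: "ucont (\<lambda>z. F y z)" if "y \<in> carrier G" for y
    unfolding ucont_def
  proof (intro allI impI)
    fix \<epsilon> :: real assume "\<epsilon> > 0"
    from F[OF this] show "\<exists>V. nbhd V \<and> (\<forall>z\<in>carrier G. \<forall>v\<in>V. norm (F y (z \<otimes> v) - F y z) < \<epsilon>)"
      using that by (elim exE) (rule exI, auto)
  qed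
  have um: "ucont (\<lambda>y. mean (F y))"
    unfolding ucont_def
  proof (intro allI impI)
    fix \<epsilon> :: real assume e: "\<epsilon> > 0"
    obtain V where V: "nbhd V" "\<forall>y\<in>carrier G. \<forall>z\<in>carrier G. \<forall>v\<in>V.
      norm (F (y \<otimes> v) z - F y z) < \<epsilon>/2 \<and> norm (F y (z \<otimes> v) - F y z) < \<epsilon>/2"
      using F[of "\<epsilon>/2"] e by auto
    have "norm (mean (F (y \<otimes> v)) - mean (F y)) < \<epsilon>" if y: "y \<in> carrier G" and v: "v \<in> V" for y v
    proof -
      have "norm (mean (F (y \<otimes> v)) - mean (F y)) \<le> \<epsilon>/2"
        using y v V nbhd_carrier[OF V(1) v] by (intro norm_mean_diff_le u2) (auto intro: less_imp_le)
      then show ?thesis using e by simp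
    qed
    then show "\<exists>V. nbhd V \<and> (\<forall>y\<in>carrier G. \<forall>v\<in>V. norm (mean (F (y \<otimes> v)) - mean (F y)) < \<epsilon>)"
      using V(1) by auto
  qed
  have "has_mean (\<lambda>z. mean (\<lambda>y. F y z)) (mean (\<lambda>y. mean (F y)))"
    unfolding has_mean_def
  proof (intro allI impI)
    fix \<epsilon> :: real assume e: "\<epsilon> > 0"
    obtain V where V: "nbhd V" "\<forall>y\<in>carrier G. \<forall>z\<in>carrier G. \<forall>v\<in>V.
      norm (F (y \<otimes> v) z - F y z) < \<epsilon>/3 \<and> norm (F y (z \<otimes> v) - F y z) < \<epsilon>/3"
      using F[of "\<epsilon>/3"] e by auto
    obtain Y where Y: "finite Y" "Y \<subseteq> carrier G"
      "\<And>x. x \<in> carrier G \<Longrightarrow> \<exists>a\<in>Y. inv a \<otimes> x \<in> V"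
      by (rule nbhd_net[OF V(1)]) (rule that, auto)
    have "\<exists>as. averaging as \<and> (\<forall>y\<in>Y. \<forall>x\<in>carrier G. norm (avg G as (F y) x - mean (F y)) \<le> \<epsilon>/3)"
      using Y(1,2) e by (intro common_averaging_finite has_mean u2) auto
    then obtain as where as: "averaging as"
      "\<And>y x. y \<in> Y \<Longrightarrow> x \<in> carrier G \<Longrightarrow> norm (avg G as (F y) x - mean (F y)) \<le> \<epsilon>/3" by auto
    have near: "norm (avg G as (F y) x - mean (F y)) \<le> \<epsilon>" if y: "y \<in> carrier G" and x: "x \<in> carrier G" for x y
    proof -
      obtain a where a: "a \<in> Y" "inv a \<otimes> y \<in> V" using Y(3)[OF y] by blast
      have aG: "a \<in> carrier G" using a Y(2) by blast
      have d: "norm (F y z - F a z) \<le> \<epsilon>/3" if "z \<in> carrier G" for z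
        using V(2) a(2) aG that mult_inv_cancel[OF aG y] by (metis less_imp_le)
      have 1: "norm (mean (F y) - mean (F a)) \<le> \<epsilon>/3"
        using d by (intro norm_mean_diff_le u2 y aG)
      have "norm (avg G as (\<lambda>z. F y z + - F a z) x) \<le> \<epsilon>/3"
        using d by (intro norm_avg_le[OF as(1) x]) simp
      then have 2: "norm (avg G as (F y) x - avg G as (F a) x) \<le> \<epsilon>/3"
        unfolding avg_add
        using avg_bounded_linear[OF bounded_linear_minus[OF bounded_linear_ident], of as "F a" x] by simp
      have 3: "norm (avg G as (F a) x - mean (F a)) \<le> \<epsilon>/3" using as(2)[OF a(1) x] .
      have "dist (avg G as (F y) x) (mean (F y)) \<le> \<epsilon>"
        using 1 2 3 unfolding dist_norm[symmetric] by metric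
      then show ?thesis by (simp add: dist_norm)
    qed
    have "norm (avg G as (\<lambda>z. mean (\<lambda>y. F y z)) x - mean (\<lambda>y. mean (F y))) \<le> \<epsilon>"
      if x: "x \<in> carrier G" for x
    proof -
      have "avg G as (\<lambda>z. mean (\<lambda>y. F y z)) x = mean (\<lambda>y. avg G as (F y) x)"
        by (rule mean_avg(2)[OF u1 as(1) x])
      moreover have "ucont (\<lambda>y. avg G as (F y) x)"
        by (rule mean_avg(1)[OF u1 as(1) x])
      ultimately show ?thesis using norm_mean_diff_le[OF _ um, of "\<lambda>y. avg G as (F y) x"] near[OF _ x] by simp
    qed
    then show "\<exists>as. averaging as \<and> (\<forall>x\<in>carrier G.
        norm (avg G as (\<lambda>z. mean (\<lambda>y. F y z)) x - mean (\<lambda>y. mean (F y))) \<le> \<epsilon>)"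
      using as(1) by auto
  qed
  from mean_eqI[OF this] show ?thesis by simp
qed

text \<open>This replaces the full support of Haar measure. The function
  \<open>(cmod (g x))\<^sup>2\<close> exceeds half of its value at \<open>x0\<close> on all of
  \<open>x0 \<otimes> V\<close>, and finitely many translates of that set cover the group, so some
  average is bounded below by a positive constant.\<close>

lemma mean_pos:
  assumes u: "ucont g" and x0: "x0 \<in> carrier G" "g x0 \<noteq> 0"
  shows "Re (mean (\<lambda>x. g x * cnj (g x))) > 0"
proof -
  let ?u = "\<lambda>x. (cmod (g x))\<^sup>2"
  have eq: "g x * cnj (g x) = complex_of_real (?u x)" for x
    by (rule complex_norm_square[symmetric])
  have uc: "ucont (\<lambda>x. g x * cnj (g x))" by (intro ucont_mult ucont_cnj u)
  have uR: "ucont ?u"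
    using ucont_bounded_linear[OF uc bounded_linear_Re] unfolding eq by simp
  have m: "has_mean ?u (Re (mean (\<lambda>x. g x * cnj (g x))))"
    using has_mean_bounded_linear[OF has_mean[OF uc] bounded_linear_Re] unfolding eq by simp
  define e where "e = ?u x0 / 2"
  have e: "e > 0" using x0 by (simp add: e_def)
  obtain V where V: "nbhd V" "\<And>x v. x \<in> carrier G \<Longrightarrow> v \<in> V \<Longrightarrow> norm (?u (x \<otimes> v) - ?u x) < e"
    by (rule ucontD[OF uR e]) (rule that, auto)
  obtain F where F: "finite F" "F \<subseteq> carrier G"
    "\<And>x. x \<in> carrier G \<Longrightarrow> \<exists>a\<in>F. inv a \<otimes> x \<in> V"
    by (rule nbhd_net[OF V(1)]) (rule that, auto)
  obtain fs where fs: "set fs = F" using finite_list[OF F(1)] by blast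
  have "fs \<noteq> []" using F(3)[of \<one>] fs by auto
  define bs where "bs = map (\<lambda>a. x0 \<otimes> inv a) fs"
  have bs: "averaging bs"
    using \<open>fs \<noteq> []\<close> fs F(2) x0 by (auto simp: bs_def)
  have "avg G bs ?u x \<ge> e / length bs" if x: "x \<in> carrier G" for x
  proof -
    obtain a where a: "a \<in> F" "inv a \<otimes> x \<in> V" using F(3)[OF x] by blast
    have aG: "a \<in> carrier G" using a F(2) by blast
    have "norm (?u (x0 \<otimes> (inv a \<otimes> x)) - ?u x0) < e" using V(2)[OF x0(1) a(2)] .
    moreover have "?u x0 = 2 * e" by (simp add: e_def)
    ultimately have "e \<le> ?u (x0 \<otimes> (inv a \<otimes> x))" unfolding real_norm_def by linarith
    also have "\<dots> = ?u (x0 \<otimes> inv a \<otimes> x)" using x x0(1) aG by (simp add: m_assoc)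
    also have "\<dots> \<le> (\<Sum>b\<leftarrow>bs. ?u (b \<otimes> x))"
      using a(1) fs by (intro member_le_sum_list_nonneg[where f = "\<lambda>b. ?u (b \<otimes> x)"]) (auto simp: bs_def)
    finally show ?thesis unfolding avg_def by (simp add: field_simps divide_right_mono)
  qed
  then have "Re (mean (\<lambda>x. g x * cnj (g x))) \<ge> e / length bs"
    by (rule has_mean_ge[OF has_mean_avg[OF m bs]])
  moreover have "e / length bs > 0" using e bs by simp
  ultimately show ?thesis by simp
qed

end

section \<open>The convolution algebra\<close>

context precompact_group
begin

text \<open>The value 0 off the carrier makes agreement on the carrier the same as equality
  (\<open>algebra_ext\<close>), so idempotency or proportionality can be stated as an equation
  between functions. Unlike \<open>undefined\<close>, it is preserved by sums and scalar
  multiples.\<close>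

definition calgebra :: "('a \<Rightarrow> complex) set" where
  "calgebra = {f. ucont f \<and> (\<forall>x. x \<notin> carrier G \<longrightarrow> f x = 0)}"

definition conv :: "('a \<Rightarrow> complex) \<Rightarrow> ('a \<Rightarrow> complex) \<Rightarrow> 'a \<Rightarrow> complex" where
  "conv f g = (\<lambda>x. if x \<in> carrier G then mean (\<lambda>y. f y * g (inv y \<otimes> x)) else 0)"

text \<open>The involution of the group algebra: \<open>star k = k\<close> means that convolution by
  \<open>k\<close> is a Hermitian operator.\<close>

definition star :: "('a \<Rightarrow> complex) \<Rightarrow> 'a \<Rightarrow> complex" where
  "star f = (\<lambda>x. if x \<in> carrier G then cnj (f (inv x)) else 0)"

definition shift :: "'a \<Rightarrow> ('a \<Rightarrow> complex) \<Rightarrow> 'a \<Rightarrow> complex" where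
  "shift a f = (\<lambda>x. if x \<in> carrier G then f (a \<otimes> x) else 0)"

definition ip :: "('a \<Rightarrow> complex) \<Rightarrow> ('a \<Rightarrow> complex) \<Rightarrow> complex" where
  "ip f g = mean (\<lambda>x. f x * cnj (g x))"

definition sqnorm :: "('a \<Rightarrow> complex) \<Rightarrow> real" where
  "sqnorm f = Re (ip f f)"

lemma algebra_ucont: "f \<in> calgebra \<Longrightarrow> ucont f"
  by (simp add: calgebra_def)

lemma algebra_ext:
  assumes "f \<in> calgebra" "g \<in> calgebra" "\<And>x. x \<in> carrier G \<Longrightarrow> f x = g x"
  shows "f = g"
proof
  fix x show "f x = g x" using assms by (cases "x \<in> carrier G") (auto simp: calgebra_def)
qed

lemma algebra_zero: "(\<lambda>x. 0) \<in> calgebra"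
  by (simp add: calgebra_def ucont_const)

lemma algebra_add: "f \<in> calgebra \<Longrightarrow> g \<in> calgebra \<Longrightarrow> (\<lambda>x. f x + g x) \<in> calgebra"
  by (simp add: calgebra_def ucont_add)

lemma algebra_diff: "f \<in> calgebra \<Longrightarrow> g \<in> calgebra \<Longrightarrow> (\<lambda>x. f x - g x) \<in> calgebra"
  by (simp add: calgebra_def ucont_diff)

lemma algebra_cmult: "f \<in> calgebra \<Longrightarrow> (\<lambda>x. c * f x) \<in> calgebra"
  by (simp add: calgebra_def ucont_cmult)

lemma algebra_star: "f \<in> calgebra \<Longrightarrow> star f \<in> calgebra"
  using ucont_cong[of "star f" "\<lambda>x. cnj (f (inv x))"] ucont_cnj[OF ucont_inv, of f]
  by (simp add: calgebra_def star_def)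

lemma algebra_shift: "f \<in> calgebra \<Longrightarrow> a \<in> carrier G \<Longrightarrow> shift a f \<in> calgebra"
  using ucont_cong[of "shift a f" "\<lambda>x. f (a \<otimes> x)"] ucont_translate[of f a]
  by (simp add: calgebra_def shift_def)

lemma star_star: "f \<in> calgebra \<Longrightarrow> star (star f) = f"
  by (rule algebra_ext[OF algebra_star[OF algebra_star]]) (auto simp: star_def)

lemma ucont_conv_kernel:
  fixes f g :: "'a \<Rightarrow> complex"
  assumes "ucont f" "ucont g" "x \<in> carrier G"
  shows "ucont (\<lambda>y. f y * g (inv y \<otimes> x))"
proof -
  have "ucont (\<lambda>y. g (x \<otimes> inv y))"
    using ucont_inv[OF ucont_translate[OF assms(2,3)]] .
  then have "ucont (\<lambda>y. g (inv y \<otimes> x))"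
    by (subst ucont_cong[of _ "\<lambda>y. g (x \<otimes> inv y)"]) (simp_all add: m_comm assms(3))
  from ucont_mult[OF assms(1) this] show ?thesis .
qed

lemma norm_conv_le:
  assumes "ucont f" "ucont g" "x \<in> carrier G"
    "\<And>y. y \<in> carrier G \<Longrightarrow> norm (f y) \<le> B" "\<And>y. y \<in> carrier G \<Longrightarrow> norm (g y) \<le> C"
  shows "norm (conv f g x) \<le> B * C"
proof -
  have B: "B \<ge> 0" using assms(4)[of \<one>] norm_ge_zero order.trans by blast
  have "norm (mean (\<lambda>y. f y * g (inv y \<otimes> x))) \<le> B * C"
    using assms(3,4,5) B by (intro norm_mean_le ucont_conv_kernel assms(1-3)) (auto simp: norm_mult intro!: mult_mono)
  then show ?thesis using assms(3) by (simp add: conv_def)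
qed

lemma conv_diff_right:
  assumes "f \<in> calgebra" "g \<in> calgebra" "h \<in> calgebra"
  shows "conv f (\<lambda>x. g x - h x) = (\<lambda>x. conv f g x - conv f h x)"
  using assms mean_diff[OF ucont_conv_kernel ucont_conv_kernel]
  by (auto simp: conv_def fun_eq_iff right_diff_distrib algebra_ucont)

lemma conv_add_right:
  assumes "f \<in> calgebra" "g \<in> calgebra" "h \<in> calgebra"
  shows "conv f (\<lambda>x. g x + h x) = (\<lambda>x. conv f g x + conv f h x)"
  using assms mean_add[OF ucont_conv_kernel ucont_conv_kernel]
  by (auto simp: conv_def fun_eq_iff distrib_left algebra_ucont)

lemma conv_cmult_right:
  assumes "f \<in> calgebra" "g \<in> calgebra"
  shows "conv f (\<lambda>x. c * g x) = (\<lambda>x. c * conv f g x)"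
  using assms mean_cmult[OF ucont_conv_kernel]
  by (auto simp: conv_def fun_eq_iff mult.left_commute algebra_ucont)

text \<open>The substitution of \<open>x \<otimes> inv y\<close> for \<open>y\<close>, carried out
  as a translation by \<open>x\<close> followed by inversion; the mean is invariant under
  both.\<close>

lemma conv_commute:
  assumes f: "f \<in> calgebra" and g: "g \<in> calgebra"
  shows "conv f g = conv g f"
proof
  fix x
  show "conv f g x = conv g f x"
  proof (cases "x \<in> carrier G")
    case True
    let ?h = "\<lambda>y. f y * g (inv y \<otimes> x)"
    have u: "ucont ?h" using f g True by (intro ucont_conv_kernel algebra_ucont)
    have "mean ?h = mean (\<lambda>y. ?h (x \<otimes> y))" using mean_translate[OF u True] by simp
    also have "\<dots> = mean (\<lambda>y. ?h (x \<otimes> inv y))"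
      using mean_inv[OF ucont_translate[OF u True]] by simp
    also have "\<dots> = mean (\<lambda>y. g y * f (inv y \<otimes> x))"
    proof (rule mean_cong)
      show "ucont (\<lambda>y. g y * f (inv y \<otimes> x))"
        using f g True by (intro ucont_conv_kernel algebra_ucont)
      fix y assume y: "y \<in> carrier G"
      have "inv (x \<otimes> inv y) \<otimes> x = y"
        using y True by (simp add: inv_mult m_assoc m_comm[of "inv x"] m_lcomm)
      then show "g y * f (inv y \<otimes> x) = f (x \<otimes> inv y) * g (inv (x \<otimes> inv y) \<otimes> x)"
        using y True by (simp add: m_comm)
    qed
    finally show ?thesis using True by (simp add: conv_def)
  qed (simp add: conv_def)
qed

text \<open>The modulus of continuity of \<open>g\<close>, rescaled by a bound of \<open>f\<close>,
  serves for the convolution.\<close>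

lemma algebra_conv:
  assumes f: "f \<in> calgebra" and g: "g \<in> calgebra"
  shows "conv f g \<in> calgebra"
proof -
  have "ucont (conv f g)"
    unfolding ucont_def
  proof (intro allI impI)
    fix \<epsilon> :: real assume e: "\<epsilon> > 0"
    obtain B where B: "B > 0" "\<And>x. x \<in> carrier G \<Longrightarrow> norm (f x) \<le> B"
      by (rule ucont_bounded[OF algebra_ucont[OF f]]) (rule that, auto)
    have "\<epsilon>/(2*B) > 0" using e B by simp
    then obtain V where V: "nbhd V"
      "\<And>x v. x \<in> carrier G \<Longrightarrow> v \<in> V \<Longrightarrow> norm (g (x \<otimes> v) - g x) < \<epsilon>/(2*B)"
      by (rule ucontD[OF algebra_ucont[OF g]]) (rule that, auto)
    have "norm (conv f g (x \<otimes> v) - conv f g x) < \<epsilon>" if x: "x \<in> carrier G" and v: "v \<in> V" for x v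
    proof -
      have vG: "v \<in> carrier G" using nbhd_carrier[OF V(1) v] .
      have "norm (mean (\<lambda>y. f y * g (inv y \<otimes> (x \<otimes> v))) - mean (\<lambda>y. f y * g (inv y \<otimes> x))) \<le> B * (\<epsilon>/(2*B))"
      proof (rule norm_mean_diff_le)
        fix y assume y: "y \<in> carrier G"
        have "norm (f y * (g (inv y \<otimes> x \<otimes> v) - g (inv y \<otimes> x))) \<le> B * (\<epsilon>/(2*B))"
          unfolding norm_mult using y x v B by (intro mult_mono less_imp_le[OF V(2)]) auto
        then show "norm (f y * g (inv y \<otimes> (x \<otimes> v)) - f y * g (inv y \<otimes> x)) \<le> B * (\<epsilon>/(2*B))"
          using x y vG by (simp add: m_assoc right_diff_distrib)
      qed (use x vG in \<open>simp_all add: ucont_conv_kernel[OF algebra_ucont[OF f] algebra_ucont[OF g]]\<close>)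
      then show ?thesis using x vG e B by (simp add: conv_def)
    qed
    then show "\<exists>V. nbhd V \<and> (\<forall>x\<in>carrier G. \<forall>v\<in>V. norm (conv f g (x \<otimes> v) - conv f g x) < \<epsilon>)"
      using V(1) by auto
  qed
  then show ?thesis by (simp add: calgebra_def conv_def)
qed

lemma conv_diff_left:
  assumes "f \<in> calgebra" "g \<in> calgebra" "h \<in> calgebra"
  shows "conv (\<lambda>x. g x - h x) f = (\<lambda>x. conv g f x - conv h f x)"
  using conv_diff_right[OF assms] conv_commute[OF assms(1)] assms algebra_diff by metis

lemma conv_add_left:
  assumes "f \<in> calgebra" "g \<in> calgebra" "h \<in> calgebra"
  shows "conv (\<lambda>x. g x + h x) f = (\<lambda>x. conv g f x + conv h f x)"
  using conv_add_right[OF assms] conv_commute[OF assms(1)] assms algebra_add by metis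

lemma conv_cmult_left:
  assumes "f \<in> calgebra" "g \<in> calgebra"
  shows "conv (\<lambda>x. c * g x) f = (\<lambda>x. c * conv g f x)"
  using conv_cmult_right[OF assms] conv_commute[OF assms(1)] assms algebra_cmult by metis

text \<open>The hypothesis of \<open>mean_fubini\<close> together with a bound. The bound makes the
  class closed under products, so that the integrand of \<open>conv_assoc\<close> can be assembled
  from its three factors.\<close>

definition biucont :: "('a \<Rightarrow> 'a \<Rightarrow> complex) \<Rightarrow> bool" where
  "biucont F \<longleftrightarrow>
     (\<exists>B>0. \<forall>y\<in>carrier G. \<forall>z\<in>carrier G. norm (F y z) \<le> B) \<and>
     (\<forall>\<epsilon>>0. \<exists>V. nbhd V \<and> (\<forall>y\<in>carrier G. \<forall>z\<in>carrier G. \<forall>v\<in>V.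
        norm (F (y \<otimes> v) z - F y z) < \<epsilon> \<and> norm (F y (z \<otimes> v) - F y z) < \<epsilon>))"

lemma biucont_bounded:
  assumes "biucont F"
  obtains B where "B > 0" "\<And>y z. y \<in> carrier G \<Longrightarrow> z \<in> carrier G \<Longrightarrow> norm (F y z) \<le> B"
proof -
  have "\<exists>B>0. \<forall>y\<in>carrier G. \<forall>z\<in>carrier G. norm (F y z) \<le> B"
    using assms unfolding biucont_def by (rule conjunct1)
  then show ?thesis by (elim exE conjE) (rule that, auto)
qed

lemma biucont_modulus:
  assumes "biucont F" "\<epsilon> > 0"
  shows "\<exists>V. nbhd V \<and> (\<forall>y\<in>carrier G. \<forall>z\<in>carrier G. \<forall>v\<in>V.
      norm (F (y \<otimes> v) z - F y z) < \<epsilon> \<and> norm (F y (z \<otimes> v) - F y z) < \<epsilon>)"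
  using assms(1)[unfolded biucont_def, THEN conjunct2] assms(2) by simp

lemma biucont_mult:
  assumes "biucont F" "biucont H"
  shows "biucont (\<lambda>y z. F y z * H y z)"
proof -
  obtain B where B: "B > 0" "\<And>y z. y \<in> carrier G \<Longrightarrow> z \<in> carrier G \<Longrightarrow> norm (F y z) \<le> B"
    by (rule biucont_bounded[OF assms(1)]) (rule that, auto)
  obtain C where C: "C > 0" "\<And>y z. y \<in> carrier G \<Longrightarrow> z \<in> carrier G \<Longrightarrow> norm (H y z) \<le> C"
    by (rule biucont_bounded[OF assms(2)]) (rule that, auto)
  have "norm (F y z * H y z) \<le> B * C" if "y \<in> carrier G" "z \<in> carrier G" for y z
    unfolding norm_mult using B C that by (intro mult_mono) auto
  moreover have "\<exists>V. nbhd V \<and> (\<forall>y\<in>carrier G. \<forall>z\<in>carrier G. \<forall>v\<in>V.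
        norm (F (y \<otimes> v) z * H (y \<otimes> v) z - F y z * H y z) < \<epsilon> \<and>
        norm (F y (z \<otimes> v) * H y (z \<otimes> v) - F y z * H y z) < \<epsilon>)" if e: "\<epsilon> > 0" for \<epsilon>
  proof -
    have e1: "\<epsilon>/(2*C) > 0" and e2: "\<epsilon>/(2*B) > 0" using e B C by auto
    obtain V where V: "nbhd V" "\<forall>y\<in>carrier G. \<forall>z\<in>carrier G. \<forall>v\<in>V.
        norm (F (y \<otimes> v) z - F y z) < \<epsilon>/(2*C) \<and> norm (F y (z \<otimes> v) - F y z) < \<epsilon>/(2*C)"
      using biucont_modulus[OF assms(1) e1] by auto
    obtain W where W: "nbhd W" "\<forall>y\<in>carrier G. \<forall>z\<in>carrier G. \<forall>v\<in>W.
        norm (H (y \<otimes> v) z - H y z) < \<epsilon>/(2*B) \<and> norm (H y (z \<otimes> v) - H y z) < \<epsilon>/(2*B)"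
      using biucont_modulus[OF assms(2) e2] by auto
    show ?thesis
    proof (intro exI[of _ "V \<inter> W"] conjI ballI)
      show "nbhd (V \<inter> W)" using V W by (intro nbhd_Int)
      fix y z v assume y: "y \<in> carrier G" and z: "z \<in> carrier G" and v: "v \<in> V \<inter> W"
      have vG: "v \<in> carrier G" using v nbhd_carrier[OF V(1)] by simp
      show "norm (F (y \<otimes> v) z * H (y \<otimes> v) z - F y z * H y z) < \<epsilon>"
        using V(2) W(2) B C y z v vG by (intro norm_mult_diff_less[of _ _ _ C _ _ B]) auto
      show "norm (F y (z \<otimes> v) * H y (z \<otimes> v) - F y z * H y z) < \<epsilon>"
        using V(2) W(2) B C y z v vG by (intro norm_mult_diff_less[of _ _ _ C _ _ B]) auto
    qed
  qed
  moreover have "B * C > 0" using B C by simp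
  ultimately show ?thesis
    unfolding biucont_def by (intro conjI allI impI exI[of _ "B * C"]) simp_all
qed

lemma biucont_fst:
  assumes "f \<in> calgebra"
  shows "biucont (\<lambda>y z. f y)"
  unfolding biucont_def
proof (intro conjI allI impI)
  obtain B where B: "B > 0" "\<And>x. x \<in> carrier G \<Longrightarrow> norm (f x) \<le> B"
    by (rule ucont_bounded[OF algebra_ucont[OF assms]]) (rule that, auto)
  then show "\<exists>B>0. \<forall>y\<in>carrier G. \<forall>z\<in>carrier G. norm (f y) \<le> B" by auto
  fix \<epsilon> :: real assume e: "\<epsilon> > 0"
  obtain V where V: "nbhd V" "\<And>x v. x \<in> carrier G \<Longrightarrow> v \<in> V \<Longrightarrow> norm (f (x \<otimes> v) - f x) < \<epsilon>"
    by (rule ucontD[OF algebra_ucont[OF assms] e]) (rule that, auto)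
  then show "\<exists>V. nbhd V \<and> (\<forall>y\<in>carrier G. \<forall>z\<in>carrier G. \<forall>v\<in>V.
        norm (f (y \<otimes> v) - f y) < \<epsilon> \<and> norm (f y - f y) < \<epsilon>)"
    using e by auto
qed

lemma biucont_snd:
  assumes "f \<in> calgebra" "x \<in> carrier G"
  shows "biucont (\<lambda>y z. f (inv z \<otimes> x))"
proof -
  let ?g = "\<lambda>z. if z \<in> carrier G then f (inv z \<otimes> x) else 0"
  \<comment> \<open>The factor 1 brings the function into the shape of
    \<open>ucont_conv_kernel\<close>.\<close>
  have "ucont (\<lambda>z. 1 * f (inv z \<otimes> x))"
    using assms by (intro ucont_conv_kernel ucont_const algebra_ucont)
  then have "ucont ?g" by (subst ucont_cong[of _ "\<lambda>z. 1 * f (inv z \<otimes> x)"]) auto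
  then have "?g \<in> calgebra" by (simp add: calgebra_def)
  note g = biucont_fst[OF this]
  obtain B where B: "B > 0" "\<And>y z. y \<in> carrier G \<Longrightarrow> z \<in> carrier G \<Longrightarrow> norm (?g y) \<le> B"
    by (rule biucont_bounded[OF g]) (rule that, auto)
  show ?thesis
    unfolding biucont_def
  proof (intro conjI allI impI)
    show "\<exists>B>0. \<forall>y\<in>carrier G. \<forall>z\<in>carrier G. norm (f (inv z \<otimes> x)) \<le> B"
      using B(1) B(2)[OF _ one_closed] by auto
    fix \<epsilon> :: real assume e: "\<epsilon> > 0"
    obtain V where V: "nbhd V" "\<forall>y\<in>carrier G. \<forall>z\<in>carrier G. \<forall>v\<in>V.
        norm (?g (y \<otimes> v) - ?g y) < \<epsilon> \<and> norm (?g y - ?g y) < \<epsilon>"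
      using biucont_modulus[OF g e] by auto
    show "\<exists>V. nbhd V \<and> (\<forall>y\<in>carrier G. \<forall>z\<in>carrier G. \<forall>v\<in>V.
        norm (f (inv z \<otimes> x) - f (inv z \<otimes> x)) < \<epsilon> \<and>
        norm (f (inv (z \<otimes> v) \<otimes> x) - f (inv z \<otimes> x)) < \<epsilon>)"
    proof (intro exI[of _ V] conjI ballI V(1))
      fix y z v assume "y \<in> carrier G" "z \<in> carrier G" and v: "v \<in> V"
      then have "norm (?g (z \<otimes> v) - ?g z) < \<epsilon>" using V(2) by blast
      then show "norm (f (inv (z \<otimes> v) \<otimes> x) - f (inv z \<otimes> x)) < \<epsilon>"
        using \<open>z \<in> carrier G\<close> nbhd_carrier[OF V(1) v] by simp
    qed (use e in auto)
  qed
qed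

lemma biucont_quotient:
  assumes "f \<in> calgebra"
  shows "biucont (\<lambda>y z. f (inv y \<otimes> z))"
  unfolding biucont_def
proof (intro conjI allI impI)
  obtain B where B: "B > 0" "\<And>x. x \<in> carrier G \<Longrightarrow> norm (f x) \<le> B"
    by (rule ucont_bounded[OF algebra_ucont[OF assms]]) (rule that, auto)
  then show "\<exists>B>0. \<forall>y\<in>carrier G. \<forall>z\<in>carrier G. norm (f (inv y \<otimes> z)) \<le> B" by auto
  fix \<epsilon> :: real assume e: "\<epsilon> > 0"
  obtain V where V: "nbhd V" "\<And>x v. x \<in> carrier G \<Longrightarrow> v \<in> V \<Longrightarrow> norm (f (x \<otimes> v) - f x) < \<epsilon>"
    by (rule ucontD[OF algebra_ucont[OF assms] e]) (rule that, auto)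
  show "\<exists>V. nbhd V \<and> (\<forall>y\<in>carrier G. \<forall>z\<in>carrier G. \<forall>v\<in>V.
        norm (f (inv (y \<otimes> v) \<otimes> z) - f (inv y \<otimes> z)) < \<epsilon> \<and>
        norm (f (inv y \<otimes> (z \<otimes> v)) - f (inv y \<otimes> z)) < \<epsilon>)"
  proof (intro exI conjI ballI)
    show "nbhd (V \<inter> {x \<in> carrier G. inv x \<in> V})"
      using nbhd_Int[OF V(1) nbhd_inv[OF V(1)]] .
    fix y z v assume y: "y \<in> carrier G" and z: "z \<in> carrier G"
      and v: "v \<in> V \<inter> {x \<in> carrier G. inv x \<in> V}"
    have "inv (y \<otimes> v) \<otimes> z = inv y \<otimes> z \<otimes> inv v"
      using y z v by (simp add: inv_mult m_assoc m_comm[of z])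
    then show "norm (f (inv (y \<otimes> v) \<otimes> z) - f (inv y \<otimes> z)) < \<epsilon>"
      using V(2)[of "inv y \<otimes> z" "inv v"] y z v by simp
    show "norm (f (inv y \<otimes> (z \<otimes> v)) - f (inv y \<otimes> z)) < \<epsilon>"
      using V(2)[of "inv y \<otimes> z" v] y z v by (simp add: m_assoc)
  qed
qed

text \<open>Fubini for the triple product \<open>?F\<close>. On the right-hand side the inner
  variable is first translated by \<open>inv y\<close>, which turns
  \<open>g z * h (inv z \<otimes> (inv y \<otimes> x))\<close> into
  \<open>g (inv y \<otimes> z) * h (inv z \<otimes> x)\<close>.\<close>

lemma conv_assoc:
  assumes f: "f \<in> calgebra" and g: "g \<in> calgebra" and h: "h \<in> calgebra"
  shows "conv (conv f g) h = conv f (conv g h)"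
proof (rule algebra_ext)
  fix x assume x: "x \<in> carrier G"
  let ?F = "\<lambda>y z. f y * g (inv y \<otimes> z) * h (inv z \<otimes> x)"
  have "biucont ?F"
    by (intro biucont_mult biucont_fst biucont_quotient biucont_snd f g h x)
  then have "mean (\<lambda>y. mean (\<lambda>z. ?F y z)) = mean (\<lambda>z. mean (\<lambda>y. ?F y z))"
    by (intro mean_fubini biucont_modulus)
  moreover have "conv (conv f g) h x = mean (\<lambda>z. mean (\<lambda>y. ?F y z))"
  proof -
    have "mean (\<lambda>z. mean (\<lambda>y. ?F y z)) = mean (\<lambda>z. conv f g z * h (inv z \<otimes> x))"
    proof (rule mean_cong)
      show "ucont (\<lambda>z. conv f g z * h (inv z \<otimes> x))"
        by (intro ucont_conv_kernel algebra_ucont[OF algebra_conv[OF f g]] algebra_ucont[OF h] x)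
      fix z assume z: "z \<in> carrier G"
      then show "conv f g z * h (inv z \<otimes> x) = mean (\<lambda>y. ?F y z)"
        using mean_cmult[OF ucont_conv_kernel[OF algebra_ucont[OF f] algebra_ucont[OF g] z], of "h (inv z \<otimes> x)"]
        by (simp add: conv_def mult.commute)
    qed
    then show ?thesis using x by (simp add: conv_def[of "conv f g"])
  qed
  moreover have "conv f (conv g h) x = mean (\<lambda>y. mean (\<lambda>z. ?F y z))"
  proof -
    have "mean (\<lambda>y. mean (\<lambda>z. ?F y z)) = mean (\<lambda>y. f y * conv g h (inv y \<otimes> x))"
    proof (rule mean_cong)
      show "ucont (\<lambda>y. f y * conv g h (inv y \<otimes> x))"
        by (intro ucont_conv_kernel algebra_ucont[OF algebra_conv[OF g h]] algebra_ucont[OF f] x)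
      fix y assume y: "y \<in> carrier G"
      let ?k = "\<lambda>z. g z * h (inv z \<otimes> (inv y \<otimes> x))"
      have k: "ucont ?k"
        using x y by (intro ucont_conv_kernel algebra_ucont[OF g] algebra_ucont[OF h]) simp
      have k': "ucont (\<lambda>z. ?k (inv y \<otimes> z))" using ucont_translate[OF k] y by simp
      have "f y * conv g h (inv y \<otimes> x) = f y * mean (\<lambda>z. ?k (inv y \<otimes> z))"
        using mean_translate[OF k, of "inv y"] x y by (simp add: conv_def)
      also have "\<dots> = mean (\<lambda>z. f y * ?k (inv y \<otimes> z))" using mean_cmult[OF k'] by simp
      also have "\<dots> = mean (\<lambda>z. ?F y z)"
      proof (rule mean_cong[OF ucont_cmult[OF k'], symmetric])
        fix z assume z: "z \<in> carrier G"
        have "inv (inv y \<otimes> z) \<otimes> (inv y \<otimes> x) = inv z \<otimes> x"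
          using x y z by (simp add: inv_mult m_assoc m_comm[of "inv z"] mult_inv_cancel m_lcomm)
        then show "f y * ?k (inv y \<otimes> z) = ?F y z" by simp
      qed
      finally show "f y * conv g h (inv y \<otimes> x) = mean (\<lambda>z. ?F y z)" .
    qed
    then show ?thesis using x by (simp add: conv_def[of f])
  qed
  ultimately show "conv (conv f g) h x = conv f (conv g h) x" by simp
qed (intro algebra_conv f g h)+

lemma star_conv:
  assumes f: "f \<in> calgebra" and g: "g \<in> calgebra"
  shows "star (conv f g) = conv (star f) (star g)"
proof (rule algebra_ext)
  fix x assume x: "x \<in> carrier G"
  have u: "ucont (\<lambda>y. f y * g (inv y \<otimes> inv x))"
    using f g x by (intro ucont_conv_kernel algebra_ucont) simp_all
  have "star (conv f g) x = mean (\<lambda>y. cnj (f y * g (inv y \<otimes> inv x)))"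
    using x mean_cnj[OF u] by (simp add: star_def conv_def)
  also have "\<dots> = mean (\<lambda>y. cnj (f (inv y) * g (inv (inv y) \<otimes> inv x)))"
    using mean_inv[OF ucont_cnj[OF u]] by simp
  also have "\<dots> = mean (\<lambda>y. star f y * star g (inv y \<otimes> x))"
    using f g x
    by (intro mean_cong ucont_conv_kernel algebra_ucont algebra_star)
       (auto simp: star_def inv_mult)
  finally show "star (conv f g) x = conv (star f) (star g) x" using x by (simp add: conv_def)
qed (intro algebra_star algebra_conv f g)+

section \<open>The inner product and its control of convolutions\<close>

lemma ucont_ip: "f \<in> calgebra \<Longrightarrow> g \<in> calgebra \<Longrightarrow> ucont (\<lambda>x. f x * cnj (g x))"
  by (intro ucont_mult ucont_cnj algebra_ucont)

text \<open>The bridge from the algebra to Hilbert space geometry: values of convolutions are inner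
  products with translates. At \<open>\<one>\<close> the translate disappears, so evaluation at
  \<open>\<one>\<close> behaves like a trace.\<close>

lemma conv_star:
  assumes "f \<in> calgebra" "g \<in> calgebra" "x \<in> carrier G"
  shows "conv f (star g) x = ip f (shift (inv x) g)"
proof -
  have "mean (\<lambda>y. f y * star g (inv y \<otimes> x)) = ip f (shift (inv x) g)"
    unfolding ip_def using assms
    by (intro mean_cong ucont_ip algebra_shift)
       (auto simp: star_def shift_def inv_mult m_comm)
  then show ?thesis using assms(3) by (simp add: conv_def)
qed

lemma conv_star_one:
  assumes "f \<in> calgebra" "g \<in> calgebra"
  shows "conv f (star g) \<one> = ip f g"
proof -
  have "shift \<one> g = g"
    by (rule algebra_ext[OF algebra_shift[OF assms(2)] assms(2)]) (auto simp: shift_def)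
  then show ?thesis using conv_star[OF assms, of \<one>] by simp
qed

lemma ip_diff_left: "f \<in> calgebra \<Longrightarrow> g \<in> calgebra \<Longrightarrow> h \<in> calgebra \<Longrightarrow>
    ip (\<lambda>x. f x - g x) h = ip f h - ip g h"
  unfolding ip_def left_diff_distrib by (intro mean_diff ucont_ip)

lemma ip_cmult_left: "f \<in> calgebra \<Longrightarrow> g \<in> calgebra \<Longrightarrow> ip (\<lambda>x. c * f x) g = c * ip f g"
  unfolding ip_def mult.assoc by (intro mean_cmult ucont_ip)

lemma ip_commute: "f \<in> calgebra \<Longrightarrow> g \<in> calgebra \<Longrightarrow> ip g f = cnj (ip f g)"
  unfolding ip_def using mean_cnj[OF ucont_ip, of f g] by (simp add: mult.commute)

lemma ip_self: "f \<in> calgebra \<Longrightarrow> ip f f = of_real (sqnorm f)"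
  using ip_commute[of f f] unfolding sqnorm_def by (metis Reals_cnj_iff of_real_Re)

lemma sqnorm_diff:
  assumes "f \<in> calgebra" "g \<in> calgebra"
  shows "sqnorm (\<lambda>x. f x - g x) = sqnorm f - 2 * Re (ip f g) + sqnorm g"
proof -
  let ?d = "\<lambda>x. f x - g x"
  have d: "?d \<in> calgebra" using assms by (rule algebra_diff)
  have "ip ?d ?d = ip f ?d - ip g ?d" using assms d by (intro ip_diff_left)
  moreover have "ip f ?d = cnj (ip f f - ip g f)"
    by (simp only: ip_commute[OF d assms(1)] ip_diff_left[OF assms assms(1)])
  moreover have "ip g ?d = cnj (ip f g - ip g g)"
    by (simp only: ip_commute[OF d assms(2)] ip_diff_left[OF assms assms(2)])
  moreover have "Re (ip g f) = Re (ip f g)" using ip_commute[OF assms] by simp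
  ultimately show ?thesis by (simp add: sqnorm_def)
qed

lemma sqnorm_pos:
  assumes "f \<in> calgebra" "f \<noteq> (\<lambda>x. 0)"
  shows "sqnorm f > 0"
proof -
  obtain x where "x \<in> carrier G" "f x \<noteq> 0"
    using algebra_ext[OF assms(1) algebra_zero] assms(2) by blast
  then show ?thesis unfolding sqnorm_def ip_def using assms(1) by (intro mean_pos algebra_ucont)
qed

lemma sqnorm_zero: "sqnorm (\<lambda>x. 0) = 0"
  by (simp add: sqnorm_def ip_def)

lemma sqnorm_nonneg: "f \<in> calgebra \<Longrightarrow> sqnorm f \<ge> 0"
  using sqnorm_pos sqnorm_zero by (cases "f = (\<lambda>x. 0)") (auto simp: less_imp_le)

lemma Cauchy_Schwarz_ip:
  assumes f: "f \<in> calgebra" and g: "g \<in> calgebra"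
  shows "(norm (ip f g))\<^sup>2 \<le> sqnorm f * sqnorm g"
proof (cases "g = (\<lambda>x. 0)")
  case True
  then show ?thesis by (simp add: ip_def sqnorm_zero)
next
  case False
  then have pos: "sqnorm g > 0" using g sqnorm_pos by blast
  \<comment> \<open>The coefficient of the orthogonal projection of \<open>f\<close> to the line
    through \<open>g\<close>.\<close>
  define c where "c = ip f g / of_real (sqnorm g)"
  have cg: "(\<lambda>x. c * g x) \<in> calgebra" using g by (rule algebra_cmult)
  have 1: "ip g (\<lambda>x. c * g x) = cnj c * of_real (sqnorm g)"
    using ip_commute[OF cg g] ip_cmult_left[OF g g, of c] ip_self[OF g] by simp
  have 2: "ip f (\<lambda>x. c * g x) = cnj c * ip f g"
    using ip_commute[OF cg f] ip_cmult_left[OF g f, of c] ip_commute[OF g f] by simp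
  have cz: "ip f g * cnj (ip f g) = of_real ((norm (ip f g))\<^sup>2)"
    by (rule complex_norm_square[symmetric])
  have cc: "cnj c * ip f g = of_real ((norm (ip f g))\<^sup>2 / sqnorm g)"
    unfolding of_real_divide cz[symmetric] c_def by simp
  have "c * (cnj c * of_real (sqnorm g)) = of_real ((norm (ip f g))\<^sup>2 / sqnorm g)"
    unfolding of_real_divide cz[symmetric] c_def using pos by simp
  then have 3: "sqnorm (\<lambda>x. c * g x) = (norm (ip f g))\<^sup>2 / sqnorm g"
    unfolding sqnorm_def ip_cmult_left[OF g cg] 1 by simp
  have "0 \<le> sqnorm (\<lambda>x. f x - c * g x)" using f cg by (intro sqnorm_nonneg algebra_diff)
  also have "\<dots> = sqnorm f - (norm (ip f g))\<^sup>2 / sqnorm g"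
    unfolding sqnorm_diff[OF f cg] 2 3 cc by simp
  finally show ?thesis using pos by (simp add: field_simps)
qed

lemma sqnorm_shift:
  assumes f: "f \<in> calgebra" and a: "a \<in> carrier G"
  shows "sqnorm (shift a f) = sqnorm f"
proof -
  have u: "ucont (\<lambda>x. f x * cnj (f x))" using f by (intro ucont_ip)
  have "mean (\<lambda>x. shift a f x * cnj (shift a f x)) = mean (\<lambda>x. f (a \<otimes> x) * cnj (f (a \<otimes> x)))"
    by (rule mean_cong[OF ucont_translate[OF u a]]) (simp add: shift_def)
  then show ?thesis unfolding sqnorm_def ip_def using mean_translate[OF u a] by simp
qed

lemma sqnorm_star:
  assumes f: "f \<in> calgebra"
  shows "sqnorm (star f) = sqnorm f"
proof -
  have u: "ucont (\<lambda>x. f x * cnj (f x))" using f by (intro ucont_ip)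
  have "mean (\<lambda>x. star f x * cnj (star f x)) = mean (\<lambda>x. f (inv x) * cnj (f (inv x)))"
    by (rule mean_cong[OF ucont_inv[OF u]]) (simp add: star_def mult.commute)
  then show ?thesis unfolding sqnorm_def ip_def using mean_inv[OF u] by simp
qed

text \<open>Cauchy-Schwarz for the inner product behind a convolution. It bounds a supremum by
  mean-square norms, hence upgrades mean-square convergence to uniform convergence after one
  convolution.\<close>

lemma norm_conv_le_sqnorm:
  assumes f: "f \<in> calgebra" and g: "g \<in> calgebra" and x: "x \<in> carrier G"
  shows "(norm (conv f g x))\<^sup>2 \<le> sqnorm f * sqnorm g"
proof -
  have sg: "star g \<in> calgebra" using g by (rule algebra_star)
  have "conv f g x = ip f (shift (inv x) (star g))"
    using conv_star[OF f sg x] star_star[OF g] by simp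
  moreover have "sqnorm (shift (inv x) (star g)) = sqnorm g"
    using sqnorm_shift[OF sg] sqnorm_star[OF g] x by simp
  ultimately show ?thesis
    using Cauchy_Schwarz_ip[OF f algebra_shift[OF sg], of "inv x"] x by simp
qed

end

section \<open>Idempotents and characters\<close>

text \<open>In the application \<open>a n\<close> is the trace of the \<open>2(n + 1)\<close>-th power of a Hermitian operator
  and \<open>l\<close> the square of its norm.\<close>

lemma trace_sequence_limit:
  fixes a :: "nat \<Rightarrow> real"
  assumes pos: "\<And>n. a n > 0"
    and logconvex: "\<And>n. (a (Suc n))\<^sup>2 \<le> a n * a (Suc (Suc n))"
    and submult: "\<And>m n. a (Suc (m + n)) \<le> a m * a n"
  obtains l where "l > 0" "decseq (\<lambda>n. a n / l ^ Suc n)" "\<And>n. a n / l ^ Suc n \<ge> 1"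
proof -
  \<comment> \<open>Log-convexity makes these ratios increase and submultiplicativity bounds them by
    \<open>a 0\<close>; \<open>l\<close> is their limit.\<close>
  define r where "r n = a (Suc n) / a n" for n
  have rpos: "r n > 0" for n using pos by (simp add: r_def)
  have inc: "incseq r"
  proof (rule incseq_SucI)
    fix n show "r n \<le> r (Suc n)"
      using logconvex[of n] pos[of n] pos[of "Suc n"]
      by (simp add: r_def divide_simps power2_eq_square mult.commute)
  qed
  have bd: "r n \<le> a 0" for n
    using submult[of 0 n] pos[of n] by (simp add: r_def divide_simps)
  obtain l where l: "r \<longlonglongrightarrow> l" "\<And>n. r n \<le> l"
    using incseq_convergent[OF inc, of "a 0"] bd by auto
  have lpos: "l > 0" using rpos[of 0] l(2)[of 0] by simp
  have step: "a (Suc n) = r n * a n" for n using pos[of n] by (simp add: r_def)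
  have "decseq (\<lambda>n. a n / l ^ Suc n)"
  proof (rule decseq_SucI)
    fix n
    have "a (Suc n) \<le> l * a n" unfolding step using l(2)[of n] pos[of n] by (intro mult_right_mono) auto
    then have "a (Suc n) / l ^ Suc (Suc n) \<le> (l * a n) / l ^ Suc (Suc n)"
      using lpos by (intro divide_right_mono) auto
    also have "\<dots> = a n / l ^ Suc n" using lpos by simp
    finally show "a (Suc n) / l ^ Suc (Suc n) \<le> a n / l ^ Suc n" .
  qed
  moreover have "a m / l ^ Suc m \<ge> 1" for m
  proof -
    \<comment> \<open>Increasing ratios force geometric growth from index \<open>n\<close> on.
      Comparing with \<open>a (Suc (m + n)) \<le> a m * a n\<close>, the factor \<open>a n\<close>
      cancels and a bound on \<open>r n ^ Suc m\<close> remains that does not depend on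
      \<open>n\<close>.\<close>
    have grow: "r n ^ k * a n \<le> a (n + k)" for n k
    proof (induction k)
      case (Suc k)
      have "r n ^ Suc k * a n = r n * (r n ^ k * a n)" by simp
      also have "\<dots> \<le> r (n + k) * a (n + k)"
        using Suc incseqD[OF inc, of n "n + k"] rpos pos by (intro mult_mono) (auto intro: less_imp_le)
      finally show ?case using step by simp
    qed simp
    have "r n ^ Suc m \<le> a m" for n
    proof -
      have "r n ^ Suc m * a n \<le> a m * a n"
        using grow[of n "Suc m"] submult[of m n] by (simp add: add.commute)
      then show ?thesis using pos[of n] by (simp add: mult_le_cancel_right)
    qed
    then have "l ^ Suc m \<le> a m"
      by (intro LIMSEQ_le_const2[OF tendsto_power[OF l(1)]]) auto
    then show ?thesis using lpos by simp
  qed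
  ultimately show ?thesis using lpos that by blast
qed

context precompact_group
begin

section \<open>Convolution powers and spectral idempotents\<close>

lemma star_add: "star (\<lambda>x. f x + g x) = (\<lambda>x. star f x + star g x)"
  by (simp add: star_def fun_eq_iff)

lemma star_diff: "star (\<lambda>x. f x - g x) = (\<lambda>x. star f x - star g x)"
  by (simp add: star_def fun_eq_iff)

lemma star_cmult: "star (\<lambda>x. c * f x) = (\<lambda>x. cnj c * star f x)"
  by (simp add: star_def fun_eq_iff)

lemma tendsto_conv:
  assumes f: "f \<in> calgebra" and g: "\<And>n. g n \<in> calgebra" and h: "h \<in> calgebra"
    and lim: "uniform_limit (carrier G) g h sequentially" and x: "x \<in> carrier G"
  shows "(\<lambda>n. conv f (g n) x) \<longlonglongrightarrow> conv f h x"
proof (rule tendstoI)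
  fix \<epsilon> :: real assume e: "\<epsilon> > 0"
  obtain B where B: "B > 0" "\<And>x. x \<in> carrier G \<Longrightarrow> norm (f x) \<le> B"
    by (rule ucont_bounded[OF algebra_ucont[OF f]]) (rule that, auto)
  have "\<epsilon>/(2*B) > 0" using e B by simp
  from uniform_limitD[OF lim this]
  show "\<forall>\<^sub>F n in sequentially. dist (conv f (g n) x) (conv f h x) < \<epsilon>"
  proof eventually_elim
    case (elim n)
    have d: "(\<lambda>x. g n x - h x) \<in> calgebra" using g h by (intro algebra_diff)
    have "norm (conv f (\<lambda>x. g n x - h x) x) \<le> B * (\<epsilon>/(2*B))"
      using elim B(2) by (intro norm_conv_le algebra_ucont f d x) (auto simp: dist_norm intro: less_imp_le)
    then show ?case using B e by (simp add: conv_diff_right[OF f g h] dist_norm)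
  qed
qed

lemma algebra_limit:
  assumes g: "\<And>n. g n \<in> calgebra" and lim: "uniform_limit UNIV g h sequentially"
  shows "h \<in> calgebra"
proof -
  have "ucont h"
  proof (rule ucont_limit)
    fix \<epsilon> :: real assume "\<epsilon> > 0"
    from eventually_happens[OF uniform_limitD[OF lim this]]
    obtain n where "\<forall>x\<in>UNIV. dist (g n x) (h x) < \<epsilon>" by auto
    then show "\<exists>f. ucont f \<and> (\<forall>x\<in>carrier G. norm (f x - h x) \<le> \<epsilon>)"
      using algebra_ucont[OF g[of n]] by (intro exI[of _ "g n"]) (auto simp: dist_norm intro: less_imp_le)
  qed
  moreover have "h x = 0" if "x \<notin> carrier G" for x
  proof -
    have "(\<lambda>n. g n x) \<longlonglongrightarrow> h x" using tendsto_uniform_limitI[OF lim] by simp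
    moreover have "g n x = 0" for n using g[of n] that by (simp add: calgebra_def)
    ultimately show ?thesis by (simp add: LIMSEQ_const_iff)
  qed
  ultimately show ?thesis by (simp add: calgebra_def)
qed

text \<open>\<open>conv_power k n\<close> is the \<open>(n + 1)\<close>-st power: convolution has no
  unit in general, so counting starts at \<open>k\<close> itself. Hence the index
  \<open>Suc (m + n)\<close> of a product.\<close>

primrec conv_power :: "('a \<Rightarrow> complex) \<Rightarrow> nat \<Rightarrow> 'a \<Rightarrow> complex" where
  "conv_power k 0 = k"
| "conv_power k (Suc n) = conv k (conv_power k n)"

lemma algebra_conv_power: "k \<in> calgebra \<Longrightarrow> conv_power k n \<in> calgebra"
  by (induction n) (auto intro: algebra_conv)

lemma conv_power_add:
  assumes "k \<in> calgebra"
  shows "conv (conv_power k m) (conv_power k n) = conv_power k (Suc (m + n))"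
  using assms by (induction m) (auto simp: conv_assoc algebra_conv_power)

lemma star_conv_power:
  assumes "k \<in> calgebra" "star k = k"
  shows "star (conv_power k n) = conv_power k n"
proof (induction n)
  case (Suc n)
  then show ?case
    using assms conv_commute[OF assms(1) algebra_conv_power[OF assms(1)], of n]
    by (simp add: star_conv algebra_conv_power)
qed (simp add: assms)

lemma ip_conv_power:
  assumes "k \<in> calgebra" "star k = k"
  shows "ip (conv_power k m) (conv_power k n) = conv_power k (Suc (m + n)) \<one>"
  using conv_star_one[OF algebra_conv_power algebra_conv_power, of k k m n] assms
  by (simp add: star_conv_power conv_power_add del: conv_power.simps)

text \<open>Convolution by \<open>conv k k\<close> is a positive operator with largest eigenvalue
  \<open>l\<close>, and \<open>P\<close> is the projection to its eigenspace, obtained as the limit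
  of the \<open>(n + 1)\<close>-st powers of \<open>conv k k\<close> divided by
  \<open>l ^ Suc n\<close>. Their traces \<open>b n\<close> decrease but stay at least 1, so the
  sequence is Cauchy in mean square and its limit is not zero. The last clause holds because
  \<open>P\<close> absorbs \<open>\<psi> 0\<close>, a multiple of \<open>conv k k\<close>: whatever
  fixes \<open>k\<close> fixes \<open>P\<close>. It will place \<open>P\<close> below a given
  idempotent.\<close>

lemma spectral_idempotent:
  assumes k: "k \<in> calgebra" and herm: "star k = k" and nz: "k \<noteq> (\<lambda>x. 0)"
  shows "\<exists>l P. l > 0 \<and> P \<in> calgebra \<and> star P = P \<and> P \<noteq> (\<lambda>x. 0) \<and> conv P P = P \<and>
    conv (conv k k) P = (\<lambda>x. of_real l * P x) \<and>
    (\<forall>Q\<in>calgebra. conv Q k = k \<longrightarrow> conv Q P = P)"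
proof -
  let ?K = "conv_power k"
  define a where "a n = sqnorm (?K n)" for n
  note K = algebra_conv_power[OF k]
  have ipK: "ip (?K m) (?K n) = ?K (Suc (m + n)) \<one>" for m n
    using ip_conv_power[OF k herm] .
  have aK: "?K (Suc (2 * n)) \<one> = of_real (a n)" for n
    using ipK[of n n] ip_self[OF K[of n]] by (simp add: a_def mult_2 del: conv_power.simps)
  \<comment> \<open>Cauchy-Schwarz for powers whose exponents differ by two: their inner product is
    the trace of the power halfway between.\<close>
  have logconvex: "(a (Suc n))\<^sup>2 \<le> a n * a (Suc (Suc n))" for n
  proof -
    have "Suc (n + Suc (Suc n)) = Suc (2 * Suc n)" by simp
    then have "ip (?K n) (?K (Suc (Suc n))) = of_real (a (Suc n))"
      unfolding ipK by (simp only: aK)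
    then show ?thesis
      using Cauchy_Schwarz_ip[OF K[of n] K[of "Suc (Suc n)"]] by (simp add: a_def[symmetric] del: conv_power.simps)
  qed
  \<comment> \<open>An even power is the convolution of a Hermitian function with itself, so its
    modulus is largest at \<open>\<one>\<close>, where it equals \<open>a n\<close>.\<close>
  have phi_bound: "norm (?K (Suc (2 * n)) x) \<le> a n" if x: "x \<in> carrier G" for n x
  proof -
    have "?K (Suc (2 * n)) = conv (?K n) (?K n)" using conv_power_add[OF k, of n n] by (simp add: mult_2)
    then have "(norm (?K (Suc (2 * n)) x))\<^sup>2 \<le> (a n)\<^sup>2"
      using norm_conv_le_sqnorm[OF K K x, of n n] by (simp only: a_def power2_eq_square)
    then show ?thesis using sqnorm_nonneg[OF K[of n]] by (simp add: a_def power2_le_iff_abs_le)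
  qed
  \<comment> \<open>The inner product of two even powers is a trace again, and it is a mean of
    products that \<open>phi_bound\<close> controls pointwise.\<close>
  have submult: "a (Suc (m + n)) \<le> a m * a n" for m n
  proof -
    have "Suc (Suc (2 * m) + Suc (2 * n)) = Suc (2 * Suc (m + n))" by simp
    then have "ip (?K (Suc (2 * m))) (?K (Suc (2 * n))) = of_real (a (Suc (m + n)))"
      unfolding ipK by (simp only: aK)
    moreover have "norm (ip (?K (Suc (2 * m))) (?K (Suc (2 * n)))) \<le> a m * a n"
      unfolding ip_def
    proof (rule norm_mean_le[OF ucont_ip[OF K K]])
      fix x assume x: "x \<in> carrier G"
      have "a m \<ge> 0" using sqnorm_nonneg[OF K] by (simp add: a_def)
      then show "norm (?K (Suc (2 * m)) x * cnj (?K (Suc (2 * n)) x)) \<le> a m * a n"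
        unfolding norm_mult complex_mod_cnj using phi_bound[OF x] by (intro mult_mono) auto
    qed
    ultimately show ?thesis by simp
  qed
  have a01: "a 0 > 0 \<and> a (Suc 0) > 0"
  proof
    show a0: "a 0 > 0" using sqnorm_pos[OF k nz] by (simp add: a_def)
    have "?K (Suc 0) \<noteq> (\<lambda>x. 0)"
    proof
      assume "?K (Suc 0) = (\<lambda>x. 0)"
      then have "?K (Suc (2 * 0)) \<one> = 0" by simp
      then show False unfolding aK using a0 by simp
    qed
    then show "a (Suc 0) > 0" unfolding a_def by (intro sqnorm_pos K)
  qed
  \<comment> \<open>By log-convexity the norms of the powers cannot drop to zero.\<close>
  have "a n > 0 \<and> a (Suc n) > 0" for n
  proof (induction n)
    case (Suc n)
    then have "0 < (a (Suc n))\<^sup>2" by simp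
    then have "0 < a n * a (Suc (Suc n))" using logconvex[of n] by linarith
    then show ?case using Suc by (simp add: zero_less_mult_iff)
  qed (rule a01)
  then have pos: "a n > 0" for n by blast
  obtain l where l: "l > 0" "decseq (\<lambda>n. a n / l ^ Suc n)" "\<And>n. a n / l ^ Suc n \<ge> 1"
    by (rule trace_sequence_limit[of a, OF pos logconvex submult]) (rule that, auto)
  define b where "b n = a n / l ^ Suc n" for n
  obtain \<beta> where \<beta>: "b \<longlonglongrightarrow> \<beta>" "\<And>n. \<beta> \<le> b n"
    using decseq_convergent[of b 1] l(2,3) unfolding b_def by metis
  define \<psi> where "\<psi> n = (\<lambda>x. of_real (1 / l ^ Suc n) * ?K (Suc (2 * n)) x)" for n
  have \<psi>A: "\<psi> n \<in> calgebra" for n unfolding \<psi>_def by (intro algebra_cmult K)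
  have \<psi>_one: "\<psi> n \<one> = of_real (b n)" for n unfolding \<psi>_def aK b_def by simp
  have \<psi>_star: "star (\<psi> n) = \<psi> n" for n
    unfolding \<psi>_def star_cmult star_conv_power[OF k herm] by simp
  have \<psi>_conv: "conv (\<psi> m) (\<psi> n) = \<psi> (Suc (m + n))" for m n
  proof -
    have "Suc (Suc (2 * m) + Suc (2 * n)) = Suc (2 * Suc (m + n))" by simp
    then have "conv (?K (Suc (2 * m))) (?K (Suc (2 * n))) = ?K (Suc (2 * Suc (m + n)))"
      using conv_power_add[OF k] by (simp only:)
    then show ?thesis
      unfolding \<psi>_def conv_cmult_left[OF algebra_cmult[OF K] K] conv_cmult_right[OF K K]
      by (simp add: power_add mult.commute mult.left_commute del: conv_power.simps)
  qed
  have ip\<psi>: "ip (\<psi> m) (\<psi> n) = of_real (b (Suc (m + n)))" for m n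
    using conv_star_one[OF \<psi>A \<psi>A, of m n] by (simp add: \<psi>_star \<psi>_conv \<psi>_one)
  have sq\<psi>: "sqnorm (\<lambda>x. \<psi> m x - \<psi> n x) = b (Suc (2*m)) - 2 * b (Suc (m + n)) + b (Suc (2*n))" for m n
    unfolding sqnorm_diff[OF \<psi>A \<psi>A] by (simp add: sqnorm_def ip\<psi> flip: mult_2)
  \<comment> \<open>Convolving the difference with \<open>\<psi> 0\<close> raises both indices by
    one and turns its mean-square norm into a pointwise bound. This is why the limit is taken along
    \<open>\<psi> (Suc n)\<close>.\<close>
  have diff\<psi>: "(norm (\<psi> (Suc m) x - \<psi> (Suc n) x))\<^sup>2
      \<le> sqnorm (\<psi> 0) * (b (Suc (2*m)) - 2 * b (Suc (m + n)) + b (Suc (2*n)))"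
    if "x \<in> carrier G" for x m n
    using norm_conv_le_sqnorm[OF \<psi>A[of 0] algebra_diff[OF \<psi>A[of m] \<psi>A[of n]] that]
    unfolding conv_diff_right[OF \<psi>A \<psi>A \<psi>A] \<psi>_conv sq\<psi> by simp
  define M where "M = sqnorm (\<psi> 0)"
  have M: "M \<ge> 0" unfolding M_def by (rule sqnorm_nonneg[OF \<psi>A])
  have "uniformly_Cauchy_on UNIV (\<lambda>n. \<psi> (Suc n))"
  proof (rule uniformly_Cauchy_onI)
    fix \<epsilon> :: real assume e: "\<epsilon> > 0"
    \<comment> \<open>\<open>M + 1\<close> keeps the divisor positive, and 4 in place of 2 makes the
      final estimate strict.\<close>
    define \<delta> where "\<delta> = \<epsilon>\<^sup>2 / (4 * (M + 1))"
    have d: "\<delta> > 0" using e M by (simp add: \<delta>_def)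
    obtain N where N: "\<And>n. n \<ge> N \<Longrightarrow> norm (b n - \<beta>) < \<delta>"
      using LIMSEQ_D[OF \<beta>(1) d] by blast
    have "dist (\<psi> (Suc m) x) (\<psi> (Suc n) x) < \<epsilon>" if mn: "m \<ge> N" "n \<ge> N" for x m n
    proof (cases "x \<in> carrier G")
      case True
      have "b (Suc (2*m)) < \<beta> + \<delta>" "b (Suc (2*n)) < \<beta> + \<delta>"
        using N[of "Suc (2*m)"] N[of "Suc (2*n)"] mn by (auto simp: abs_less_iff)
      moreover have "b (Suc (m + n)) \<ge> \<beta>" by (rule \<beta>(2))
      ultimately have "b (Suc (2*m)) - 2 * b (Suc (m + n)) + b (Suc (2*n)) \<le> 2 * \<delta>" by linarith
      then have "(norm (\<psi> (Suc m) x - \<psi> (Suc n) x))\<^sup>2 \<le> M * (2 * \<delta>)"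
        using diff\<psi>[OF True, of m n] M unfolding M_def[symmetric]
        by (meson mult_left_mono order.trans)
      also have "\<dots> < (M + 1) * (4 * \<delta>)"
        by (rule mult_strict_mono) (use M d in auto)
      also have "\<dots> = \<epsilon>\<^sup>2" using M by (simp add: \<delta>_def divide_simps)
      finally show ?thesis using e by (simp add: dist_norm power2_less_imp_less)
    next
      case False
      then have "\<psi> n x = 0" for n using \<psi>A[of n] by (simp add: calgebra_def)
      then show ?thesis using e by simp
    qed
    then show "\<exists>M. \<forall>x\<in>UNIV. \<forall>m\<ge>M. \<forall>n\<ge>M. dist (\<psi> (Suc m) x) (\<psi> (Suc n) x) < \<epsilon>" by blast
  qed
  then have "uniformly_convergent_on UNIV (\<lambda>n. \<psi> (Suc n))"
    by (rule Cauchy_uniformly_convergent)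
  then obtain P where P: "uniform_limit UNIV (\<lambda>n. \<psi> (Suc n)) P sequentially"
    unfolding uniformly_convergent_on_def by blast
  have PA: "P \<in> calgebra" using algebra_limit[OF \<psi>A P] .
  have Pc: "uniform_limit (carrier G) (\<lambda>n. \<psi> (Suc n)) P sequentially"
    using P by (rule uniform_limit_on_subset) simp
  have Plim: "(\<lambda>n. \<psi> (Suc n) x) \<longlonglongrightarrow> P x" for x using tendsto_uniform_limitI[OF P] by simp
  \<comment> \<open>Convolution by \<open>\<psi> m\<close> merely shifts the index of the sequence,
    so it fixes the limit.\<close>
  have \<psi>P: "conv (\<psi> m) P = P" for m
  proof (rule algebra_ext[OF algebra_conv[OF \<psi>A PA] PA])
    fix x assume x: "x \<in> carrier G"
    have "(\<lambda>n. conv (\<psi> m) (\<psi> (Suc n)) x) \<longlonglongrightarrow> conv (\<psi> m) P x"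
      by (rule tendsto_conv[OF \<psi>A \<psi>A PA Pc x])
    moreover have "(\<lambda>n. conv (\<psi> m) (\<psi> (Suc n)) x) \<longlonglongrightarrow> P x"
      using LIMSEQ_ignore_initial_segment[OF Plim[of x], of "Suc m"] unfolding \<psi>_conv
      by (simp add: add.commute)
    ultimately show "conv (\<psi> m) P x = P x" by (rule LIMSEQ_unique)
  qed
  have PP: "conv P P = P"
  proof (rule algebra_ext[OF algebra_conv[OF PA PA] PA])
    fix x assume x: "x \<in> carrier G"
    have "(\<lambda>n. conv P (\<psi> (Suc n)) x) \<longlonglongrightarrow> conv P P x"
      by (rule tendsto_conv[OF PA \<psi>A PA Pc x])
    then have "(\<lambda>n::nat. P x) \<longlonglongrightarrow> conv P P x"
      unfolding conv_commute[OF PA \<psi>A] \<psi>P .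
    then show "conv P P x = P x" by (simp add: LIMSEQ_const_iff)
  qed
  have starP: "star P = P"
  proof (rule algebra_ext[OF algebra_star[OF PA] PA])
    fix x assume x: "x \<in> carrier G"
    have "(\<lambda>n. cnj (\<psi> (Suc n) (inv x))) \<longlonglongrightarrow> cnj (P (inv x))"
      by (intro tendsto_cnj Plim)
    moreover have "cnj (\<psi> n (inv x)) = \<psi> n x" for n
      using fun_cong[OF \<psi>_star[of n], of x] x by (simp add: star_def)
    ultimately have "P x = cnj (P (inv x))" using LIMSEQ_unique[OF Plim[of x]] by simp
    then show "star P x = P x" using x by (simp add: star_def)
  qed
  have nzP: "P \<noteq> (\<lambda>x. 0)"
  proof
    assume 0: "P = (\<lambda>x. 0)"
    have "(\<lambda>n. Re (\<psi> (Suc n) \<one>)) \<longlonglongrightarrow> Re (P \<one>)" by (intro tendsto_Re Plim)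
    then have "(\<lambda>n. b (Suc n)) \<longlonglongrightarrow> 0" unfolding \<psi>_one 0 by simp
    moreover have "1 \<le> b (Suc n)" for n unfolding b_def by (rule l(3))
    ultimately have "(1::real) \<le> 0" by (intro LIMSEQ_le_const) auto
    then show False by simp
  qed
  \<comment> \<open>With this, \<open>\<psi>P\<close> at \<open>m = 0\<close> becomes the eigenvalue
    equation.\<close>
  have kk: "conv k k = (\<lambda>x. of_real l * \<psi> 0 x)"
    using l(1) by (simp add: \<psi>_def)
  have "conv (conv k k) P = (\<lambda>x. of_real l * P x)"
    unfolding kk conv_cmult_left[OF PA \<psi>A] \<psi>P ..
  moreover have "conv Q P = P" if Q: "Q \<in> calgebra" "conv Q k = k" for Q
  proof -
    have "conv Q (?K n) = ?K n" for n
    proof (induction n)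
      case (Suc n)
      have "conv Q (conv k (?K n)) = conv (conv Q k) (?K n)"
        using conv_assoc[OF Q(1) k K] by simp
      then show ?case using Q(2) by simp
    qed (simp add: Q(2))
    then have "conv Q (\<psi> n) = \<psi> n" for n
      unfolding \<psi>_def conv_cmult_right[OF Q(1) K] by (simp only:)
    then have "conv Q (conv (\<psi> 0) P) = conv (\<psi> 0) P"
      using conv_assoc[OF Q(1) \<psi>A PA] by metis
    then show ?thesis unfolding \<psi>P .
  qed
  ultimately show ?thesis
    using l(1) PA starP nzP PP by (intro exI[of _ l] exI[of _ P] conjI ballI impI)
qed

text \<open>The trace of a Hermitian projection is its squared Hilbert-Schmidt norm, that is, the
  dimension of its range.\<close>

lemma idempotent_sqnorm:
  assumes "Q \<in> calgebra" "star Q = Q" "conv Q Q = Q"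
  shows "Q \<one> = of_real (sqnorm Q)"
  using conv_star_one[OF assms(1,1)] ip_self[OF assms(1)] assms(2,3) by simp

text \<open>With \<open>q = sqnorm Q\<close>, idempotency gives \<open>norm (Q x) \<le> q\<close>
  everywhere, and so \<open>q\<close>, the mean of \<open>(norm (Q x))\<^sup>2\<close>, is at most
  \<open>q * q\<close>. This gap above 0 is what makes minimal idempotents exist.\<close>

lemma idempotent_ge_1:
  assumes Q: "Q \<in> calgebra" "star Q = Q" "conv Q Q = Q" "Q \<noteq> (\<lambda>x. 0)"
  shows "sqnorm Q \<ge> 1"
proof -
  let ?q = "sqnorm Q"
  have q: "?q > 0" using sqnorm_pos[OF Q(1,4)] .
  have bd: "norm (Q x) \<le> ?q" if "x \<in> carrier G" for x
  proof -
    have "(norm (Q x))\<^sup>2 \<le> ?q\<^sup>2"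
      using norm_conv_le_sqnorm[OF Q(1,1) that] Q(3) by (simp add: power2_eq_square)
    then show ?thesis using q by (simp add: power2_le_iff_abs_le)
  qed
  have "norm (ip Q Q) \<le> ?q * ?q"
    unfolding ip_def
    by (rule norm_mean_le[OF ucont_ip[OF Q(1,1)]]) (use bd q in \<open>auto simp: norm_mult intro!: mult_mono\<close>)
  then have "?q \<le> ?q * ?q" using q by (simp add: ip_self[OF Q(1)])
  then show ?thesis using q by (simp add: mult_le_cancel_left_pos[of ?q 1 ?q, simplified] )
qed

text \<open>The elements of \<open>characters\<close> are \<open>undefined\<close> off the carrier;
  here the value is 0 there, which makes characters members of \<open>calgebra\<close>.\<close>

definition continuous_character :: "('a \<Rightarrow> complex) \<Rightarrow> bool" where
  "continuous_character \<phi> \<longleftrightarrow> \<phi> \<in> calgebra \<and>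
     (\<forall>x\<in>carrier G. \<forall>y\<in>carrier G. \<phi> (x \<otimes> y) = \<phi> x * \<phi> y) \<and>
     (\<forall>x\<in>carrier G. norm (\<phi> x) = 1)"

lemma
  assumes "continuous_character \<phi>"
  shows character_algebra: "\<phi> \<in> calgebra"
    and character_mult: "\<And>x y. x \<in> carrier G \<Longrightarrow> y \<in> carrier G \<Longrightarrow> \<phi> (x \<otimes> y) = \<phi> x * \<phi> y"
    and character_norm: "\<And>x. x \<in> carrier G \<Longrightarrow> norm (\<phi> x) = 1"
  using assms by (auto simp: continuous_character_def)

lemma character_one:
  assumes "continuous_character \<phi>"
  shows "\<phi> \<one> = 1"
proof -
  have "\<phi> \<one> * \<phi> \<one> = \<phi> \<one>" using character_mult[OF assms, of \<one> \<one>] by simp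
  moreover have "\<phi> \<one> \<noteq> 0" using character_norm[OF assms, of \<one>] by auto
  ultimately show ?thesis by simp
qed

lemma character_cnj:
  assumes "continuous_character \<phi>" "x \<in> carrier G"
  shows "\<phi> x * cnj (\<phi> x) = 1"
  using complex_norm_square[of "\<phi> x"] character_norm[OF assms] by simp

lemma character_inv:
  assumes "continuous_character \<phi>" "x \<in> carrier G"
  shows "\<phi> (inv x) = cnj (\<phi> x)"
proof -
  have "\<phi> x * \<phi> (inv x) = \<phi> x * cnj (\<phi> x)"
    using character_mult[OF assms(1), of x "inv x"] character_one[OF assms(1)]
      character_cnj[OF assms] assms(2) by simp
  moreover have "\<phi> x \<noteq> 0" using character_norm[OF assms] by auto
  ultimately show ?thesis by simp
qed

lemma star_character: "continuous_character \<phi> \<Longrightarrow> star \<phi> = \<phi>"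
  using algebra_ext[OF algebra_star, of \<phi> \<phi>] character_algebra[of \<phi>]
  by (simp add: star_def character_inv)

text \<open>From \<open>\<phi> (inv y \<otimes> x) = cnj (\<phi> y) * \<phi> x\<close>: the Fourier
  coefficient is the eigenvalue of convolution by \<open>k\<close> at \<open>\<phi>\<close>.\<close>

lemma conv_character:
  assumes k: "k \<in> calgebra" and \<phi>: "continuous_character \<phi>"
  shows "conv k \<phi> = (\<lambda>x. ip k \<phi> * \<phi> x)"
proof (rule algebra_ext)
  note \<phi>A = character_algebra[OF \<phi>]
  fix x assume x: "x \<in> carrier G"
  have "mean (\<lambda>y. k y * \<phi> (inv y \<otimes> x)) = mean (\<lambda>y. \<phi> x * (k y * cnj (\<phi> y)))"
  proof (rule mean_cong)
    show "ucont (\<lambda>y. \<phi> x * (k y * cnj (\<phi> y)))"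
      by (intro ucont_cmult ucont_ip k \<phi>A)
    fix y assume y: "y \<in> carrier G"
    show "\<phi> x * (k y * cnj (\<phi> y)) = k y * \<phi> (inv y \<otimes> x)"
      using x y by (simp add: character_mult[OF \<phi>] character_inv[OF \<phi>])
  qed
  also have "\<dots> = ip k \<phi> * \<phi> x"
    unfolding ip_def using mean_cmult[OF ucont_ip[OF k \<phi>A]] by simp
  finally show "conv k \<phi> x = ip k \<phi> * \<phi> x" using x by (simp add: conv_def)
qed (intro algebra_conv algebra_cmult k character_algebra[OF \<phi>])+

text \<open>A minimal idempotent \<open>Q\<close> below \<open>P\<close> should have a
  one-dimensional range. Any Hermitian \<open>h\<close> in the range of \<open>Q\<close> has a
  spectral idempotent below \<open>Q\<close>, which must be \<open>Q\<close>; so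
  \<open>conv h h\<close>, and by polarization \<open>h\<close> itself, is a multiple of
  \<open>Q\<close>. Translates of \<open>Q\<close> lie in that range and are therefore multiples of
  \<open>Q\<close>, which makes \<open>Q\<close>, divided by its value at \<open>\<one>\<close>,
  multiplicative.\<close>

lemma exists_character:
  assumes k: "k \<in> calgebra" and herm: "star k = k" and nz: "k \<noteq> (\<lambda>x. 0)"
  shows "\<exists>\<phi>. continuous_character \<phi> \<and> ip k \<phi> \<noteq> 0"
proof -
  obtain l P where l: "l > 0" and P: "P \<in> calgebra" "star P = P" "P \<noteq> (\<lambda>x. 0)" "conv P P = P"
    and kP: "conv (conv k k) P = (\<lambda>x. of_real l * P x)"
    using spectral_idempotent[OF assms] by (elim exE conjE) (rule that)
  \<comment> \<open>The condition \<open>conv Q P = Q\<close> says that \<open>Q\<close> lies below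
    \<open>P\<close>. Comparing integer parts is enough for minimality, since the trace falls by at
    least 1 from an idempotent to a strictly smaller one.\<close>
  define I where "I = {Q \<in> calgebra. star Q = Q \<and> Q \<noteq> (\<lambda>x. 0) \<and> conv Q Q = Q \<and> conv Q P = Q}"
  have "P \<in> I" using P by (simp add: I_def)
  then obtain Q where QI: "Q \<in> I" and Qmin: "\<And>Q'. Q' \<in> I \<Longrightarrow> nat \<lfloor>sqnorm Q\<rfloor> \<le> nat \<lfloor>sqnorm Q'\<rfloor>"
    using ex_has_least_nat[of "\<lambda>Q. Q \<in> I" P "\<lambda>Q. nat \<lfloor>sqnorm Q\<rfloor>"] by blast
  have Q: "Q \<in> calgebra" "star Q = Q" "Q \<noteq> (\<lambda>x. 0)" "conv Q Q = Q" "conv Q P = Q"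
    using QI by (auto simp: I_def)
  \<comment> \<open>The spectral idempotent \<open>P'\<close> of \<open>h\<close> satisfies
    \<open>conv Q P' = P'\<close> by the last clause of \<open>spectral_idempotent\<close>;
    minimality identifies it with \<open>Q\<close>, and its eigenvalue equation then reads as the
    claim.\<close>
  have square: "\<exists>c. conv h h = (\<lambda>x. c * Q x)"
    if h: "h \<in> calgebra" "star h = h" "conv Q h = h" for h
  proof (cases "h = (\<lambda>x. 0)")
    case True
    then show ?thesis by (intro exI[of _ 0]) (auto simp: conv_def)
  next
    case False
    obtain l' P' where P': "P' \<in> calgebra" "star P' = P'" "P' \<noteq> (\<lambda>x. 0)" "conv P' P' = P'"
        "conv (conv h h) P' = (\<lambda>x. of_real l' * P' x)"
      and QP': "\<forall>Q\<in>calgebra. conv Q h = h \<longrightarrow> conv Q P' = P'"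
      using spectral_idempotent[OF h(1,2) False] by (elim exE conjE) (rule that)
    have QP: "conv Q P' = P'" using bspec[OF QP' Q(1)] h(3) by simp
    have PQ: "conv P' Q = P'" using QP conv_commute[OF Q(1) P'(1)] by simp
    have "conv P' P = P'"
      using conv_assoc[OF P'(1) Q(1) P(1)] Q(5) PQ by simp
    then have P'I: "P' \<in> I" using P' by (simp add: I_def)
    have "P' = Q"
    proof (rule ccontr)
      assume ne: "P' \<noteq> Q"
      \<comment> \<open>The complement of \<open>P'\<close> in \<open>Q\<close>. It would be a
        nonzero idempotent of trace at least 1, so \<open>P'\<close> would contradict the choice of
        \<open>Q\<close>.\<close>
      let ?R = "\<lambda>x. Q x - P' x"
      have R: "?R \<in> calgebra" using Q(1) P'(1) by (rule algebra_diff)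
      have "star ?R = ?R"
        by (simp only: star_diff Q(2) P'(2))
      moreover have "conv ?R ?R = ?R"
        unfolding conv_diff_right[OF R Q(1) P'(1)] conv_diff_left[OF Q(1) Q(1) P'(1)]
          conv_diff_left[OF P'(1) Q(1) P'(1)] QP PQ Q(4) P'(4) by simp
      moreover have "?R \<noteq> (\<lambda>x. 0)" using ne unfolding fun_eq_iff right_minus_eq by metis
      ultimately have "sqnorm ?R \<ge> 1" using R by (intro idempotent_ge_1)
      moreover have "sqnorm ?R = sqnorm Q - sqnorm P'"
      proof -
        have "ip Q P' = of_real (sqnorm P')"
          using conv_star_one[OF Q(1) P'(1)] P'(2) QP idempotent_sqnorm[OF P'(1,2,4)] by simp
        then show ?thesis unfolding sqnorm_diff[OF Q(1) P'(1)] by simp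
      qed
      ultimately have "sqnorm P' + 1 \<le> sqnorm Q" by simp
      moreover have "sqnorm P' \<ge> 0" using P' by (intro sqnorm_nonneg)
      ultimately have "nat \<lfloor>sqnorm P'\<rfloor> < nat \<lfloor>sqnorm Q\<rfloor>" by linarith
      then show False using Qmin[OF P'I] by linarith
    qed
    moreover have "conv (conv h h) Q = conv h h"
      using conv_assoc[OF h(1,1) Q(1)] conv_commute[OF h(1) Q(1)] h(3) by simp
    ultimately have "conv h h = (\<lambda>x. of_real l' * Q x)" using P'(5) by simp
    then show ?thesis by blast
  qed
  have scalar: "\<exists>c. h = (\<lambda>x. c * Q x)"
    if h: "h \<in> calgebra" "star h = h" "conv Q h = h" for h
  proof -
    \<comment> \<open>Polarization against the unit \<open>Q\<close>: the square of
      \<open>h + Q\<close> is the square of \<open>h\<close> plus \<open>2 * h\<close> plus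
      \<open>Q\<close>, and both squares are multiples of \<open>Q\<close>.\<close>
    let ?g = "\<lambda>x. h x + Q x"
    have g: "?g \<in> calgebra" using h Q by (intro algebra_add)
    have "star ?g = ?g"
      by (simp only: star_add h(2) Q(2))
    moreover have "conv Q ?g = ?g" unfolding conv_add_right[OF Q(1) h(1) Q(1)] h(3) Q(4) ..
    ultimately obtain c where c: "conv ?g ?g = (\<lambda>x. c * Q x)" using square[OF g] by blast
    obtain d where d: "conv h h = (\<lambda>x. d * Q x)" using square[OF h] by blast
    have hQ: "conv h Q = h" using h(3) conv_commute[OF h(1) Q(1)] by simp
    have "conv ?g ?g = (\<lambda>x. conv h h x + h x + (h x + Q x))"
      unfolding conv_add_right[OF g h(1) Q(1)] conv_add_left[OF h(1) h(1) Q(1)]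
        conv_add_left[OF Q(1) h(1) Q(1)] h(3) hQ Q(4) ..
    then have "d * Q x + 2 * h x + Q x = c * Q x" for x
      unfolding c d fun_eq_iff by (simp add: algebra_simps)
    then have "h x = ((c - d - 1) / 2) * Q x" for x
      by (simp add: algebra_simps)
    then show ?thesis by blast
  qed
  have shift_scalar: "\<exists>c. shift a Q = (\<lambda>x. c * Q x)" if a: "a \<in> carrier G" for a
  proof -
    have star_shift: "star (shift b Q) = shift (inv b) Q" if b: "b \<in> carrier G" for b
    proof
      fix x
      have *: "cnj (Q (inv y)) = Q y" if "y \<in> carrier G" for y
        using fun_cong[OF Q(2), of y] that by (simp add: star_def)
      show "star (shift b Q) x = shift (inv b) Q x"
      proof (cases "x \<in> carrier G")
        case True
        then have "inv (inv b \<otimes> x) = b \<otimes> inv x" using b by (simp add: inv_mult)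
        moreover have "cnj (Q (inv (inv b \<otimes> x))) = Q (inv b \<otimes> x)"
          using True b by (intro *) simp
        ultimately show ?thesis using True by (simp add: star_def shift_def)
      qed (simp add: star_def shift_def)
    qed
    have QS: "conv Q (shift b Q) = shift b Q" if b: "b \<in> carrier G" for b
    proof (rule algebra_ext)
      fix x assume x: "x \<in> carrier G"
      have "mean (\<lambda>y. Q y * shift b Q (inv y \<otimes> x)) = mean (\<lambda>y. Q y * Q (inv y \<otimes> (b \<otimes> x)))"
      proof (rule mean_cong)
        show "ucont (\<lambda>y. Q y * Q (inv y \<otimes> (b \<otimes> x)))"
          using x b by (intro ucont_conv_kernel algebra_ucont[OF Q(1)]) simp
      qed (use x b in \<open>simp add: shift_def m_lcomm\<close>)
      also have "\<dots> = Q (b \<otimes> x)" using fun_cong[OF Q(4), of "b \<otimes> x"] x b by (simp add: conv_def)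
      finally show "conv Q (shift b Q) x = shift b Q x" using x by (simp add: conv_def shift_def)
    qed (use b Q(1) in \<open>auto intro: algebra_conv algebra_shift\<close>)
    let ?s = "shift a Q" and ?t = "shift (inv a) Q"
    have sA: "?s \<in> calgebra" "?t \<in> calgebra" using a Q(1) by (auto intro: algebra_shift)
    have st: "cnj (?s (inv x)) = ?t x" "cnj (?t (inv x)) = ?s x" if "x \<in> carrier G" for x
      using fun_cong[OF star_shift[OF a], of x] fun_cong[OF star_shift[of "inv a"], of x] a that
      by (simp_all add: star_def)
    have out: "?s x = 0" "?t x = 0" if "x \<notin> carrier G" for x using that by (simp_all add: shift_def)
    \<comment> \<open>A translate of \<open>Q\<close> need not be Hermitian, but \<open>star\<close>
      exchanges \<open>?s\<close> and \<open>?t\<close>; hence \<open>?u\<close> and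
      \<open>?v\<close> are Hermitian, and \<open>?s\<close> is half of
      \<open>?u - \<i> * ?v\<close>.\<close>
    let ?u = "\<lambda>x. ?s x + ?t x" and ?v = "\<lambda>x. \<i> * (?s x - ?t x)"
    have u: "?u \<in> calgebra" using sA by (rule algebra_add)
    have v: "?v \<in> calgebra" using sA by (intro algebra_cmult algebra_diff)
    have "star ?u = ?u" "star ?v = ?v"
      using st out by (auto simp: star_def fun_eq_iff algebra_simps)
    moreover have "conv Q ?u = ?u" "conv Q ?v = ?v"
      using a sA Q(1)
      by (simp_all add: conv_add_right conv_cmult_right conv_diff_right algebra_diff QS)
    ultimately obtain c d where "?u = (\<lambda>x. c * Q x)" "?v = (\<lambda>x. d * Q x)"
      using scalar[OF u] scalar[OF v] by metis
    then have cd: "?s x + ?t x = c * Q x" "\<i> * (?s x - ?t x) = d * Q x" for x by metis+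
    have "?s x = ((c - \<i> * d) / 2) * Q x" for x
    proof -
      have "?s x - ?t x = - \<i> * (\<i> * (?s x - ?t x))" by simp
      also have "\<dots> = - \<i> * d * Q x" unfolding cd(2) by simp
      finally have d: "?s x - ?t x = - \<i> * d * Q x" .
      have "2 * ?s x = (?s x + ?t x) + (?s x - ?t x)" by simp
      also have "\<dots> = c * Q x - \<i> * d * Q x" unfolding d cd(1) by simp
      finally have "2 * ?s x = c * Q x - \<i> * d * Q x" .
      then show ?thesis by (simp add: algebra_simps)
    qed
    then show ?thesis by blast
  qed
  define q where "q = sqnorm Q"
  have q: "q > 0" unfolding q_def using sqnorm_pos[OF Q(1,3)] .
  have Q1: "Q \<one> = of_real q" unfolding q_def using idempotent_sqnorm[OF Q(1,2,4)] .
  define \<phi> where "\<phi> = (\<lambda>x. of_real (1/q) * Q x)"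
  have \<phi>A: "\<phi> \<in> calgebra" unfolding \<phi>_def using Q(1) by (rule algebra_cmult)
  have mult: "\<phi> (x \<otimes> y) = \<phi> x * \<phi> y" if x: "x \<in> carrier G" and y: "y \<in> carrier G" for x y
  proof -
    obtain c where c: "shift x Q = (\<lambda>z. c * Q z)" using shift_scalar[OF x] by blast
    have "Q (x \<otimes> z) = c * Q z" if "z \<in> carrier G" for z
      using fun_cong[OF c, of z] that by (simp add: shift_def)
    from this[OF y] this[of \<one>] have "Q (x \<otimes> y) = c * Q y" "Q x = c * of_real q" using x Q1 by auto
    then show ?thesis using q by (simp add: \<phi>_def)
  qed
  have cnj: "\<phi> (inv x) = cnj (\<phi> x)" if "x \<in> carrier G" for x
    using fun_cong[OF Q(2), of "inv x"] that by (simp add: star_def \<phi>_def)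
  have one: "\<phi> \<one> = 1" using q Q1 by (simp add: \<phi>_def)
  have norm1: "norm (\<phi> x) = 1" if x: "x \<in> carrier G" for x
  proof -
    have "\<phi> x * cnj (\<phi> x) = 1" using mult[of x "inv x"] cnj[OF x] one x by simp
    then have "of_real ((norm (\<phi> x))\<^sup>2) = (1::complex)" unfolding complex_norm_square .
    then have "(norm (\<phi> x))\<^sup>2 = 1" by (simp only: of_real_eq_1_iff)
    then show ?thesis by (simp add: power2_eq_1_iff) (metis norm_ge_zero not_one_le_zero neg_0_le_iff_le)
  qed
  have char: "continuous_character \<phi>"
    using \<phi>A mult norm1 by (simp add: continuous_character_def)
  \<comment> \<open>Otherwise \<open>conv k Q\<close> would vanish, whereas \<open>conv k k\<close>
    acts on \<open>Q\<close>, which lies below \<open>P\<close>, as the positive scalar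
    \<open>l\<close>.\<close>
  have "ip k \<phi> \<noteq> 0"
  proof
    assume 0: "ip k \<phi> = 0"
    have "Q = (\<lambda>x. of_real q * \<phi> x)" using q by (simp add: \<phi>_def fun_eq_iff)
    then have "conv k Q = (\<lambda>x. of_real q * conv k \<phi> x)"
      using conv_cmult_right[OF k \<phi>A] by metis
    then have "conv k Q = (\<lambda>x. 0)" unfolding conv_character[OF k char] 0 by simp
    then have "conv (conv k k) Q = (\<lambda>x. 0)"
      using conv_assoc[OF k k Q(1)] by (simp add: conv_def fun_eq_iff)
    moreover have "conv (conv k k) Q = (\<lambda>x. of_real l * Q x)"
    proof -
      have PQ: "conv P Q = Q" using Q(5) conv_commute[OF Q(1) P(1)] by simp
      have "conv (conv k k) Q = conv (conv (conv k k) P) Q"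
        using conv_assoc[OF algebra_conv[OF k k] P(1) Q(1)] PQ by simp
      also have "\<dots> = (\<lambda>x. of_real l * Q x)"
        unfolding kP conv_cmult_left[OF Q(1) P(1)] PQ ..
      finally show ?thesis .
    qed
    ultimately have "of_real l * Q x = 0" for x by metis
    then have "Q = (\<lambda>x. 0)" using l by auto
    then show False using Q(3) by simp
  qed
  then show ?thesis using char by blast
qed

end

section \<open>Characters generate the topology\<close>

context precompact_group
begin

section \<open>Orthogonality and uniformly convergent Fourier series\<close>

lemma ip_character_self:
  assumes "continuous_character \<phi>"
  shows "ip \<phi> \<phi> = 1"
proof -
  have "mean (\<lambda>x. \<phi> x * cnj (\<phi> x)) = mean (\<lambda>x. 1)"
    by (rule mean_cong[OF ucont_const]) (simp add: character_cnj[OF assms])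
  then show ?thesis by (simp add: ip_def)
qed

text \<open>Convolution being commutative, \<open>conv \<phi> \<psi>\<close> is a multiple of
  \<open>\<psi>\<close> and of \<open>\<phi>\<close>. Evaluation at \<open>\<one>\<close> shows that
  both factors agree, so they vanish wherever the characters differ.\<close>

lemma ip_character_orthogonal:
  assumes \<phi>: "continuous_character \<phi>" and \<psi>: "continuous_character \<psi>" and ne: "\<phi> \<noteq> \<psi>"
  shows "ip \<phi> \<psi> = 0"
proof -
  have "conv \<phi> \<psi> = conv \<psi> \<phi>"
    by (intro conv_commute character_algebra \<phi> \<psi>)
  then have eq: "ip \<phi> \<psi> * \<psi> x = ip \<psi> \<phi> * \<phi> x" for x
    unfolding conv_character[OF character_algebra[OF \<phi>] \<psi>]
      conv_character[OF character_algebra[OF \<psi>] \<phi>] by (rule fun_cong)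
  obtain x where "\<phi> x \<noteq> \<psi> x" using ne by (auto simp: fun_eq_iff)
  moreover have "ip \<phi> \<psi> = ip \<psi> \<phi>"
    using eq[of \<one>] by (simp add: character_one \<phi> \<psi>)
  ultimately show ?thesis using eq[of x] by auto
qed

lemma algebra_sum:
  assumes "\<And>a. a \<in> A \<Longrightarrow> f a \<in> calgebra"
  shows "(\<lambda>x. \<Sum>a\<in>A. f a x) \<in> calgebra"
  using assms by (induction A rule: infinite_finite_induct) (auto intro: algebra_zero algebra_add)

lemma ip_sum_left:
  assumes "\<And>a. a \<in> A \<Longrightarrow> f a \<in> calgebra" "g \<in> calgebra"
  shows "ip (\<lambda>x. \<Sum>a\<in>A. f a x) g = (\<Sum>a\<in>A. ip (f a) g)"
  unfolding ip_def sum_distrib_right using assms by (intro mean_sum ucont_ip) auto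

lemma Bessel:
  assumes g: "g \<in> calgebra" and F: "finite F" "\<And>\<phi>. \<phi> \<in> F \<Longrightarrow> continuous_character \<phi>"
  shows "(\<Sum>\<phi>\<in>F. (norm (ip g \<phi>))\<^sup>2) \<le> sqnorm g"
proof -
  define p where "p = (\<lambda>x. \<Sum>\<phi>\<in>F. ip g \<phi> * \<phi> x)"
  define s where "s = (\<Sum>\<phi>\<in>F. (norm (ip g \<phi>))\<^sup>2)"
  have FA: "\<phi> \<in> calgebra" if "\<phi> \<in> F" for \<phi> using character_algebra[OF F(2)[OF that]] .
  have p: "p \<in> calgebra" unfolding p_def by (intro algebra_sum algebra_cmult FA)
  have ip_p: "ip p f = (\<Sum>\<phi>\<in>F. ip g \<phi> * ip \<phi> f)" if f: "f \<in> calgebra" for f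
  proof -
    have "ip p f = (\<Sum>\<phi>\<in>F. ip (\<lambda>x. ip g \<phi> * \<phi> x) f)"
      unfolding p_def by (rule ip_sum_left[OF algebra_cmult[OF FA] f])
    also have "\<dots> = (\<Sum>\<phi>\<in>F. ip g \<phi> * ip \<phi> f)"
      by (intro sum.cong refl ip_cmult_left FA f)
    finally show ?thesis .
  qed
  have coeff: "ip p \<psi> = ip g \<psi>" if "\<psi> \<in> F" for \<psi>
  proof -
    have "ip g \<phi> * ip \<phi> \<psi> = (if \<phi> = \<psi> then ip g \<psi> else 0)" if "\<phi> \<in> F" for \<phi>
      using ip_character_orthogonal[of \<phi> \<psi>] ip_character_self[of \<psi>] F(2) that \<open>\<psi> \<in> F\<close> by auto
    then have "ip p \<psi> = (\<Sum>\<phi>\<in>F. if \<phi> = \<psi> then ip g \<psi> else 0)"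
      unfolding ip_p[OF FA[OF that]] by (intro sum.cong) auto
    then show ?thesis using that F(1) by simp
  qed
  have s: "complex_of_real s = (\<Sum>\<phi>\<in>F. ip g \<phi> * cnj (ip g \<phi>))"
    unfolding s_def of_real_sum complex_norm_square ..
  have "ip p g = (\<Sum>\<phi>\<in>F. ip g \<phi> * cnj (ip g \<phi>))"
    unfolding ip_p[OF g] by (intro sum.cong refl arg_cong2[of _ _ _ _ "(*)"] ip_commute[OF g FA])
  then have gp: "Re (ip g p) = s"
    unfolding s[symmetric] using ip_commute[OF p g] by simp
  have "ip p p = (\<Sum>\<phi>\<in>F. ip g \<phi> * cnj (ip g \<phi>))"
    unfolding ip_p[OF p]
  proof (intro sum.cong refl arg_cong2[of _ _ _ _ "(*)"])
    fix \<phi> assume \<phi>: "\<phi> \<in> F"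
    show "ip \<phi> p = cnj (ip g \<phi>)" using ip_commute[OF p FA[OF \<phi>]] coeff[OF \<phi>] by simp
  qed
  then have pp: "sqnorm p = s" unfolding sqnorm_def s[symmetric] by simp
  have "0 \<le> sqnorm (\<lambda>x. g x - p x)" by (intro sqnorm_nonneg algebra_diff g p)
  then show ?thesis unfolding sqnorm_diff[OF g p] gp pp s_def by simp
qed

text \<open>Eigenvalues at \<open>\<phi>\<close> multiply under convolution, and that of
  \<open>star g\<close> is conjugate to that of \<open>g\<close>.\<close>

lemma autocorrelation_coefficient:
  assumes g: "g \<in> calgebra" and \<phi>: "continuous_character \<phi>"
  shows "ip (conv g (star g)) \<phi> = of_real ((norm (ip g \<phi>))\<^sup>2)"
proof -
  note A = character_algebra[OF \<phi>]
  note sg = algebra_star[OF g]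
  have gs: "conv (star g) \<phi> = (\<lambda>x. cnj (ip g \<phi>) * \<phi> x)"
    using star_conv[OF g A] by (simp add: star_character[OF \<phi>] conv_character[OF g \<phi>] star_cmult)
  have "ip (conv g (star g)) \<phi> = conv (conv g (star g)) \<phi> \<one>"
    unfolding conv_character[OF algebra_conv[OF g sg] \<phi>] by (simp add: character_one[OF \<phi>])
  also have "\<dots> = conv g (conv (star g) \<phi>) \<one>" by (simp only: conv_assoc[OF g sg A])
  also have "\<dots> = cnj (ip g \<phi>) * ip g \<phi>"
    unfolding gs conv_cmult_right[OF g A] conv_character[OF g \<phi>] by (simp add: character_one[OF \<phi>])
  also have "\<dots> = of_real ((norm (ip g \<phi>))\<^sup>2)" unfolding complex_norm_square by simp
  finally show ?thesis .
qed

text \<open>The coefficients are squares, hence summable by Bessel, so the series converges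
  uniformly to a function \<open>H\<close> of the algebra. The difference from
  \<open>conv g (star g)\<close> is Hermitian with all coefficients zero, and
  \<open>exists_character\<close> leaves no such function except 0.\<close>

lemma autocorrelation_expansion:
  assumes g: "g \<in> calgebra"
  defines "c \<equiv> \<lambda>\<phi>. (norm (ip g \<phi>))\<^sup>2"
  shows "c summable_on Collect continuous_character"
    and "conv g (star g) = (\<lambda>x. \<Sum>\<^sub>\<infinity>\<phi>\<in>Collect continuous_character. of_real (c \<phi>) * \<phi> x)"
proof -
  let ?X = "Collect continuous_character"
  let ?h = "conv g (star g)"
  have c0: "c \<phi> \<ge> 0" for \<phi> by (simp add: c_def)
  show sc: "c summable_on ?X"
  proof (rule nonneg_bdd_above_summable_on)
    show "bdd_above (sum c ` {F. F \<subseteq> ?X \<and> finite F})"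
      unfolding c_def using Bessel[OF g] by (intro bdd_aboveI2[of _ _ "sqnorm g"]) auto
  qed (rule c0)
  define H where "H = (\<lambda>x. \<Sum>\<^sub>\<infinity>\<phi>\<in>?X. of_real (c \<phi>) * \<phi> x)"
  have nrm: "norm (of_real (c \<phi>) * \<phi> x) \<le> c \<phi>" if "\<phi> \<in> ?X" for \<phi> x
  proof -
    have "norm (\<phi> x) \<le> 1"
      using character_norm[of \<phi> x] character_algebra[of \<phi>] that
      by (cases "x \<in> carrier G") (auto simp: calgebra_def)
    then have "c \<phi> * norm (\<phi> x) \<le> c \<phi> * 1" using c0 by (intro mult_left_mono)
    then show ?thesis using c0 by (simp add: norm_mult)
  qed
  have abs: "(\<lambda>\<phi>. norm (of_real (c \<phi>) * \<phi> x)) summable_on Y" if "Y \<subseteq> ?X" for x Y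
  proof (rule summable_on_comparison_test)
    show "c summable_on Y" using sc that by (rule summable_on_subset_banach)
  qed (use nrm that in auto)
  have sm: "(\<lambda>\<phi>. of_real (c \<phi>) * \<phi> x) summable_on Y" if "Y \<subseteq> ?X" for x Y
    using abs[OF that] by (rule abs_summable_summable)
  define S where "S F = (\<lambda>x. \<Sum>\<phi>\<in>F. of_real (c \<phi>) * \<phi> x)" for F
  have tail: "norm (H x - S F x) \<le> infsum c (?X - F)" if F: "finite F" "F \<subseteq> ?X" for F x
  proof -
    have "H x - S F x = (\<Sum>\<^sub>\<infinity>\<phi>\<in>?X - F. of_real (c \<phi>) * \<phi> x)"
      unfolding H_def S_def using infsum_Diff[OF sm[OF order.refl] sm[OF F(2)] F(2)] F(1) by simp
    also have "norm \<dots> \<le> infsum c (?X - F)"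
    proof (rule norm_infsum_le)
      show "((\<lambda>\<phi>. of_real (c \<phi>) * \<phi> x) has_sum (\<Sum>\<^sub>\<infinity>\<phi>\<in>?X - F. of_real (c \<phi>) * \<phi> x)) (?X - F)"
        by (intro has_sum_infsum sm) auto
      show "(c has_sum infsum c (?X - F)) (?X - F)"
        by (intro has_sum_infsum summable_on_subset_banach[OF sc]) auto
    qed (use nrm in auto)
    finally show ?thesis .
  qed
  \<comment> \<open>A prescribed finite set \<open>Y\<close> is put into \<open>F\<close>, so that
    \<open>coeff\<close> can read off the coefficient at a given character; as \<open>c\<close> is
    nonnegative, this does not enlarge the tail.\<close>
  have approx: "\<exists>F. finite F \<and> F \<subseteq> ?X \<and> Y \<subseteq> F \<and> (\<forall>x. norm (H x - S F x) \<le> \<epsilon>)"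
    if e: "\<epsilon> > 0" and Y: "finite Y" "Y \<subseteq> ?X" for \<epsilon> Y
  proof -
    obtain F where F: "finite F" "F \<subseteq> ?X" "dist (sum c F) (infsum c ?X) \<le> \<epsilon>"
      using infsum_finite_approximation[OF sc e] by blast
    have sF: "sum c F \<le> sum c (F \<union> Y)" using F Y c0 by (intro sum_mono2) auto
    have "infsum c (?X - (F \<union> Y)) = infsum c ?X - sum c (F \<union> Y)"
      using infsum_Diff[OF sc summable_on_finite[of "F \<union> Y"]] F Y by simp
    also have "\<dots> \<le> \<epsilon>" using F(3) sF by (simp add: dist_real_def abs_le_iff)
    finally have "norm (H x - S (F \<union> Y) x) \<le> \<epsilon>" for x
      using tail[of "F \<union> Y" x] F Y by simp
    then show ?thesis using F Y by (intro exI[of _ "F \<union> Y"]) auto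
  qed
  have SA: "S F \<in> calgebra" if "F \<subseteq> ?X" for F
    unfolding S_def using that by (intro algebra_sum algebra_cmult character_algebra) auto
  have HA: "H \<in> calgebra"
  proof -
    have "ucont H"
    proof (rule ucont_limit)
      fix \<epsilon> :: real assume "\<epsilon> > 0"
      from approx[OF this, of "{}"] obtain F where F: "F \<subseteq> ?X" "\<forall>x. norm (H x - S F x) \<le> \<epsilon>" by auto
      then show "\<exists>f. ucont f \<and> (\<forall>x\<in>carrier G. norm (f x - H x) \<le> \<epsilon>)"
        using algebra_ucont[OF SA[OF F(1)]] by (intro exI[of _ "S F"]) (simp add: norm_minus_commute)
    qed
    moreover have "H x = 0" if "x \<notin> carrier G" for x
    proof -
      have "of_real (c \<phi>) * \<phi> x = 0" if "\<phi> \<in> ?X" for \<phi>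
        using character_algebra[of \<phi>] that \<open>x \<notin> carrier G\<close> by (simp add: calgebra_def)
      then show ?thesis unfolding H_def by (intro infsum_0)
    qed
    ultimately show ?thesis by (simp add: calgebra_def)
  qed
  have coeff: "ip H \<psi> = of_real (c \<psi>)" if \<psi>: "continuous_character \<psi>" for \<psi>
  proof -
    note A = character_algebra[OF \<psi>]
    have "norm (ip H \<psi> - of_real (c \<psi>)) \<le> 0"
    proof (rule field_le_epsilon)
      fix \<epsilon> :: real assume "\<epsilon> > 0"
      from approx[OF this, of "{\<psi>}"] \<psi> obtain F where
        F: "finite F" "F \<subseteq> ?X" "\<psi> \<in> F" "\<forall>x. norm (H x - S F x) \<le> \<epsilon>" by auto
      have "ip (S F) \<psi> = (\<Sum>\<phi>\<in>F. of_real (c \<phi>) * ip \<phi> \<psi>)"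
      proof -
        have FA: "\<phi> \<in> calgebra" if "\<phi> \<in> F" for \<phi> using F(2) that by (intro character_algebra) auto
        have "ip (S F) \<psi> = (\<Sum>\<phi>\<in>F. ip (\<lambda>x. of_real (c \<phi>) * \<phi> x) \<psi>)"
          unfolding S_def by (rule ip_sum_left[OF algebra_cmult[OF FA] A])
        also have "\<dots> = (\<Sum>\<phi>\<in>F. of_real (c \<phi>) * ip \<phi> \<psi>)"
          by (intro sum.cong refl ip_cmult_left FA A)
        finally show ?thesis .
      qed
      also have "\<dots> = (\<Sum>\<phi>\<in>F. if \<phi> = \<psi> then of_real (c \<psi>) else 0)"
        using F(2) ip_character_orthogonal[OF _ \<psi>] ip_character_self[OF \<psi>] by (intro sum.cong) auto
      also have "\<dots> = of_real (c \<psi>)" using F(1,3) by simp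
      finally have "ip (S F) \<psi> = of_real (c \<psi>)" .
      moreover have "norm (ip H \<psi> - ip (S F) \<psi>) \<le> \<epsilon>"
        unfolding ip_def
      proof (rule norm_mean_diff_le)
        fix x assume x: "x \<in> carrier G"
        have "H x * cnj (\<psi> x) - S F x * cnj (\<psi> x) = (H x - S F x) * cnj (\<psi> x)"
          by (simp add: algebra_simps)
        then show "norm (H x * cnj (\<psi> x) - S F x * cnj (\<psi> x)) \<le> \<epsilon>"
          using F(4) character_norm[OF \<psi> x] by (simp add: norm_mult)
      qed (intro ucont_ip HA SA[OF F(2)] A)+
      ultimately show "norm (ip H \<psi> - of_real (c \<psi>)) \<le> 0 + \<epsilon>" by simp
    qed
    then show ?thesis by simp
  qed
  have hA: "?h \<in> calgebra" using g by (intro algebra_conv algebra_star)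
  have star_h: "star ?h = ?h"
    using star_conv[OF g algebra_star[OF g]] star_star[OF g] conv_commute[OF g algebra_star[OF g]] by simp
  have star_H: "star H = H"
  proof (rule algebra_ext[OF algebra_star[OF HA] HA])
    fix x assume x: "x \<in> carrier G"
    have "cnj (H (inv x)) = (\<Sum>\<^sub>\<infinity>\<phi>\<in>?X. cnj (of_real (c \<phi>) * \<phi> (inv x)))"
      unfolding H_def by (rule infsum_cnj[symmetric])
    also have "\<dots> = H x"
      unfolding H_def using x by (intro infsum_cong) (simp add: character_inv)
    finally show "star H x = H x" using x by (simp add: star_def)
  qed
  have "(\<lambda>x. ?h x - H x) = (\<lambda>x. 0)"
  proof (rule ccontr)
    assume nz: "(\<lambda>x. ?h x - H x) \<noteq> (\<lambda>x. 0)"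
    have d: "(\<lambda>x. ?h x - H x) \<in> calgebra" using hA HA by (rule algebra_diff)
    have "star (\<lambda>x. ?h x - H x) = (\<lambda>x. ?h x - H x)" unfolding star_diff star_h star_H ..
    from exists_character[OF d this nz] obtain \<phi> where
      \<phi>: "continuous_character \<phi>" "ip (\<lambda>x. ?h x - H x) \<phi> \<noteq> 0" by blast
    then show False
      unfolding ip_diff_left[OF hA HA character_algebra[OF \<phi>(1)]]
      using autocorrelation_coefficient[OF g \<phi>(1)] coeff[OF \<phi>(1)] by (simp add: c_def)
  qed
  then have "?h x - H x = 0" for x by (rule fun_cong)
  then show "?h = (\<lambda>x. \<Sum>\<^sub>\<infinity>\<phi>\<in>?X. of_real (c \<phi>) * \<phi> x)"
    unfolding H_def[symmetric] by auto
qed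

subsection \<open>Uniformly continuous bump functions\<close>

context
  fixes U :: "nat \<Rightarrow> 'a set"
  assumes U_nbhd: "\<And>n. nbhd (U n)"
    and U_mult: "\<And>n x y. x \<in> U (Suc n) \<Longrightarrow> y \<in> U (Suc n) \<Longrightarrow> x \<otimes> y \<in> U n"
begin

text \<open>The sets of the Birkhoff--Kakutani metrization theorem: \<open>dyadic n j\<close> is the ball of radius
  \<open>j / 2 ^ n\<close>.\<close>

fun dyadic :: "nat \<Rightarrow> nat \<Rightarrow> 'a set" where
  "dyadic 0 j = (if j = 0 then {\<one>} else if j = 1 then U 0 else carrier G)"
| "dyadic (Suc n) j =
     (if even j then dyadic n (j div 2)
      else {x \<otimes> u | x u. x \<in> dyadic n (j div 2) \<and> u \<in> U (Suc n)})"

lemma dyadic_carrier: "dyadic n j \<subseteq> carrier G"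
proof (induction n arbitrary: j)
  case 0
  then show ?case using nbhd_carrier[OF U_nbhd] by auto
next
  case (Suc n)
  have "x \<otimes> u \<in> carrier G" if "x \<in> dyadic n (j div 2)" "u \<in> U (Suc n)" for x u
    using that Suc[of "j div 2"] nbhd_carrier[OF U_nbhd] by (intro m_closed) auto
  then show ?case using Suc[of "j div 2"] by auto
qed

text \<open>Binary addition with carry. For even \<open>j\<close> the new factor fills the empty
  last digit; for odd \<open>j\<close> the two factors from \<open>U (Suc n)\<close> merge by
  \<open>U_mult\<close> into one from \<open>U n\<close>, added one level up.\<close>

lemma dyadic_mult: "x \<in> dyadic n j \<Longrightarrow> u \<in> U n \<Longrightarrow> x \<otimes> u \<in> dyadic n (Suc j)"
proof (induction n arbitrary: j x u)
  case 0
  have "x \<in> carrier G" "u \<in> carrier G"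
    using 0 dyadic_carrier nbhd_carrier[OF U_nbhd] by blast+
  then show ?case using 0 by (auto split: if_splits)
next
  case (Suc n)
  show ?case
  proof (cases "even j")
    case True
    then show ?thesis using Suc.prems by auto
  next
    case False
    then obtain y v where y: "x = y \<otimes> v" "y \<in> dyadic n (j div 2)" "v \<in> U (Suc n)"
      using Suc.prems(1) by auto
    have cs: "y \<in> carrier G" "v \<in> carrier G" "u \<in> carrier G"
      using y Suc.prems(2) dyadic_carrier nbhd_carrier[OF U_nbhd] by blast+
    have "y \<otimes> (v \<otimes> u) \<in> dyadic n (Suc (j div 2))"
      by (rule Suc.IH[OF y(2) U_mult[OF y(3) Suc.prems(2)]])
    moreover have "Suc j div 2 = Suc (j div 2)" "even (Suc j)" using False by auto
    ultimately show ?thesis using y(1) cs by (simp add: m_assoc)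
  qed
qed

lemma dyadic_mono:
  assumes "i \<le> j"
  shows "dyadic n i \<subseteq> dyadic n j"
  using assms
proof (induction j rule: dec_induct)
  case (step j)
  have "x \<in> dyadic n (Suc j)" if "x \<in> dyadic n j" for x
  proof -
    have "x \<otimes> \<one> \<in> dyadic n (Suc j)" by (rule dyadic_mult[OF that nbhd_one[OF U_nbhd]])
    moreover have "x \<in> carrier G" using that dyadic_carrier by blast
    ultimately show ?thesis by simp
  qed
  then show ?case using step by blast
qed simp

lemma dyadic_refine: "dyadic (n + m) (j * 2 ^ m) = dyadic n j"
  by (induction m) (simp_all add: mult.assoc[symmetric] del: dyadic.simps(1))

definition dyadic_dist :: "'a \<Rightarrow> real" where
  "dyadic_dist x = Inf {real j / 2 ^ n | n j. x \<in> dyadic n j}"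

lemma dyadic_dist_le: "x \<in> dyadic n j \<Longrightarrow> dyadic_dist x \<le> real j / 2 ^ n"
  unfolding dyadic_dist_def
  by (rule cInf_lower) (auto intro!: bdd_belowI[of _ 0])

lemma dyadic_dist_ge:
  assumes "x \<in> carrier G" "\<And>n j. x \<in> dyadic n j \<Longrightarrow> b \<le> real j / 2 ^ n"
  shows "b \<le> dyadic_dist x"
proof -
  \<comment> \<open>Radius 2 is already the whole group, so the infimum is taken over a nonempty
    set.\<close>
  have "x \<in> dyadic 0 2" using assms(1) by simp
  then show ?thesis
    unfolding dyadic_dist_def using assms(2) by (intro cInf_greatest) blast+
qed

lemma dyadic_dist_one: "dyadic_dist \<one> = 0"
proof -
  have "dyadic_dist \<one> \<le> 0" using dyadic_dist_le[of \<one> 0 0] by simp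
  moreover have "0 \<le> dyadic_dist \<one>" by (rule dyadic_dist_ge) auto
  ultimately show ?thesis by simp
qed

lemma dyadic_dist_ge_1:
  assumes "x \<in> carrier G" "x \<notin> U 0"
  shows "dyadic_dist x \<ge> 1"
proof (rule dyadic_dist_ge[OF assms(1)])
  fix n j assume x: "x \<in> dyadic n j"
  have "\<not> j \<le> 2 ^ n"
  proof
    assume "j \<le> 2 ^ n"
    then have "x \<in> dyadic n (2 ^ n)" using dyadic_mono x by blast
    then have "x \<in> dyadic 0 1" using dyadic_refine[of 0 n 1] by simp
    then show False using assms(2) by simp
  qed
  then have "real (2 ^ n) \<le> real j" by linarith
  then show "1 \<le> real j / 2 ^ n" by simp
qed

lemma dyadic_dist_mult:
  assumes x: "x \<in> carrier G" and u: "u \<in> U N"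
  shows "dyadic_dist (x \<otimes> u) \<le> dyadic_dist x + 2 / 2 ^ N"
proof -
  have "dyadic_dist (x \<otimes> u) - 2 / 2 ^ N \<le> dyadic_dist x"
  proof (rule dyadic_dist_ge[OF x])
    fix n j assume xj: "x \<in> dyadic n j"
    \<comment> \<open>The radius \<open>j / 2 ^ n\<close> rounded up to a multiple of
      \<open>1 / 2 ^ N\<close>. Rounding costs at most \<open>1 / 2 ^ N\<close>, and multiplying by
      \<open>u\<close> costs the other \<open>1 / 2 ^ N\<close>.\<close>
    define i where "i = Suc (j * 2 ^ N div 2 ^ n)"
    have "j * 2 ^ N \<le> i * 2 ^ n"
      unfolding i_def by (metis dividend_less_div_times less_imp_le mult_Suc pos2 zero_less_power)
    moreover have "x \<in> dyadic (n + N) (j * 2 ^ N)" unfolding dyadic_refine by (rule xj)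
    ultimately have "x \<in> dyadic (n + N) (i * 2 ^ n)" using dyadic_mono by blast
    then have "x \<in> dyadic N i" using dyadic_refine[of N n i] by (simp add: add.commute)
    then have "dyadic_dist (x \<otimes> u) \<le> real (Suc i) / 2 ^ N"
      by (intro dyadic_dist_le dyadic_mult u)
    also have "\<dots> = (real (j * 2 ^ N div 2 ^ n) + 2) / 2 ^ N" by (simp add: i_def)
    also have "\<dots> \<le> (real (j * 2 ^ N) / real (2 ^ n) + 2) / 2 ^ N"
      by (intro divide_right_mono add_right_mono of_nat_div_le_of_nat) auto
    also have "\<dots> = real j / 2 ^ n + 2 / 2 ^ N" by (simp add: field_simps)
    finally show "dyadic_dist (x \<otimes> u) - 2 / 2 ^ N \<le> real j / 2 ^ n" by simp
  qed
  then show ?thesis by simp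
qed

lemma dyadic_bump: "\<exists>g\<in>calgebra. g \<one> \<noteq> 0 \<and> (\<forall>x. x \<notin> U 0 \<longrightarrow> g x = 0)"
proof -
  define g where "g x = (if x \<in> carrier G then complex_of_real (max 0 (1 - dyadic_dist x)) else 0)" for x
  have "ucont g"
    unfolding ucont_def
  proof (intro allI impI)
    fix \<epsilon> :: real assume e: "\<epsilon> > 0"
    obtain N where N: "(1/2) ^ N < \<epsilon> / 2"
      using real_arch_pow_inv[of "\<epsilon>/2" "1/2"] e by auto
    then have N: "2 / 2 ^ N < \<epsilon>" by (simp add: power_one_over field_simps)
    \<comment> \<open>\<open>dyadic_dist_mult\<close> is one-sided; with \<open>inv v\<close> in
      \<open>U N\<close> as well, it also bounds the distance of \<open>x\<close> by that of
      \<open>x \<otimes> v\<close>.\<close>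
    let ?V = "U N \<inter> {x \<in> carrier G. inv x \<in> U N}"
    have "norm (g (x \<otimes> v) - g x) < \<epsilon>" if x: "x \<in> carrier G" and v: "v \<in> ?V" for x v
    proof -
      have vG: "v \<in> carrier G" using v by simp
      have 1: "dyadic_dist (x \<otimes> v) \<le> dyadic_dist x + 2 / 2 ^ N"
        using x v by (intro dyadic_dist_mult) auto
      have "dyadic_dist (x \<otimes> v \<otimes> inv v) \<le> dyadic_dist (x \<otimes> v) + 2 / 2 ^ N"
        using x v by (intro dyadic_dist_mult) auto
      then have 2: "dyadic_dist x \<le> dyadic_dist (x \<otimes> v) + 2 / 2 ^ N"
        using x vG by (simp add: m_assoc)
      have "norm (g (x \<otimes> v) - g x)
          = \<bar>max 0 (1 - dyadic_dist (x \<otimes> v)) - max 0 (1 - dyadic_dist x)\<bar>"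
        using x vG by (simp add: g_def flip: of_real_diff)
      also have "\<dots> \<le> 2 / 2 ^ N" using 1 2 by linarith
      finally show ?thesis using N by linarith
    qed
    moreover have "nbhd ?V" by (intro nbhd_Int nbhd_inv U_nbhd)
    ultimately show "\<exists>V. nbhd V \<and> (\<forall>x\<in>carrier G. \<forall>v\<in>V. norm (g (x \<otimes> v) - g x) < \<epsilon>)" by blast
  qed
  then have "g \<in> calgebra" by (simp add: calgebra_def g_def)
  moreover have "g \<one> \<noteq> 0" by (simp add: g_def dyadic_dist_one)
  moreover have "g x = 0" if "x \<notin> U 0" for x
    using dyadic_dist_ge_1[OF _ that] by (simp add: g_def)
  ultimately show ?thesis by blast
qed

end

lemma exists_bump:
  assumes "nbhd V"
  shows "\<exists>g\<in>calgebra. g \<one> \<noteq> 0 \<and> (\<forall>x. x \<notin> V \<longrightarrow> g x = 0)"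
proof -
  \<comment> \<open>Dependent choice by repeated use of \<open>nbhd_mult\<close>, started at
    \<open>V\<close>.\<close>
  have "\<exists>U. \<forall>n. (nbhd (U n) \<and> (n = 0 \<longrightarrow> U n = V)) \<and> (\<forall>x\<in>U (Suc n). \<forall>y\<in>U (Suc n). x \<otimes> y \<in> U n)"
    by (rule dependent_nat_choice) (use assms nbhd_mult in auto)
  then obtain U where U: "\<And>n. nbhd (U n) \<and> (n = 0 \<longrightarrow> U n = V)"
    "\<And>n. \<forall>x\<in>U (Suc n). \<forall>y\<in>U (Suc n). x \<otimes> y \<in> U n" by blast
  have "U 0 = V" using U(1)[of 0] by simp
  then show ?thesis using dyadic_bump[of U] U by simp
qed

text \<open>Let \<open>g\<close> be a bump supported in a symmetric \<open>W\<close> with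
  \<open>W \<otimes> W\<close> inside \<open>V\<close>. Its autocorrelation \<open>h\<close>
  vanishes outside \<open>V\<close> and is a nonnegative combination of characters, with
  coefficients adding up to \<open>h \<one> = s\<close>. Finitely many characters carry all but a
  quarter of this sum; if they are close to 1 at \<open>x\<close>, then \<open>h x\<close> cannot
  vanish.\<close>

theorem characters_generate:
  assumes V: "nbhd V"
  shows "\<exists>F \<delta>. finite F \<and> (\<forall>\<phi>\<in>F. continuous_character \<phi>) \<and> \<delta> > 0 \<and>
    (\<forall>x\<in>carrier G. (\<forall>\<phi>\<in>F. norm (\<phi> x - 1) < \<delta>) \<longrightarrow> x \<in> V)"
proof -
  let ?X = "Collect continuous_character"
  obtain W where W: "nbhd W" "\<forall>x\<in>W. \<forall>y\<in>W. x \<otimes> y \<in> V" using nbhd_mult[OF V] by blast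
  have W': "nbhd (W \<inter> {x \<in> carrier G. inv x \<in> W})" by (intro nbhd_Int nbhd_inv W(1))
  obtain g where g: "g \<in> calgebra" "g \<one> \<noteq> 0" "\<forall>x. x \<notin> W \<inter> {x \<in> carrier G. inv x \<in> W} \<longrightarrow> g x = 0"
    using exists_bump[OF W'] by (elim bexE conjE) (rule that)
  define h where "h = conv g (star g)"
  define c where "c \<phi> = (norm (ip g \<phi>))\<^sup>2" for \<phi>
  define s where "s = sqnorm g"
  have c0: "c \<phi> \<ge> 0" for \<phi> by (simp add: c_def)
  have "g \<noteq> (\<lambda>x. 0)" using g(2) by auto
  then have s: "s > 0" unfolding s_def by (intro sqnorm_pos g(1))
  have sc: "c summable_on ?X" and h: "h = (\<lambda>x. \<Sum>\<^sub>\<infinity>\<phi>\<in>?X. of_real (c \<phi>) * \<phi> x)"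
    using autocorrelation_expansion[OF g(1)] unfolding h_def c_def .
  have "h \<one> = of_real s"
    unfolding h_def s_def conv_star_one[OF g(1,1)] by (rule ip_self[OF g(1)])
  moreover have "h \<one> = (\<Sum>\<^sub>\<infinity>\<phi>\<in>?X. of_real (c \<phi>))"
    unfolding h by (intro infsum_cong) (simp add: character_one)
  moreover have "((\<lambda>\<phi>. complex_of_real (c \<phi>)) has_sum of_real (infsum c ?X)) ?X"
    by (rule has_sum_bounded_linear[OF bounded_linear_of_real has_sum_infsum[OF sc]])
  then have "(\<Sum>\<^sub>\<infinity>\<phi>\<in>?X. complex_of_real (c \<phi>)) = of_real (infsum c ?X)"
    by (rule infsumI)
  ultimately have s_eq: "s = infsum c ?X" by simp
  obtain F where F: "finite F" "F \<subseteq> ?X" "dist (sum c F) (infsum c ?X) \<le> s/4"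
    using infsum_finite_approximation[OF sc, of "s/4"] s by auto
  have tail: "infsum c (?X - F) \<le> s/4"
    using infsum_Diff[OF sc summable_on_finite[OF F(1)] F(2)] F(3)
    unfolding dist_real_def infsum_finite[OF F(1)] by linarith
  have sumF: "sum c F \<le> s"
    unfolding s_eq using F(1,2) c0 sc by (intro finite_sum_le_infsum) auto
  \<comment> \<open>Terms in \<open>F\<close> contribute at most \<open>s/4\<close> in total. A
    character moves by at most 2, so the tail contributes at most twice \<open>s/4\<close>. The sum
    \<open>3/4 * s\<close> stays below \<open>h \<one> = s\<close>.\<close>
  have "x \<in> V" if x: "x \<in> carrier G" and small: "\<forall>\<phi>\<in>F. norm (\<phi> x - 1) < 1/4" for x
  proof -
    let ?t = "\<lambda>\<phi>. of_real (c \<phi>) * (\<phi> x - 1)"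
    have nt: "norm (?t \<phi>) \<le> c \<phi> * 2" if "\<phi> \<in> ?X" for \<phi>
    proof -
      have "norm (\<phi> x - 1) \<le> 2"
        using norm_triangle_ineq4[of "\<phi> x" 1] character_norm[of \<phi> x] that x by simp
      then show ?thesis using c0 by (simp add: norm_mult mult_left_mono)
    qed
    have sm: "?t summable_on Y" if "Y \<subseteq> ?X" for Y
    proof (rule abs_summable_summable, rule summable_on_comparison_test)
      show "(\<lambda>\<phi>. c \<phi> * 2) summable_on Y"
        by (intro summable_on_cmult_left summable_on_subset_banach[OF sc that])
    qed (use nt that in auto)
    have "h x - h \<one> = infsum ?t ?X"
    proof -
      have sx: "(\<lambda>\<phi>. of_real (c \<phi>) * \<phi> y) summable_on ?X" if "y \<in> carrier G" for y
      proof (rule abs_summable_summable, rule summable_on_comparison_test[OF sc])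
        show "norm (of_real (c \<phi>) * \<phi> y) \<le> c \<phi>" if "\<phi> \<in> ?X" for \<phi>
          using character_norm[of \<phi> y] that \<open>y \<in> carrier G\<close> c0 by (simp add: norm_mult)
      qed auto
      have "infsum ?t ?X + h \<one> = (\<Sum>\<^sub>\<infinity>\<phi>\<in>?X. ?t \<phi> + of_real (c \<phi>) * \<phi> \<one>)"
        unfolding h using infsum_add[OF sm[OF order.refl] sx[OF one_closed]] by simp
      also have "\<dots> = h x"
        unfolding h by (intro infsum_cong) (simp add: character_one algebra_simps)
      finally have "h x = infsum ?t ?X + h \<one>" by (rule sym)
      then show ?thesis by (simp only: add_diff_cancel_right')
    qed
    also have "\<dots> = sum ?t F + infsum ?t (?X - F)"
    proof -
      have "infsum ?t (?X - F) = infsum ?t ?X - sum ?t F"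
        using infsum_Diff[OF sm[OF order.refl] sm[OF F(2)] F(2)] unfolding infsum_finite[OF F(1)] .
      then have "infsum ?t (?X - F) + sum ?t F = infsum ?t ?X" unfolding eq_diff_eq .
      from this[symmetric] show ?thesis by (subst add.commute)
    qed
    finally have "norm (h x - h \<one>) \<le> norm (sum ?t F) + norm (infsum ?t (?X - F))"
      by (simp only: norm_triangle_ineq)
    also have "norm (sum ?t F) \<le> (\<Sum>\<phi>\<in>F. c \<phi> * (1/4))"
    proof (rule sum_norm_le)
      fix \<phi> assume "\<phi> \<in> F"
      then have "norm (\<phi> x - 1) \<le> 1/4" using small by (auto intro: less_imp_le)
      then have "c \<phi> * norm (\<phi> x - 1) \<le> c \<phi> * (1/4)" using c0 by (intro mult_left_mono)
      then show "norm (?t \<phi>) \<le> c \<phi> * (1/4)" using c0 by (simp add: norm_mult)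
    qed
    also have "\<dots> = sum c F / 4" by (simp add: sum_divide_distrib)
    also have "\<dots> \<le> s / 4" using sumF by simp
    also have "norm (infsum ?t (?X - F)) \<le> infsum c (?X - F) * 2"
    proof (rule norm_infsum_le)
      show "(?t has_sum infsum ?t (?X - F)) (?X - F)" by (intro has_sum_infsum sm) auto
      show "((\<lambda>\<phi>. c \<phi> * 2) has_sum infsum c (?X - F) * 2) (?X - F)"
        by (intro has_sum_cmult_left has_sum_infsum summable_on_subset_banach[OF sc]) auto
    qed (use nt in auto)
    also have "\<dots> \<le> s / 4 * 2" using tail by simp
    finally have "norm (h x - of_real s) \<le> s/4 + s/4 * 2"
      using \<open>h \<one> = of_real s\<close> by simp
    then have "h x \<noteq> 0" using s by auto
    \<comment> \<open>A nonzero inner product means that the supports of \<open>g\<close> and of its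
      translate meet at some \<open>y\<close>, and \<open>x\<close> is the product of
      \<open>y\<close> and \<open>inv (inv x \<otimes> y)\<close>, both in \<open>W\<close>.\<close>
    then have nz: "ip g (shift (inv x) g) \<noteq> 0"
      unfolding h_def conv_star[OF g(1,1) x] .
    have "\<exists>y\<in>carrier G. g y * cnj (shift (inv x) g y) \<noteq> 0"
    proof (rule ccontr)
      assume "\<not> ?thesis"
      then have "mean (\<lambda>y. g y * cnj (shift (inv x) g y)) = mean (\<lambda>y. 0)"
        by (intro mean_cong[OF ucont_const]) simp
      then show False using nz by (simp add: ip_def)
    qed
    then obtain y where y: "y \<in> carrier G" "g y \<noteq> 0" "g (inv x \<otimes> y) \<noteq> 0"
      by (auto simp: shift_def)
    have "y \<in> W" using y(2) g(3) by blast
    moreover have "inv (inv x \<otimes> y) \<in> W" using y(3) g(3) by blast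
    ultimately have "y \<otimes> inv (inv x \<otimes> y) \<in> V" using W(2) by blast
    moreover have "y \<otimes> inv (inv x \<otimes> y) = x"
      using x y(1) by (simp add: inv_mult m_lcomm)
    ultimately show ?thesis by simp
  qed
  then show ?thesis using F(1,2) by (intro exI[of _ F] exI[of _ "1/4"]) auto
qed

end

section \<open>Weight\<close>

lemma countable_ordLeq_infinite:
  assumes "countable A" "infinite B"
  shows "|A| \<le>o |B|"
proof -
  have "|A| \<le>o |UNIV :: nat set|"
    using inj_on_to_nat_on[OF assms(1)] by (intro card_of_ordLeqI) auto
  moreover have "|UNIV :: nat set| \<le>o |B|"
    using assms(2) infinite_iff_card_of_nat by blast
  ultimately show ?thesis by (rule ordLeq_transitive)
qed

lemma Times_ordLeq_infinite:
  assumes "infinite B" "|A| \<le>o |B|" "|C| \<le>o |B|"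
  shows "|A \<times> C| \<le>o |B|"
  using assms by (intro card_of_Times_ordLeq_infinite_Field card_of_Card_order) (simp_all add: Field_card_of)

text \<open>Finite subsets are sorted by size: each further element costs one factor
  \<open>A\<close>, absorbed by the infinite bound, and there are countably many sizes.\<close>

lemma Fpow_ordLeq_infinite:
  assumes "infinite B" "|A| \<le>o |B|"
  shows "|Fpow A| \<le>o |B|"
proof -
  define L where "L n = {F. F \<subseteq> A \<and> finite F \<and> card F = n}" for n
  have "|L n| \<le>o |B|" for n
  proof (induction n)
    case 0
    have "L 0 = {{}}" by (auto simp: L_def)
    then show ?case using assms(1) by (intro countable_ordLeq_infinite) auto
  next
    case (Suc n)
    have "L (Suc n) \<subseteq> (\<lambda>(a, F). insert a F) ` (A \<times> L n)"
      by (auto simp: L_def card_Suc_eq image_iff)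
    then have "|L (Suc n)| \<le>o |(\<lambda>(a, F). insert a F) ` (A \<times> L n)|"
      by (rule card_of_mono1)
    also have "|(\<lambda>(a, F). insert a F) ` (A \<times> L n)| \<le>o |A \<times> L n|" by (rule card_of_image)
    also have "|A \<times> L n| \<le>o |B|"
      by (intro Times_ordLeq_infinite assms Suc)
    finally show ?case .
  qed
  then have "|\<Union>n. L n| \<le>o |B|"
    using assms(1) by (intro card_of_UNION_ordLeq_infinite countable_ordLeq_infinite) auto
  moreover have "Fpow A = (\<Union>n. L n)" by (auto simp: Fpow_def L_def)
  ultimately show ?thesis by simp
qed

lemma weight_ordLeq:
  assumes "topology_base X \<B>"
  shows "weight X \<le>o |\<B>|"
proof -
  obtain \<B>' where \<B>': "minimal_base X \<B>'" using minimal_base_exists by blast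
  then have "|\<B>'| \<le>o |\<B>|" using assms unfolding minimal_base_def by blast
  with weight_eq[OF \<B>'] show ?thesis by (rule ordIso_ordLeq_trans)
qed

lemma topology_base_iff:
  "topology_base X \<B> \<longleftrightarrow>
     (\<forall>B\<in>\<B>. openin X B) \<and> (\<forall>U x. openin X U \<and> x \<in> U \<longrightarrow> (\<exists>B\<in>\<B>. x \<in> B \<and> B \<subseteq> U))"
  unfolding topology_base_def openin_topology_base_unique by blast

lemma weight_subtopology_ordLeq: "weight (subtopology X C) \<le>o weight X"
proof -
  obtain \<B> where \<B>: "minimal_base X \<B>" using minimal_base_exists by blast
  then have b: "\<forall>B\<in>\<B>. openin X B" "\<And>U x. openin X U \<Longrightarrow> x \<in> U \<Longrightarrow> \<exists>B\<in>\<B>. x \<in> B \<and> B \<subseteq> U"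
    unfolding minimal_base_def topology_base_iff by blast+
  have "topology_base (subtopology X C) ((\<lambda>B. B \<inter> C) ` \<B>)"
    unfolding topology_base_iff
  proof (intro conjI ballI allI impI)
    fix B assume "B \<in> (\<lambda>B. B \<inter> C) ` \<B>"
    then show "openin (subtopology X C) B" using b(1) by (auto simp: openin_subtopology)
  next
    fix U x assume "openin (subtopology X C) U \<and> x \<in> U"
    then obtain W where W: "openin X W" "U = W \<inter> C" "x \<in> W" "x \<in> C" by (auto simp: openin_subtopology)
    from b(2)[OF W(1,3)] obtain B where "B \<in> \<B>" "x \<in> B" "B \<subseteq> W" by blast
    then show "\<exists>B\<in>(\<lambda>B. B \<inter> C) ` \<B>. x \<in> B \<and> B \<subseteq> U"
      using W by (intro bexI[of _ "B \<inter> C"]) auto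
  qed
  then have "weight (subtopology X C) \<le>o |(\<lambda>B. B \<inter> C) ` \<B>|" by (rule weight_ordLeq)
  also have "|(\<lambda>B. B \<inter> C) ` \<B>| \<le>o |\<B>|" by (rule card_of_image)
  also have "|\<B>| =o weight X" by (rule ordIso_symmetric[OF weight_eq[OF \<B>]])
  finally show ?thesis .
qed

context precompact_group
begin

section \<open>The number of characters and the weight of the group\<close>

lemma ucont_continuous_map:
  fixes g :: "'a \<Rightarrow> complex"
  assumes "ucont g"
  shows "continuous_map T euclidean g"
  unfolding continuous_map_def
proof (intro conjI allI impI)
  fix A :: "complex set" assume "openin euclidean A"
  then have A: "open A" by (rule open_openin[THEN iffD2])
  show "openin T {x \<in> topspace T. g x \<in> A}"
  proof (subst openin_subopen, intro ballI)
    fix x assume x: "x \<in> {x \<in> topspace T. g x \<in> A}"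
    then have xG: "x \<in> carrier G" by (simp add: topspace_eq)
    obtain \<epsilon> where e: "\<epsilon> > 0" "ball (g x) \<epsilon> \<subseteq> A" using A x openE by blast
    obtain V where V: "nbhd V" "\<And>x v. x \<in> carrier G \<Longrightarrow> v \<in> V \<Longrightarrow> norm (g (x \<otimes> v) - g x) < \<epsilon>"
      by (rule ucontD[OF assms e(1)]) (rule that, auto)
    let ?W = "{y \<in> carrier G. inv x \<otimes> y \<in> V}"
    have "openin T ?W" using openin_translate[OF xG] V(1) by (simp add: nbhd_def)
    moreover have "x \<in> ?W" using xG nbhd_one[OF V(1)] by simp
    moreover have "?W \<subseteq> {x \<in> topspace T. g x \<in> A}"
    proof
      fix y assume y: "y \<in> ?W"
      then have "norm (g (x \<otimes> (inv x \<otimes> y)) - g x) < \<epsilon>" using V(2)[OF xG] by blast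
      then have "g y \<in> ball (g x) \<epsilon>"
        using y xG by (simp add: mult_inv_cancel dist_norm norm_minus_commute)
      then show "y \<in> {x \<in> topspace T. g x \<in> A}" using e(2) y by (auto simp: topspace_eq)
    qed
    ultimately show "\<exists>W. openin T W \<and> x \<in> W \<and> W \<subseteq> {x \<in> topspace T. g x \<in> A}" by blast
  qed
qed auto

text \<open>A positive exponent preserves the value 0 off the carrier, as
  \<open>0 ^ 0 = 1\<close>.\<close>

lemma character_power:
  assumes "continuous_character \<phi>" "n > 0"
  shows "continuous_character (\<lambda>x. \<phi> x ^ n)"
proof -
  have u: "ucont (\<lambda>x. \<phi> x ^ n)" for n
    by (induction n) (auto intro: ucont_const ucont_mult algebra_ucont[OF character_algebra[OF assms(1)]])
  moreover have "\<phi> x ^ n = 0" if "x \<notin> carrier G" for x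
    using character_algebra[OF assms(1)] that assms(2) by (simp add: calgebra_def)
  ultimately show ?thesis
    unfolding continuous_character_def
    using character_mult[OF assms(1)] character_norm[OF assms(1)]
    by (simp add: calgebra_def power_mult_distrib norm_power)
qed

text \<open>The positive powers of each character must repeat, so its values are roots of unity of
  one fixed order. Characters separate points by \<open>characters_generate\<close>, which embeds
  the group into a finite product of finite sets.\<close>

lemma finite_characters_imp_finite:
  assumes "Hausdorff_space T" and fin: "finite (Collect continuous_character)"
  shows "finite (carrier G)"
proof -
  let ?X = "Collect continuous_character"
  have torsion: "finite (\<phi> ` carrier G)" if \<phi>: "continuous_character \<phi>" for \<phi>
  proof -
    have "range (\<lambda>n x. \<phi> x ^ Suc n) \<subseteq> ?X" using character_power[OF \<phi> zero_less_Suc] by blast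
    then have "\<not> inj (\<lambda>n x. \<phi> x ^ Suc n)"
      using fin finite_subset range_inj_infinite by blast
    then obtain m n where "m \<noteq> n" "(\<lambda>x. \<phi> x ^ Suc m) = (\<lambda>x. \<phi> x ^ Suc n)"
      unfolding inj_def by blast
    then obtain m n where mn: "m < n" "(\<lambda>x. \<phi> x ^ Suc m) = (\<lambda>x. \<phi> x ^ Suc n)"
      by (cases m n rule: linorder_cases) metis+
    have "\<phi> x ^ (n - m) = 1" if x: "x \<in> carrier G" for x
    proof -
      have "\<phi> x ^ Suc m * \<phi> x ^ (n - m) = \<phi> x ^ Suc n"
        using mn(1) by (simp only: power_add[symmetric]) simp
      also have "\<dots> = \<phi> x ^ Suc m * 1"
        using fun_cong[OF mn(2), of x] by (simp only: mult_1_right)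
      finally have "\<phi> x ^ Suc m * \<phi> x ^ (n - m) = \<phi> x ^ Suc m * 1" .
      moreover have "\<phi> x \<noteq> 0" using character_norm[OF \<phi> x] by auto
      ultimately show ?thesis by simp
    qed
    then have "\<phi> ` carrier G \<subseteq> {z. z ^ (n - m) = 1}" by auto
    moreover have "finite {z :: complex. z ^ (n - m) = 1}"
      using mn(1) by (intro finite_roots_unity) simp
    ultimately show ?thesis by (rule finite_subset)
  qed
  let ?e = "\<lambda>x. \<lambda>\<phi>\<in>?X. \<phi> x"
  have "inj_on ?e (carrier G)"
  proof (rule inj_onI, rule ccontr)
    fix x y assume x: "x \<in> carrier G" and y: "y \<in> carrier G" and eq: "?e x = ?e y" and ne: "x \<noteq> y"
    let ?z = "inv x \<otimes> y"
    have z: "?z \<in> carrier G" using x y by simp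
    have "?z \<noteq> \<one>" using mult_inv_cancel[OF x y] x ne by auto
    then obtain V where V: "openin T V" "\<one> \<in> V" "?z \<notin> V"
      using assms(1) z unfolding Hausdorff_space_def disjnt_def
      by (metis (no_types, lifting) Int_iff empty_iff one_closed topspace_eq)
    then obtain F \<delta> where F: "\<forall>\<phi>\<in>F. continuous_character \<phi>" "\<delta> > 0"
      "\<forall>x\<in>carrier G. (\<forall>\<phi>\<in>F. norm (\<phi> x - 1) < \<delta>) \<longrightarrow> x \<in> V"
      using characters_generate[of V] unfolding nbhd_def by blast
    have "\<phi> ?z = 1" if "\<phi> \<in> F" for \<phi>
    proof -
      have \<phi>: "continuous_character \<phi>" using F(1) that by blast
      have "\<phi> x = \<phi> y" using fun_cong[OF eq, of \<phi>] \<phi> by simp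
      then show ?thesis
        using x y character_cnj[OF \<phi> y]
        by (simp add: character_mult[OF \<phi>] character_inv[OF \<phi>] mult.commute)
    qed
    then have "\<forall>\<phi>\<in>F. norm (\<phi> ?z - 1) < \<delta>" using F(2) by (metis diff_self norm_zero)
    then have "?z \<in> V" using F(3) z by blast
    then show False using V(3) by blast
  qed
  moreover have "?e ` carrier G \<subseteq> (\<Pi>\<^sub>E \<phi>\<in>?X. \<phi> ` carrier G)"
    by (intro image_subsetI restrict_PiE_iff[THEN iffD2] ballI imageI)
  then have "finite (?e ` carrier G)"
    by (rule finite_subset) (intro finite_PiE fin torsion, simp)
  ultimately show ?thesis using finite_imageD by blast
qed

text \<open>By \<open>characters_generate\<close>, finitely many conditions of the form
  \<open>norm (\<phi> x - q) < 1 / Suc n\<close> describe a base. Taking \<open>q\<close> from a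
  countable dense set leaves as many conditions as characters, up to a countable factor, and an
  infinite \<open>B\<close> absorbs both this factor and the passage to finite sets.\<close>

lemma weight_ordLeq_characters:
  assumes B: "infinite B" and X: "|Collect continuous_character| \<le>o |B|"
  shows "weight T \<le>o |B|"
proof -
  let ?X = "Collect continuous_character"
  obtain D :: "complex set" where D: "countable D" "\<And>A. open A \<Longrightarrow> A \<noteq> {} \<Longrightarrow> \<exists>d\<in>D. d \<in> A"
    by (rule countable_dense_setE) blast
  define I where "I = ?X \<times> (D \<times> (UNIV :: nat set))"
  have DB: "|D \<times> (UNIV :: nat set)| \<le>o |B|" using D(1) B by (intro countable_ordLeq_infinite) auto
  have "|I| \<le>o |B|"
    unfolding I_def by (rule Times_ordLeq_infinite[OF B X DB])
  then have IB: "|Fpow I| \<le>o |B|" using B by (intro Fpow_ordLeq_infinite)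
  define cell where "cell F = {x \<in> carrier G. \<forall>(\<phi>, q, n)\<in>F. norm (\<phi> x - q) < 1 / Suc n}" for F :: "(('a \<Rightarrow> complex) \<times> complex \<times> nat) set"
  have "topology_base T (cell ` Fpow I)"
    unfolding topology_base_iff
  proof (intro conjI ballI allI impI)
    fix A assume "A \<in> cell ` Fpow I"
    then obtain F where F: "finite F" "F \<subseteq> I" "A = cell F" by (auto simp: Fpow_def)
    have "openin T (cell F)" using F(1,2)
    proof (induction F rule: finite_induct)
      case empty
      have "cell {} = topspace T" by (simp add: cell_def topspace_eq)
      then show ?case by simp
    next
      case (insert p F)
      obtain \<phi> q n where p: "p = (\<phi>, q, n)" by (cases p) auto
      have \<phi>: "continuous_character \<phi>" using insert.prems p by (auto simp: I_def)
      have "openin T {x \<in> topspace T. \<phi> x \<in> ball q (1 / Suc n)}"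
        using ucont_continuous_map[OF algebra_ucont[OF character_algebra[OF \<phi>]]]
        by (rule openin_continuous_map_preimage) (rule open_ball[THEN open_openin[THEN iffD1]])
      moreover have "cell (insert p F) = {x \<in> topspace T. \<phi> x \<in> ball q (1 / Suc n)} \<inter> cell F"
        unfolding p by (auto simp: cell_def topspace_eq dist_norm norm_minus_commute)
      ultimately show ?case using insert by (auto intro: openin_Int)
    qed
    then show "openin T A" using F(3) by simp
  next
    fix U x assume Ux: "openin T U \<and> x \<in> U"
    then have x: "x \<in> carrier G" using openin_subset topspace_eq by blast
    \<comment> \<open>\<open>U\<close> translated back to the identity, where
      \<open>characters_generate\<close> applies.\<close>
    let ?V = "{y \<in> carrier G. x \<otimes> y \<in> U}"
    have "openin T ?V" using openin_translate[of "inv x" U] x Ux by simp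
    then have "nbhd ?V" using x Ux by (simp add: nbhd_def)
    from characters_generate[OF this] obtain F \<delta> where F: "finite F" "\<forall>\<phi>\<in>F. continuous_character \<phi>"
      "\<delta> > 0" "\<forall>x\<in>carrier G. (\<forall>\<phi>\<in>F. norm (\<phi> x - 1) < \<delta>) \<longrightarrow> x \<in> ?V"
      by (elim exE conjE) (rule that)
    \<comment> \<open>Half of \<open>\<delta>\<close>, because \<open>\<phi> z\<close> and
      \<open>\<phi> x\<close> are compared through the common centre
      \<open>q \<phi>\<close>.\<close>
    obtain n where n: "1 / Suc n < \<delta> / 2"
      using reals_Archimedean[of "\<delta>/2"] F(3) by (auto simp: inverse_eq_divide)
    have "\<exists>q\<in>D. q \<in> ball (\<phi> x) (1 / Suc n)" for \<phi> by (rule D(2)) auto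
    then obtain q where q: "\<And>\<phi>. q \<phi> \<in> D" "\<And>\<phi>. q \<phi> \<in> ball (\<phi> x) (1 / Suc n)" by metis
    let ?F = "(\<lambda>\<phi>. (\<phi>, q \<phi>, n)) ` F"
    have "?F \<in> Fpow I" using F(1,2) q(1) by (auto simp: Fpow_def I_def)
    moreover have "x \<in> cell ?F" using x q(2) by (simp add: cell_def dist_norm)
    moreover have "cell ?F \<subseteq> U"
    proof
      fix z assume z: "z \<in> cell ?F"
      then have zG: "z \<in> carrier G" by (simp add: cell_def)
      have "norm (\<phi> (inv x \<otimes> z) - 1) < \<delta>" if "\<phi> \<in> F" for \<phi>
      proof -
        have \<phi>: "continuous_character \<phi>" using F(2) that by blast
        have "dist (\<phi> z) (q \<phi>) < 1 / Suc n" using z that by (auto simp: cell_def dist_norm)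
        moreover have "dist (\<phi> x) (q \<phi>) < 1 / Suc n" using q(2)[of \<phi>] by simp
        ultimately have d: "dist (\<phi> z) (\<phi> x) < \<delta>" using n by metric
        have "\<phi> (inv x \<otimes> z) - 1 = cnj (\<phi> x) * (\<phi> z - \<phi> x)"
          using x zG character_cnj[OF \<phi> x]
          by (simp add: character_mult[OF \<phi>] character_inv[OF \<phi>] algebra_simps)
        then show ?thesis using d character_norm[OF \<phi> x] by (simp add: norm_mult dist_norm)
      qed
      then have "inv x \<otimes> z \<in> ?V" using F(4) x zG by simp
      then show "z \<in> U" using mult_inv_cancel[OF x zG] by simp
    qed
    ultimately show "\<exists>A\<in>cell ` Fpow I. x \<in> A \<and> A \<subseteq> U" by blast
  qed
  then have "weight T \<le>o |cell ` Fpow I|" by (rule weight_ordLeq)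
  also have "|cell ` Fpow I| \<le>o |Fpow I|" by (rule card_of_image)
  also have "|Fpow I| \<le>o |B|" by (rule IB)
  finally show ?thesis .
qed

text \<open>A character is encoded, up to uniform distance \<open>\<delta>\<close> on \<open>C\<close>, by finitely many pairs of a
  basic open set and an approximate value taken from a fixed finite net.\<close>

lemma characters_ordLeq_Fpow:
  assumes C: "compactin T C" and d: "\<delta> > 0"
    and sep: "\<And>\<phi> \<psi>. continuous_character \<phi> \<Longrightarrow> continuous_character \<psi> \<Longrightarrow>
      \<forall>x\<in>C. norm (\<phi> x - \<psi> x) < \<delta> \<Longrightarrow> \<phi> = \<psi>"
    and base: "topology_base (subtopology T C) \<B>"
  shows "\<exists>N :: complex set. finite N \<and> |Collect continuous_character| \<le>o |Fpow (\<B> \<times> N)|"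
proof -
  let ?X = "Collect continuous_character"
  have CG: "C \<subseteq> carrier G" using C compactin_subset_topspace topspace_eq by blast
  \<comment> \<open>Radius \<open>\<delta>/2\<close>, so that two characters sharing a code are less
    than \<open>\<delta>\<close> apart.\<close>
  have "sphere (0::complex) 1 \<subseteq> (\<Union>q\<in>sphere 0 1. ball q (\<delta>/2))" using d by auto
  then obtain N where N: "N \<subseteq> sphere (0::complex) 1" "finite N" "sphere 0 1 \<subseteq> (\<Union>q\<in>N. ball q (\<delta>/2))"
    using compactE_image[OF compact_sphere[of "0::complex" 1], of "sphere 0 1" "\<lambda>q. ball q (\<delta>/2)"]
    by (metis open_ball)
  have b: "\<And>B. B \<in> \<B> \<Longrightarrow> openin (subtopology T C) B"
    "\<And>U x. openin (subtopology T C) U \<Longrightarrow> x \<in> U \<Longrightarrow> \<exists>B\<in>\<B>. x \<in> B \<and> B \<subseteq> U"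
    using base unfolding topology_base_iff by blast+
  define codes where "codes \<phi> E \<longleftrightarrow> E \<in> Fpow (\<B> \<times> N) \<and>
    (\<forall>x\<in>C. \<exists>p\<in>E. x \<in> fst p) \<and> (\<forall>p\<in>E. \<forall>y\<in>fst p. norm (\<phi> y - snd p) < \<delta>/2)" for \<phi> :: "'a \<Rightarrow> complex" and E
  have ex: "\<exists>E. codes \<phi> E" if \<phi>: "continuous_character \<phi>" for \<phi>
  proof -
    \<comment> \<open>All admissible pairs. Their first components cover \<open>C\<close> by
      continuity of \<open>\<phi>\<close>, and compactness of \<open>C\<close> reduces them to a
      finite code.\<close>
    let ?P = "{p \<in> \<B> \<times> N. \<forall>y\<in>fst p. norm (\<phi> y - snd p) < \<delta>/2}"
    have cont: "continuous_map (subtopology T C) euclidean \<phi>"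
      using ucont_continuous_map[OF algebra_ucont[OF character_algebra[OF \<phi>]]]
      by (rule continuous_map_from_subtopology)
    have "\<exists>p\<in>?P. x \<in> fst p" if x: "x \<in> C" for x
    proof -
      have "\<phi> x \<in> sphere 0 1" using character_norm[OF \<phi>, of x] x CG by auto
      then obtain q where q: "q \<in> N" "\<phi> x \<in> ball q (\<delta>/2)" using N(3) by blast
      have "openin (subtopology T C) {y \<in> topspace (subtopology T C). \<phi> y \<in> ball q (\<delta>/2)}"
        using cont by (rule openin_continuous_map_preimage) (rule open_ball[THEN open_openin[THEN iffD1]])
      moreover have "x \<in> {y \<in> topspace (subtopology T C). \<phi> y \<in> ball q (\<delta>/2)}"
        using x q(2) CG by (auto simp: topspace_eq)
      ultimately obtain B where B: "B \<in> \<B>" "x \<in> B" "B \<subseteq> {y \<in> topspace (subtopology T C). \<phi> y \<in> ball q (\<delta>/2)}"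
        using b(2) by blast
      then have "(B, q) \<in> ?P" using q(1) by (auto simp: dist_norm norm_minus_commute)
      then show ?thesis using B(2) by force
    qed
    then have cover: "topspace (subtopology T C) \<subseteq> \<Union> (fst ` ?P)" using CG by (auto simp: topspace_eq)
    have cs: "compact_space (subtopology T C)" using C by (simp add: compactin_subspace)
    have "\<exists>\<F>. finite \<F> \<and> \<F> \<subseteq> fst ` ?P \<and> topspace (subtopology T C) \<subseteq> \<Union> \<F>"
    proof (rule cs[unfolded compact_space_alt, rule_format], intro conjI ballI cover)
      fix B assume "B \<in> fst ` ?P"
      then show "openin (subtopology T C) B" using b(1) by auto
    qed
    then obtain \<F> where \<F>: "finite \<F>" "\<F> \<subseteq> fst ` ?P" "topspace (subtopology T C) \<subseteq> \<Union> \<F>"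
      by (elim exE conjE) (rule that)
    obtain E where E: "finite E" "E \<subseteq> ?P" "\<F> = fst ` E" using finite_subset_image[OF \<F>(1,2)] by blast
    have "codes \<phi> E"
      unfolding codes_def
    proof (intro conjI ballI)
      show "E \<in> Fpow (\<B> \<times> N)" using E by (auto simp: Fpow_def)
      show "\<exists>p\<in>E. x \<in> fst p" if "x \<in> C" for x using \<F>(3) E(3) that CG by (auto simp: topspace_eq)
      show "norm (\<phi> y - snd p) < \<delta>/2" if "p \<in> E" "y \<in> fst p" for p y using E(2) that by blast
    qed
    then show ?thesis by blast
  qed
  define code where "code \<phi> = (SOME E. codes \<phi> E)" for \<phi>
  have code: "codes \<phi> (code \<phi>)" if "continuous_character \<phi>" for \<phi>
    unfolding code_def using ex[OF that] by (rule someI_ex)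
  have "inj_on code ?X"
  proof (rule inj_onI)
    fix \<phi> \<psi> assume "\<phi> \<in> ?X" "\<psi> \<in> ?X" and eq: "code \<phi> = code \<psi>"
    then have \<phi>: "continuous_character \<phi>" and \<psi>: "continuous_character \<psi>" by auto
    have "norm (\<phi> x - \<psi> x) < \<delta>" if x: "x \<in> C" for x
    proof -
      obtain p where p: "p \<in> code \<phi>" "x \<in> fst p" using code[OF \<phi>] x unfolding codes_def by blast
      have "norm (\<phi> x - snd p) < \<delta>/2" using code[OF \<phi>] p unfolding codes_def by blast
      moreover have "norm (\<psi> x - snd p) < \<delta>/2" using code[OF \<psi>] p eq unfolding codes_def by metis
      ultimately show ?thesis unfolding dist_norm[symmetric] by metric
    qed
    then show "\<phi> = \<psi>" using sep[OF \<phi> \<psi>] by blast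
  qed
  moreover have "code ` ?X \<subseteq> Fpow (\<B> \<times> N)" using code by (auto simp: codes_def)
  ultimately have "|?X| \<le>o |Fpow (\<B> \<times> N)|" by (intro card_of_ordLeqI) auto
  then show ?thesis using N(2) by (intro exI[of _ N] conjI)
qed

text \<open>Codes compare the number of characters with a minimal base of \<open>C\<close>, and
  characters in turn bound the weight of the whole group. Both comparisons absorb finite sets into
  an infinite cardinal, hence the case distinction; with finitely many characters the group is
  finite, and the compact set is the group itself.\<close>

lemma w_compactI:
  assumes T: "Hausdorff_space T" and C: "compactin T C" and d: "\<delta> > 0"
    and sep: "\<And>\<phi> \<psi>. continuous_character \<phi> \<Longrightarrow> continuous_character \<psi> \<Longrightarrow>
      \<forall>x\<in>C. norm (\<phi> x - \<psi> x) < \<delta> \<Longrightarrow> \<phi> = \<psi>"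
  shows "w_compact T"
proof (cases "finite (Collect continuous_character)")
  case True
  have "compactin T (topspace T)"
    using finite_characters_imp_finite[OF T True] by (intro finite_imp_compactin) (auto simp: topspace_eq)
  moreover have "weight (subtopology T (topspace T)) =o weight T"
    unfolding subtopology_topspace weight_def by (rule card_of_refl)
  ultimately show ?thesis unfolding w_compact_def by blast
next
  case False
  obtain \<B> where \<B>: "minimal_base (subtopology T C) \<B>" using minimal_base_exists by blast
  then have base: "topology_base (subtopology T C) \<B>" by (simp add: minimal_base_def)
  obtain N :: "complex set" where N: "finite N" "|Collect continuous_character| \<le>o |Fpow (\<B> \<times> N)|"
    using characters_ordLeq_Fpow[OF C d _ base] sep by blast
  \<comment> \<open>A finite base would leave only finitely many codes.\<close>
  have "infinite \<B>"
  proof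
    assume "finite \<B>"
    then have "finite (Fpow (\<B> \<times> N))" using N(1) by (intro finite_subset[OF Fpow_subset_Pow]) simp
    then show False using False N(2) card_of_ordLeq_finite by blast
  qed
  have "|N| \<le>o |\<B>|" using N(1) \<open>infinite \<B>\<close> by (intro countable_ordLeq_infinite countable_finite)
  then have "|\<B> \<times> N| \<le>o |\<B>|"
    by (intro Times_ordLeq_infinite \<open>infinite \<B>\<close> card_of_mono1 order.refl)
  then have "|Fpow (\<B> \<times> N)| \<le>o |\<B>|" using \<open>infinite \<B>\<close> by (intro Fpow_ordLeq_infinite)
  with N(2) have "|Collect continuous_character| \<le>o |\<B>|" by (rule ordLeq_transitive)
  then have "weight T \<le>o |\<B>|" using \<open>infinite \<B>\<close> by (intro weight_ordLeq_characters)
  also have "|\<B>| =o weight (subtopology T C)" by (rule ordIso_symmetric[OF weight_eq[OF \<B>]])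
  finally have "weight (subtopology T C) =o weight T"
    using weight_subtopology_ordLeq[of T C] unfolding ordIso_iff_ordLeq by blast
  then show ?thesis unfolding w_compact_def using C by blast
qed

end

section \<open>Determining subgroups\<close>

text \<open>For \<open>w\<close> on the circle with positive real part,
  \<open>(norm (w + 1))\<^sup>2 \<ge> 2\<close>, so squaring \<open>w\<close> at least doubles the
  squared distance to 1. Repeated squaring of a \<open>z\<close> other than 1 would push this beyond
  its maximum 4.\<close>

lemma no_small_subgroups_circle:
  fixes z :: complex
  assumes z: "norm z = 1" and pos: "\<And>n. Re (z ^ n) > 0"
  shows "z = 1"
proof -
  have norm_sq: "(norm (w + 1))\<^sup>2 = 2 + 2 * Re w" if "norm w = 1" for w :: complex
  proof -
    have "(Re w)\<^sup>2 + (Im w)\<^sup>2 = 1" using that cmod_power2[of w] by simp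
    then show ?thesis unfolding cmod_power2 by (simp add: power2_sum)
  qed
  have grow: "2 ^ n * (norm (z - 1))\<^sup>2 \<le> (norm (z ^ (2 ^ n) - 1))\<^sup>2" for n
  proof (induction n)
    case (Suc n)
    let ?w = "z ^ (2 ^ n)"
    have w: "norm ?w = 1" using z by (simp add: norm_power)
    have "z ^ (2 ^ Suc n) - 1 = (?w - 1) * (?w + 1)"
      by (simp add: power_mult power2_eq_square algebra_simps)
    then have eq: "(norm (z ^ (2 ^ Suc n) - 1))\<^sup>2 = (norm (?w - 1))\<^sup>2 * (norm (?w + 1))\<^sup>2"
      by (simp add: norm_mult power_mult_distrib)
    have "(norm (?w + 1))\<^sup>2 \<ge> 2" using norm_sq[OF w] pos[of "2 ^ n"] by simp
    then have "(norm (?w - 1))\<^sup>2 * 2 \<le> (norm (?w - 1))\<^sup>2 * (norm (?w + 1))\<^sup>2"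
      by (intro mult_left_mono) auto
    then show ?case using Suc eq by simp
  qed simp
  show ?thesis
  proof (rule ccontr)
    assume "z \<noteq> 1"
    then have a: "(norm (z - 1))\<^sup>2 > 0" by simp
    obtain n where "4 / (norm (z - 1))\<^sup>2 < 2 ^ n" using real_arch_pow[of 2] by auto
    then have "4 < 2 ^ n * (norm (z - 1))\<^sup>2" using a by (simp add: divide_less_eq)
    also have "\<dots> \<le> (norm (z ^ (2 ^ n) - 1))\<^sup>2" by (rule grow)
    also have "\<dots> \<le> 2\<^sup>2"
      using norm_triangle_ineq4[of "z ^ (2 ^ n)" 1] z by (intro power_mono) (auto simp: norm_power)
    finally show False by simp
  qed
qed

lemma charactersD:
  assumes "\<phi> \<in> characters G T"
  shows "\<And>x y. x \<in> carrier G \<Longrightarrow> y \<in> carrier G \<Longrightarrow> \<phi> (x \<otimes>\<^bsub>G\<^esub> y) = \<phi> x * \<phi> y"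
    and "\<And>x. x \<in> carrier G \<Longrightarrow> norm (\<phi> x) = 1"
    and "\<phi> \<in> continuous_maps T circle_topology"
  using assms by (auto simp: characters_def hom_def circle_group_def)

lemma (in topological_group) trivial_character:
  shows "(\<lambda>x\<in>carrier G. 1) \<in> characters G T"
proof -
  have "continuous_map T circle_topology (\<lambda>x. 1)"
    by (rule continuous_map_const[THEN iffD2]) (simp add: circle_topology_def)
  then have "continuous_map T circle_topology (\<lambda>x\<in>carrier G. 1)"
    by (rule continuous_map_eq) (simp add: topspace_eq)
  moreover have "(\<lambda>x\<in>carrier G. 1) \<in> hom G circle_group"
    by (rule homI) (simp_all add: circle_group_def)
  ultimately show ?thesis by (simp add: characters_def continuous_maps_def topspace_eq)
qed

lemma (in topological_group) trivial_character_open: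
  assumes "compact_space T"
  shows "openin (dual_topology G T) {\<lambda>x\<in>carrier G. 1}"
proof -
  \<comment> \<open>The open right half of the circle. Together with the compact set
    \<open>topspace T\<close> it gives a basic open set of maps that contains no nontrivial
    character.\<close>
  define V where "V = {z \<in> sphere (0::complex) 1. Re z > 0}"
  define U where "U = {f \<in> continuous_maps T circle_topology. f ` topspace T \<subseteq> V}"
  have "open {z. Re z > 0}" by (rule open_halfspace_Re_gt)
  then have "openin circle_topology (sphere 0 1 \<inter> {z. Re z > 0})"
    unfolding circle_topology_def by (rule openin_open_Int)
  moreover have "sphere 0 1 \<inter> {z. Re z > 0} = V" by (auto simp: V_def)
  ultimately have "openin circle_topology V" by simp
  moreover have "compactin T (topspace T)" using assms by (simp add: compact_space_def)
  ultimately have "openin (compact_open_topology T circle_topology) U"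
    unfolding compact_open_topology_def U_def
    by (intro topology_generated_by_Basis CollectI exI conjI) auto
  moreover have "{\<lambda>x\<in>carrier G. 1} = U \<inter> characters G T"
  proof (intro equalityI subsetI)
    fix \<phi> assume "\<phi> \<in> {\<lambda>x\<in>carrier G. 1 :: complex}"
    then have "\<phi> = (\<lambda>x\<in>carrier G. 1)" by simp
    then show "\<phi> \<in> U \<inter> characters G T"
      using trivial_character charactersD(3)[OF trivial_character]
      by (auto simp: U_def V_def topspace_eq)
  next
    fix \<phi> assume \<phi>: "\<phi> \<in> U \<inter> characters G T"
    then have \<phi>c: "\<phi> \<in> characters G T" and \<phi>U: "\<phi> ` carrier G \<subseteq> V" by (auto simp: U_def topspace_eq)
    have "\<phi> x = 1" if x: "x \<in> carrier G" for x
    proof (rule no_small_subgroups_circle)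
      show "norm (\<phi> x) = 1" using charactersD(2)[OF \<phi>c x] .
      fix n :: nat
      have "\<phi> \<one> * \<phi> \<one> = \<phi> \<one>" using charactersD(1)[OF \<phi>c, of \<one> \<one>] by simp
      moreover have "\<phi> \<one> \<noteq> 0" using charactersD(2)[OF \<phi>c, of \<one>] by auto
      ultimately have one: "\<phi> \<one> = 1" by simp
      have "\<phi> (x [^] n) = \<phi> x ^ n"
        by (induction n) (simp_all add: one charactersD(1)[OF \<phi>c] x)
      moreover have "\<phi> (x [^] n) \<in> V" using \<phi>U x by blast
      ultimately show "Re (\<phi> x ^ n) > 0" by (simp add: V_def)
    qed
    moreover have "\<phi> \<in> extensional (carrier G)"
      using charactersD(3)[OF \<phi>c] by (simp add: continuous_maps_def topspace_eq)
    ultimately have "\<phi> = (\<lambda>x\<in>carrier G. 1)" by (intro extensionalityI[of _ "carrier G"]) auto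
    then show "\<phi> \<in> {\<lambda>x\<in>carrier G. 1}" by simp
  qed
  ultimately show ?thesis unfolding dual_topology_def openin_subtopology by blast
qed

text \<open>Near the constant map 1, uniform closeness on a compact set suffices to stay in a
  subbasic set. Intersections take the union of the compact sets and the smaller radius, so the
  property passes to all open sets by induction.\<close>

lemma compact_open_nbhd_one:
  assumes "openin (compact_open_topology X circle_topology) W" "(\<lambda>x\<in>topspace X. 1) \<in> W"
  shows "\<exists>K \<delta>. compactin X K \<and> \<delta> > 0 \<and>
    (\<forall>g\<in>continuous_maps X circle_topology. (\<forall>x\<in>K. norm (g x - 1) < \<delta>) \<longrightarrow> g \<in> W)"
proof -
  let ?e = "\<lambda>x\<in>topspace X. 1 :: complex"
  from assms(1) have "generate_topology_on
      {{f \<in> continuous_maps X circle_topology. f ` K \<subseteq> U} | K U. compactin X K \<and> openin circle_topology U} W"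
    unfolding compact_open_topology_def by (rule openin_topology_generated_by)
  then show ?thesis using assms(2)
  proof (induction W rule: generate_topology_on.induct)
    case Empty
    then show ?case by simp
  next
    case (Int a b)
    from Int obtain K \<delta> where 1: "compactin X K" "\<delta> > 0"
      "\<forall>g\<in>continuous_maps X circle_topology. (\<forall>x\<in>K. norm (g x - 1) < \<delta>) \<longrightarrow> g \<in> a" by auto
    from Int obtain K' \<delta>' where 2: "compactin X K'" "\<delta>' > 0"
      "\<forall>g\<in>continuous_maps X circle_topology. (\<forall>x\<in>K'. norm (g x - 1) < \<delta>') \<longrightarrow> g \<in> b" by auto
    show ?case
      using 1 2 by (intro exI[of _ "K \<union> K'"] exI[of _ "min \<delta> \<delta>'"]) (auto intro: compactin_Un)
  next
    case (UN \<K>)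
    then obtain k where "k \<in> \<K>" "?e \<in> k" by blast
    with UN.IH[OF this] show ?case by blast
  next
    case (Basis s)
    then obtain K U where s: "s = {f \<in> continuous_maps X circle_topology. f ` K \<subseteq> U}"
      and K: "compactin X K" and U: "openin circle_topology U" by blast
    show ?case
    \<comment> \<open>For empty \<open>K\<close> the set \<open>U\<close> need not contain 1, but
      then \<open>s\<close> consists of all continuous maps and any radius will do.\<close>
    proof (cases "K = {}")
      case True
      then show ?thesis using K s by (intro exI[of _ K] exI[of _ 1]) auto
    next
      case False
      have KX: "K \<subseteq> topspace X" using K by (rule compactin_subset_topspace)
      then have "1 \<in> U" using Basis(2) False unfolding s by auto
      then obtain \<delta> where d: "\<delta> > 0" "ball 1 \<delta> \<inter> sphere 0 1 \<subseteq> U"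
        using U unfolding circle_topology_def openin_contains_ball by blast
      have "g \<in> s" if g: "g \<in> continuous_maps X circle_topology" and near: "\<forall>x\<in>K. norm (g x - 1) < \<delta>" for g
      proof -
        have "g x \<in> U" if x: "x \<in> K" for x
        proof -
          have "g x \<in> topspace circle_topology"
            using g x KX unfolding continuous_maps_def continuous_map_def by blast
          then have "g x \<in> sphere 0 1" by (simp add: circle_topology_def)
          moreover have "g x \<in> ball 1 \<delta>" using near x by (simp add: dist_norm norm_minus_commute)
          ultimately show ?thesis using d(2) by blast
        qed
        then show ?thesis using g s by blast
      qed
      then show ?thesis using K d(1) by (intro exI[of _ K] exI[of _ \<delta>]) blast
    qed
  qed
qed

text \<open>The trivial character is isolated in the dual of \<open>G\<close>. The restriction map
  is open and carries it to the trivial character of \<open>D\<close>, which is thus isolated too;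
  \<open>compact_open_nbhd_one\<close> makes this quantitative.\<close>

lemma determines_imp_compact:
  assumes "topological_group G T" "compact_space T" "subgroup D G" "determines D G T"
  shows "\<exists>K \<delta>. compactin (subtopology T D) K \<and> \<delta> > 0 \<and>
    (\<forall>\<phi>\<in>characters (G\<lparr>carrier := D\<rparr>) (subtopology T D).
      (\<forall>x\<in>K. norm (\<phi> x - 1) < \<delta>) \<longrightarrow> \<phi> = (\<lambda>x\<in>D. 1))"
proof -
  interpret topological_group G T by fact
  let ?S = "subtopology T D"
  let ?X = "characters (G\<lparr>carrier := D\<rparr>) ?S"
  have DG: "D \<subseteq> carrier G" using subgroup.subset[OF assms(3)] .
  then have topD: "topspace ?S = D" by (auto simp: topspace_eq)
  have hom: "homeomorphic_map (dual_topology G T) (dual_topology (G\<lparr>carrier := D\<rparr>) ?S) (\<lambda>\<phi>. restrict \<phi> D)"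
    using assms(4) unfolding determines_def by (simp add: Let_def)
  have "openin (dual_topology G T) {\<lambda>x\<in>carrier G. 1}" by (rule trivial_character_open[OF assms(2)])
  then have "openin (dual_topology (G\<lparr>carrier := D\<rparr>) ?S) ((\<lambda>\<phi>. restrict \<phi> D) ` {\<lambda>x\<in>carrier G. 1})"
    using homeomorphic_imp_open_map[OF hom] unfolding open_map_def by blast
  moreover have "restrict (\<lambda>x\<in>carrier G. 1 :: complex) D = (\<lambda>x\<in>D. 1)"
    using DG by (auto simp: restrict_def fun_eq_iff)
  ultimately have "openin (dual_topology (G\<lparr>carrier := D\<rparr>) ?S) {\<lambda>x\<in>D. 1}" by simp
  then obtain W where W: "openin (compact_open_topology ?S circle_topology) W" "{\<lambda>x\<in>D. 1} = W \<inter> ?X"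
    unfolding dual_topology_def openin_subtopology by blast
  then have "(\<lambda>x\<in>topspace ?S. 1) \<in> W" unfolding topD by blast
  from compact_open_nbhd_one[OF W(1) this] obtain K \<delta> where K: "compactin ?S K" "\<delta> > 0"
    "\<forall>g\<in>continuous_maps ?S circle_topology. (\<forall>x\<in>K. norm (g x - 1) < \<delta>) \<longrightarrow> g \<in> W"
    by (elim exE conjE) (rule that)
  have "\<phi> = (\<lambda>x\<in>D. 1)" if \<phi>: "\<phi> \<in> ?X" and near: "\<forall>x\<in>K. norm (\<phi> x - 1) < \<delta>" for \<phi>
  proof -
    have "\<phi> \<in> W" using bspec[OF K(3) charactersD(3)[OF \<phi>]] near by blast
    then show ?thesis using W(2) \<phi> by blast
  qed
  then show ?thesis using K(1,2) by (intro exI[of _ K] exI[of _ \<delta>]) blast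
qed

text \<open>The preimage of \<open>V\<close> under \<open>f\<close> is the trace on \<open>D\<close>
  of an open \<open>W\<close>. Translates of \<open>W\<close> by elements of \<open>D\<close> cover
  the compact group \<open>G\<close>, so finitely many suffice, and the images of these elements
  form the net.\<close>

lemma image_precompact_group:
  assumes "topological_group G T" "compact_space T" "comm_group G" "dense_subgroup D G T"
    and H: "topological_group H S" and f: "f \<in> epi (G\<lparr>carrier := D\<rparr>) H" "continuous_map (subtopology T D) S f"
  shows "precompact_group H S"
proof -
  interpret G: topological_group G T by fact
  interpret G: comm_group G by fact
  interpret H: topological_group H S by fact
  have D: "subgroup D G" and dense: "(T closure_of D) = topspace T"
    using assms(4) by (auto simp: dense_subgroup_def)
  interpret D: group "G\<lparr>carrier := D\<rparr>" using D by (rule G.subgroup_imp_group)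
  interpret f: group_hom "G\<lparr>carrier := D\<rparr>" H f
    using f(1) by unfold_locales (simp add: epi_def)
  have DG: "D \<subseteq> carrier G" using subgroup.subset[OF D] .
  have surj: "f ` D = carrier H" using f(1) by (simp add: epi_def)
  have fmult: "f (x \<otimes>\<^bsub>G\<^esub> y) = f x \<otimes>\<^bsub>H\<^esub> f y" if "x \<in> D" "y \<in> D" for x y
    using f.hom_mult[of x y] that by simp
  have finv: "f (inv\<^bsub>G\<^esub> x) = inv\<^bsub>H\<^esub> (f x)" if "x \<in> D" for x
    using f.hom_inv[of x] that G.m_inv_consistent[OF D that] by simp
  have comm: "comm_group H"
  proof (rule H.group_comm_groupI)
    fix x y assume "x \<in> carrier H" "y \<in> carrier H"
    then obtain a b where "a \<in> D" "x = f a" "b \<in> D" "y = f b" unfolding surj[symmetric] by blast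
    moreover from this have "a \<otimes>\<^bsub>G\<^esub> b = b \<otimes>\<^bsub>G\<^esub> a" using DG by (intro G.m_comm) auto
    ultimately show "x \<otimes>\<^bsub>H\<^esub> y = y \<otimes>\<^bsub>H\<^esub> x"
      using fmult[of a b] fmult[of b a] by simp
  qed
  have "\<exists>F. finite F \<and> F \<subseteq> carrier H \<and> (\<forall>x\<in>carrier H. \<exists>a\<in>F. inv\<^bsub>H\<^esub> a \<otimes>\<^bsub>H\<^esub> x \<in> V)"
    if V: "openin S V" "\<one>\<^bsub>H\<^esub> \<in> V" for V
  proof -
    have "openin (subtopology T D) {x \<in> topspace (subtopology T D). f x \<in> V}"
      using f(2) V(1) by (rule openin_continuous_map_preimage)
    moreover have "topspace (subtopology T D) = D" using DG by (auto simp: G.topspace_eq)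
    ultimately obtain W where W: "openin T W" "{x \<in> D. f x \<in> V} = W \<inter> D"
      by (auto simp: openin_subtopology)
    have "f \<one>\<^bsub>G\<^esub> = \<one>\<^bsub>H\<^esub>" using f.hom_one by simp
    then have "\<one>\<^bsub>G\<^esub> \<in> {x \<in> D. f x \<in> V}" using V(2) subgroup.one_closed[OF D] by simp
    then have oneW: "\<one>\<^bsub>G\<^esub> \<in> W" unfolding W(2) by simp
    define N where "N d = {x \<in> topspace T. inv\<^bsub>G\<^esub> d \<otimes>\<^bsub>G\<^esub> x \<in> W}" for d
    have openN: "openin T (N d)" if d: "d \<in> D" for d
    proof -
      have "continuous_map T (prod_topology T T) (\<lambda>x. (inv\<^bsub>G\<^esub> d, x))"
        using d DG by (intro continuous_map_pairedI) (auto simp: G.topspace_eq)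
      from continuous_map_compose[OF this G.continuous_mult]
      have "continuous_map T T (\<lambda>x. inv\<^bsub>G\<^esub> d \<otimes>\<^bsub>G\<^esub> x)" by (simp add: o_def)
      then show ?thesis unfolding N_def using W(1) by (rule openin_continuous_map_preimage)
    qed
    \<comment> \<open>Density: the elements \<open>d\<close> with \<open>inv d \<otimes> x\<close>
      in \<open>W\<close> form an open neighbourhood of \<open>x\<close>, which must meet
      \<open>D\<close>.\<close>
    have cover: "\<exists>d\<in>D. x \<in> N d" if x: "x \<in> topspace T" for x
    proof -
      have xG: "x \<in> carrier G" using x by (simp add: G.topspace_eq)
      have "continuous_map T (prod_topology T T) (\<lambda>d. (inv\<^bsub>G\<^esub> d, x))"
        using x G.continuous_inv by (intro continuous_map_pairedI) auto
      from continuous_map_compose[OF this G.continuous_mult]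
      have "continuous_map T T (\<lambda>d. inv\<^bsub>G\<^esub> d \<otimes>\<^bsub>G\<^esub> x)" by (simp add: o_def)
      then have o: "openin T {d \<in> topspace T. inv\<^bsub>G\<^esub> d \<otimes>\<^bsub>G\<^esub> x \<in> W}" (is "openin T ?N")
        using W(1) by (rule openin_continuous_map_preimage)
      have xN: "x \<in> ?N" using x xG oneW by simp
      have "x \<in> (T closure_of D)" using dense x by simp
      then have "\<exists>d. d \<in> D \<and> d \<in> ?N"
        unfolding in_closure_of by (elim conjE allE[of _ ?N]) (rule mp, assumption, intro conjI xN o)
      then obtain d where "d \<in> D" "inv\<^bsub>G\<^esub> d \<otimes>\<^bsub>G\<^esub> x \<in> W" by auto
      then show ?thesis using x by (auto simp: N_def)
    qed
    have "\<exists>\<F>. finite \<F> \<and> \<F> \<subseteq> N ` D \<and> topspace T \<subseteq> \<Union> \<F>"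
      using cover openN by (intro assms(2)[unfolded compact_space_alt, rule_format] conjI ballI) auto
    then obtain \<F> where \<F>: "finite \<F>" "\<F> \<subseteq> N ` D" "topspace T \<subseteq> \<Union> \<F>" by blast
    obtain E where E: "E \<subseteq> D" "finite E" "\<F> = N ` E" using finite_subset_image[OF \<F>(1,2)] by blast
    have "\<exists>a\<in>f ` E. inv\<^bsub>H\<^esub> a \<otimes>\<^bsub>H\<^esub> y \<in> V" if y: "y \<in> carrier H" for y
    proof -
      obtain x where x: "x \<in> D" "y = f x" using y unfolding surj[symmetric] by blast
      then obtain d where d: "d \<in> E" "x \<in> N d" using \<F>(3) E(3) DG by (auto simp: G.topspace_eq)
      then have dD: "d \<in> D" using E(1) by blast
      have inD: "inv\<^bsub>G\<^esub> d \<in> D" using subgroup.m_inv_closed[OF D dD] .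
      have "inv\<^bsub>G\<^esub> d \<otimes>\<^bsub>G\<^esub> x \<in> W \<inter> D"
        using d(2) subgroup.m_closed[OF D inD x(1)] by (simp add: N_def)
      then have "f (inv\<^bsub>G\<^esub> d \<otimes>\<^bsub>G\<^esub> x) \<in> V" unfolding W(2)[symmetric] by simp
      then have "inv\<^bsub>H\<^esub> (f d) \<otimes>\<^bsub>H\<^esub> y \<in> V" using fmult[OF inD x(1)] finv[OF dD] x(2) by simp
      then show ?thesis using d(1) by blast
    qed
    moreover have "f ` E \<subseteq> carrier H" using E(1) surj by blast
    ultimately show ?thesis using E(2) by (intro exI[of _ "f ` E"]) simp
  qed
  then show ?thesis
    by (intro precompact_group.intro precompact_group_axioms.intro comm H)
qed

theorem corollary2p4:
  fixes G :: "('a, 'm) monoid_scheme" and T :: "'a topology" and D :: "'a set"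
  assumes "topological_group G T" and "Hausdorff_space T" and "compact_space T"
    and "comm_group G"
    and "dense_subgroup D G T" and "determines D G T"
  shows "projectively_w_compact TYPE('b) (G\<lparr>carrier := D\<rparr>) (subtopology T D)"
  unfolding projectively_w_compact_def
proof (intro allI impI, elim conjE)
  fix H :: "'b monoid" and S f
  assume H: "topological_group H S" and S: "Hausdorff_space S"
    and f: "f \<in> epi (G\<lparr>carrier := D\<rparr>) H" "continuous_map (subtopology T D) S f"
  interpret G: topological_group G T by fact
  interpret H: precompact_group H S
    by (rule image_precompact_group[OF assms(1,3-5) H f])
  have D: "subgroup D G" using assms(5) by (simp add: dense_subgroup_def)
  have topD: "topspace (subtopology T D) = D" using subgroup.subset[OF D] by (auto simp: G.topspace_eq)
  have surj: "f ` D = carrier H" and hom: "f \<in> hom (G\<lparr>carrier := D\<rparr>) H"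
    using f(1) by (simp_all add: epi_def)
  have fD: "f x \<in> carrier H" if "x \<in> D" for x using surj that by blast
  obtain K \<delta> where K: "compactin (subtopology T D) K" "\<delta> > 0"
    "\<forall>\<phi>\<in>characters (G\<lparr>carrier := D\<rparr>) (subtopology T D).
      (\<forall>x\<in>K. norm (\<phi> x - 1) < \<delta>) \<longrightarrow> \<phi> = (\<lambda>x\<in>D. 1)"
    using determines_imp_compact[OF assms(1,3) D assms(6)] by (elim exE conjE) (rule that)
  have KD: "K \<subseteq> D" using compactin_subset_topspace[OF K(1)] topD by simp
  show "w_compact S"
  proof (rule H.w_compactI[OF S image_compactin[OF K(1) f(2)] K(2)])
    fix \<phi> \<psi> assume \<phi>: "H.continuous_character \<phi>" and \<psi>: "H.continuous_character \<psi>"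
      and near: "\<forall>x\<in>f ` K. norm (\<phi> x - \<psi> x) < \<delta>"
    \<comment> \<open>The quotient of the two characters. As \<open>\<psi>\<close> has modulus 1,
      its distance to 1 equals the distance of \<open>\<phi>\<close> to \<open>\<psi>\<close>;
      pulled back along \<open>f\<close> it is therefore a character of \<open>D\<close> close to 1
      on \<open>K\<close>, hence trivial, and surjectivity of \<open>f\<close> gives equality on
      \<open>H\<close>.\<close>
    let ?\<theta> = "\<lambda>y. \<phi> y * cnj (\<psi> y)"
    let ?\<xi> = "\<lambda>x\<in>D. ?\<theta> (f x)"
    have eq: "\<phi> y - \<psi> y = (?\<theta> y - 1) * \<psi> y" if "y \<in> carrier H" for y
      using H.character_cnj[OF \<psi> that] by (simp add: algebra_simps)
    have norm1: "norm (?\<theta> y) = 1" if "y \<in> carrier H" for y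
      using H.character_norm[OF \<phi> that] H.character_norm[OF \<psi> that] by (simp add: norm_mult)
    have "continuous_map S euclidean ?\<theta>"
      by (intro H.ucont_continuous_map H.ucont_ip H.character_algebra \<phi> \<psi>)
    from continuous_map_compose[OF f(2) this]
    have "continuous_map (subtopology T D) euclidean (\<lambda>x. ?\<theta> (f x))" by (simp add: o_def)
    then have "continuous_map (subtopology T D) euclidean ?\<xi>"
      by (rule continuous_map_eq) (simp only: topD restrict_apply')
    moreover have "?\<xi> \<in> topspace (subtopology T D) \<rightarrow> sphere 0 1"
      using norm1[OF fD] topD by auto
    ultimately have "continuous_map (subtopology T D) circle_topology ?\<xi>"
      unfolding circle_topology_def continuous_map_in_subtopology by simp
    moreover have "?\<xi> \<in> hom (G\<lparr>carrier := D\<rparr>) circle_group"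
    proof (rule homI)
      fix x assume "x \<in> carrier (G\<lparr>carrier := D\<rparr>)"
      then show "?\<xi> x \<in> carrier circle_group" using norm1[OF fD] by (simp add: circle_group_def)
    next
      fix x y assume "x \<in> carrier (G\<lparr>carrier := D\<rparr>)" "y \<in> carrier (G\<lparr>carrier := D\<rparr>)"
      then have x: "x \<in> D" and y: "y \<in> D" by auto
      have "f (x \<otimes>\<^bsub>G\<^esub> y) = f x \<otimes>\<^bsub>H\<^esub> f y" using hom_mult[OF hom, of x y] x y by simp
      then show "?\<xi> (x \<otimes>\<^bsub>G\<lparr>carrier := D\<rparr>\<^esub> y) = ?\<xi> x \<otimes>\<^bsub>circle_group\<^esub> ?\<xi> y"
        using x y subgroup.m_closed[OF D x y] fD
        by (simp add: circle_group_def H.character_mult[OF \<phi>] H.character_mult[OF \<psi>])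
    qed
    ultimately have "?\<xi> \<in> characters (G\<lparr>carrier := D\<rparr>) (subtopology T D)"
      unfolding characters_def continuous_maps_def topD by (intro IntI CollectI conjI restrict_extensional)
    moreover have "\<forall>x\<in>K. norm (?\<xi> x - 1) < \<delta>"
    proof
      fix x assume x: "x \<in> K"
      then have xD: "x \<in> D" using KD by blast
      have "norm (\<phi> (f x) - \<psi> (f x)) < \<delta>" using near x by blast
      then show "norm (?\<xi> x - 1) < \<delta>"
        unfolding eq[OF fD[OF xD]] norm_mult H.character_norm[OF \<psi> fD[OF xD]] using xD by simp
    qed
    ultimately have one: "?\<xi> = (\<lambda>x\<in>D. 1)" using K(3) by blast
    show "\<phi> = \<psi>"
    proof (rule H.algebra_ext[OF H.character_algebra[OF \<phi>] H.character_algebra[OF \<psi>]])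
      fix y assume y: "y \<in> carrier H"
      then obtain x where x: "x \<in> D" "y = f x" using surj by blast
      have "?\<theta> y = 1" using fun_cong[OF one, of x] x by simp
      then have "\<phi> y - \<psi> y = 0" unfolding eq[OF y] by simp
      then show "\<phi> y = \<psi> y" by simp
    qed
  qed
qed

end
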